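(* The system on $\mathbb{C}^5$ $$\begin{aligned}\dot x_1&=x_3x_5-x_2x_4,\\ \dot x_2&=x_4x_1-x_3x_5,\\ \dot x_3&=x_5x_2-x_4x_1,\\ \dot x_4&=x_1x_3-x_5x_2,\\ \dot x_5&=x_2x_4-x_1x_3\end{aligned}$$ has two and only two functionally independent meromorphic first integrals; that is, the maximal number of functionally independent meromorphic first integrals on $\mathbb{C}^5$ is exactly two.
   Context: A first integral of $\dot x=F(x)$ is a function $\Phi$ with $\sum_i F_i\,\partial\Phi/\partial x_i\equiv 0$. This system is called the 5-dimensional Karabut system. *)

theory Defs
  imports "HOL-Analysis.Analysis"
begin

(* Meant for open U: complex differentiability at every point of U. *)
definition mv_holomorphic_on :: "(complex^'n \<Rightarrow> complex) \<Rightarrow> (complex^'n) set \<Rightarrow> bool" where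
  "mv_holomorphic_on f U \<longleftrightarrow>
     (\<forall>z\<in>U. \<exists>D. (f has_derivative D) (at z) \<and> (\<forall>c v. D (c *s v) = c * D v))"

definition mv_analytic_at :: "(complex^'n \<Rightarrow> complex) \<Rightarrow> complex^'n \<Rightarrow> bool" where
  "mv_analytic_at f z \<longleftrightarrow> (\<exists>U. open U \<and> z \<in> U \<and> mv_holomorphic_on f U)"

(* Locally a quotient of holomorphic functions. A ball is connected, so a denominator that is
   nonzero somewhere in it vanishes only on a nowhere dense set. The values of f
   where the denominator vanishes are unconstrained; all notions below look at f only at points
   of analyticity, which form a dense open set. *)
definition mv_meromorphic_on :: "(complex^'n \<Rightarrow> complex) \<Rightarrow> (complex^'n) set \<Rightarrow> bool" where
  "mv_meromorphic_on f U \<longleftrightarrow>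
     (\<forall>p\<in>U. \<exists>r>0. \<exists>g h. ball p r \<subseteq> U \<and>
        mv_holomorphic_on g (ball p r) \<and> mv_holomorphic_on h (ball p r) \<and>
        (\<exists>z\<in>ball p r. h z \<noteq> 0) \<and>
        (\<forall>z\<in>ball p r. h z \<noteq> 0 \<longrightarrow> f z = g z / h z))"

definition cpartial :: "'n \<Rightarrow> (complex^'n \<Rightarrow> complex) \<Rightarrow> complex^'n \<Rightarrow> complex" where
  "cpartial i f z = deriv (\<lambda>w. f (\<chi> j. if j = i then w else z $ j)) (z $ i)"

definition cgrad :: "(complex^'n \<Rightarrow> complex) \<Rightarrow> complex^'n \<Rightarrow> complex^'n" where
  "cgrad f z = (\<chi> i. cpartial i f z)"

(* The identity is one between meromorphic functions, hence required where f is analytic. *)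
definition meromorphic_first_integral ::
    "(complex^'n \<Rightarrow> complex^'n) \<Rightarrow> (complex^'n \<Rightarrow> complex) \<Rightarrow> bool" where
  "meromorphic_first_integral F f \<longleftrightarrow>
     mv_meromorphic_on f UNIV \<and>
     (\<forall>z. mv_analytic_at f z \<longrightarrow> (\<Sum>i\<in>UNIV. F z $ i * cpartial i f z) = 0)"

(* Generic linear independence of the gradients of f 0, ..., f (k - 1) over the complex numbers. *)
definition functionally_independent :: "nat \<Rightarrow> (nat \<Rightarrow> complex^'n \<Rightarrow> complex) \<Rightarrow> bool" where
  "functionally_independent k f \<longleftrightarrow>
     (\<exists>U. open U \<and> closure U = UNIV \<and>
        (\<forall>z\<in>U. (\<forall>i<k. mv_analytic_at (f i) z) \<and>
           (\<forall>c. (\<Sum>i<k. c i *s cgrad (f i) z) = 0 \<longrightarrow> (\<forall>i<k. c i = 0))))"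

definition karabut :: "complex^5 \<Rightarrow> complex^5" where
  "karabut x = vector
     [x$3 * x$5 - x$2 * x$4,
      x$4 * x$1 - x$3 * x$5,
      x$5 * x$2 - x$4 * x$1,
      x$1 * x$3 - x$5 * x$2,
      x$2 * x$4 - x$1 * x$3]"

lemma karabut_nth:
  "karabut x $ 1 = x$3 * x$5 - x$2 * x$4"
  "karabut x $ 2 = x$4 * x$1 - x$3 * x$5"
  "karabut x $ 3 = x$5 * x$2 - x$4 * x$1"
  "karabut x $ 4 = x$1 * x$3 - x$5 * x$2"
  "karabut x $ 5 = x$2 * x$4 - x$1 * x$3"
  by (simp_all add: karabut_def vector_def)

end

theory Submission
  imports Defs "HOL-Complex_Analysis.Conformal_Mappings" "HOL-Real_Asymp.Real_Asymp"
    "HOL-Computational_Algebra.Field_as_Ring" "HOL-Computational_Algebra.Polynomial_Factorial"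
begin

text \<open>
  The sums of the \<open>x\<^sub>i\<close> and of the \<open>x\<^sub>i\<^sup>2\<close> are first integrals, and their gradients \<open>(1, \<dots>, 1)\<close> and
  \<open>2 x\<close> are independent off the hyperplane \<open>x\<^sub>1 = x\<^sub>2\<close>. Everything else is the upper bound: near a suitable
  point close to the origin, the gradient of every meromorphic first integral lies, at generic points,
  in the plane spanned by these two vectors (\<open>first_integral_gradient\<close>), so three such gradients are
  dependent.

  The origin is approached along curves. With \<open>x\<^sub>1 = u + a\<close>, \<open>x\<^sub>4 = u - a\<close>, \<open>x\<^sub>3 = v + b\<close>, \<open>x\<^sub>2 = v - b\<close>,
  \<open>x\<^sub>5 = y\<close>, the plane \<open>u = v = y = 0\<close> is invariant, and \<open>a\<^sup>2 + b\<^sup>2\<close> is constant on its orbits. The family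
  \<open>curve \<sigma> A x v \<epsilon>\<close> parametrises the level set on which the two known integrals are \<open>4 \<epsilon>\<^sup>3 \<sigma>\<close> and \<open>8 \<epsilon>\<^sup>2\<close>:
  \<open>a\<close> and \<open>b\<close> have size \<open>\<epsilon>\<close>, the coordinates \<open>u, v, y\<close> transverse to the plane have size \<open>\<epsilon>\<^sup>2\<close>, \<open>A\<close> moves
  along the orbit in the plane, and \<open>x\<close> is the ratio of \<open>u\<close> to \<open>v\<close>. In these coordinates the system is
  polynomial in \<open>A, x, v\<close> and \<open>\<eta> = \<epsilon> / A\<close>, and for \<open>\<epsilon> \<rightarrow> 0\<close> it becomes its linearisation along the plane. The
  ratio \<open>x\<close> then obeys a Riccati equation over the \<open>A\<close>-line, singular over \<open>0\<close>, \<open>\<infinity>\<close> and \<open>\<plusminus>\<i>\<close>.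

  The arithmetic heart is that this Riccati equation has no algebraic solution
  (\<open>riccati_invariant_fibre\<close>). An invariant curve of degree \<open>n > 0\<close> in \<open>x\<close> would carry exponents at the four
  singular fibres, square roots of \<open>-7 \<plusminus> 8\<i>\<close> over \<open>0\<close> and \<open>\<infinity>\<close> and of \<open>-7\<close> over \<open>\<plusminus>\<i>\<close>, tied together by one
  polynomial of degree two. Taking real parts, the degree of the curve over the base is an integer
  multiple of \<open>Re (sqrt (-7 + 8\<i>))\<close>. As \<open>113 = 7\<^sup>2 + 8\<^sup>2\<close> is not a square, this number is irrational, and the
  degree is zero; but no nonconstant polynomial in \<open>x\<close> alone is invariant. By unique
  factorisation the linearised system has no nonconstant rational first integral
  (\<open>normal_der_no_invariants\<close>).

  The nonlinear system is reduced to the linearised one by an argument in the manner of Ziglin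
  (\<open>no_formal_integral\<close>, \<open>no_separating_integral\<close>). Let \<open>f = g / h\<close> be an integral that takes different values
  at two points of one level set. The cross difference \<open>g(p) h(p') - g(p') h(p)\<close>, followed down the two
  curves, then vanishes to a finite order in \<open>\<epsilon>\<close>. Replace \<open>g\<close> and \<open>h\<close> by Taylor polynomials of
  higher order; along the curves they become polynomials \<open>G, H\<close> in \<open>\<eta>, A, x, v\<close> whose quotient is an
  integral up to that order. The lowest coefficients of \<open>G\<close> and \<open>H\<close> give a rational integral of the linearised
  system, hence a constant, so a constant times a power of \<open>\<epsilon>\<close> times \<open>H\<close> can be subtracted from \<open>G\<close>. This
  changes neither the cross difference nor the relation, and increases the order of \<open>G\<close>. Repeating it
  contradicts the finite order of the cross difference. Therefore \<open>f\<close> depends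
  only on \<open>\<epsilon>\<close> and \<open>\<sigma>\<close>, and its gradient lies in the plane above.
\<close>

section \<open>Polynomials with polynomial coefficients\<close>

lemma map_poly_add_hom:
  assumes "f 0 = 0" "\<And>a b. f (a + b) = f a + f b"
  shows "map_poly f (p + q) = map_poly f p + map_poly f q"
  by (rule poly_eqI) (simp add: coeff_map_poly assms)

lemma map_poly_mult_hom:
  assumes "f 0 = 0" "\<And>a b. f (a + b) = f a + f b" "\<And>a b. f (a * b) = f a * f b"
  shows "map_poly f (p * q) = map_poly f p * map_poly f q"
proof (rule poly_eqI)
  fix n
  have s: "f (sum g A) = (\<Sum>i\<in>A. f (g i))" if "finite A" for g and A :: "nat set"
    using that by induct (auto simp: assms)
  show "coeff (map_poly f (p * q)) n = coeff (map_poly f p * map_poly f q) n"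
    by (simp add: coeff_map_poly assms coeff_mult s)
qed

lemma map_poly_pderiv_add:
  "map_poly pderiv (p + q) = map_poly pderiv p + map_poly pderiv (q :: 'a::idom poly poly)"
  by (rule map_poly_add_hom) (simp_all add: pderiv_add)

lemma map_poly_derivation_mult:
  assumes "d 0 = 0" "\<And>a b. d (a + b) = d a + d b" "\<And>a b. d (a * b) = d a * b + a * d b"
  shows "map_poly d (p * q) = map_poly d p * q + p * map_poly d q"
proof (rule poly_eqI)
  fix n
  have s: "d (sum g A) = (\<Sum>i\<in>A. d (g i))" if "finite A" for g and A :: "nat set"
    using that by induct (auto simp: assms)
  show "coeff (map_poly d (p * q)) n = coeff (map_poly d p * q + p * map_poly d q) n"
    by (simp add: coeff_map_poly assms coeff_mult s sum.distrib)
qed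

lemma coeff_mult_top:
  fixes p q :: "'a::comm_semiring_0 poly"
  assumes "degree p \<le> m" "degree q \<le> n"
  shows "coeff (p * q) (m + n) = coeff p m * coeff q n"
proof -
  have "coeff (p * q) (m + n) = (\<Sum>i\<le>m + n. coeff p i * coeff q (m + n - i))"
    by (rule coeff_mult)
  also have "\<dots> = (\<Sum>i\<le>m + n. if i = m then coeff p m * coeff q n else 0)"
  proof (rule sum.cong[OF refl])
    fix i assume "i \<in> {..m + n}"
    show "coeff p i * coeff q (m + n - i) = (if i = m then coeff p m * coeff q n else 0)"
    proof (cases i m rule: linorder_cases)
      case less
      then have "degree q < m + n - i" using assms by simp
      then show ?thesis using less by (simp add: coeff_eq_0)
    next
      case greater
      then have "degree p < i" using assms by simp
      then show ?thesis using greater by (simp add: coeff_eq_0)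
    qed auto
  qed
  also have "\<dots> = coeff p m * coeff q n" by simp
  finally show ?thesis .
qed

lemma coeff_coeff_mult_top:
  fixes P Q :: "'a::comm_semiring_0 poly poly"
  assumes "\<And>l. degree (coeff P l) \<le> m" "\<And>l. degree (coeff Q l) \<le> n"
  shows "map_poly (\<lambda>c. coeff c (m + n)) (P * Q) =
         map_poly (\<lambda>c. coeff c m) P * map_poly (\<lambda>c. coeff c n) Q"
  by (rule poly_eqI) (simp add: coeff_map_poly coeff_mult[of P]
      coeff_mult[of "map_poly f p" for f p] coeff_sum coeff_mult_top[OF assms])

lemma degree_coeff_mult_le:
  fixes P Q :: "'a::comm_semiring_0 poly poly"
  assumes "\<And>l. degree (coeff P l) \<le> m" "\<And>l. degree (coeff Q l) \<le> n"
  shows "degree (coeff (P * Q) l) \<le> m + n"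
  unfolding coeff_mult
  by (intro degree_sum_le) (auto intro!: order.trans[OF degree_mult_le] add_mono assms)

lemma of_nat_mult_conv_smult: "of_nat m * r = smult (of_nat m) (r :: 'a::comm_semiring_1 poly)"
  by (simp add: of_nat_poly)

lemma smult_left_inj:
  fixes p q :: "'a::idom poly"
  assumes "a \<noteq> 0" "smult a p = smult a q"
  shows "p = q"
  using assms by (simp add: poly_eq_iff)

section \<open>The Riccati foliation and its invariant curves\<close>

text \<open>
  Compare orders of vanishing at the root \<open>\<rho> = (\<delta> - 3) / 4\<close> of the quadratic \<open>2 x\<^sup>2 + 3 x + c\<close>. If \<open>p\<close> vanishes there
  to order \<open>m\<close>, the logarithmic derivative of \<open>p\<close> has residue \<open>m\<close>, while the derivative of the quadratic
  at \<open>\<rho>\<close> is \<open>\<delta>\<close>; hence \<open>m \<delta> = \<kappa> + 2 n \<rho>\<close>. The formula is applied to the restriction of an invariant curve to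
  a singular fibre of the Riccati foliation.
\<close>

lemma riccati_exponent:
  fixes p :: "complex poly"
  assumes "p \<noteq> 0" "\<delta>\<^sup>2 = 9 - 8 * c"
    and eq: "[:c, 3, 2:] * pderiv p = [:\<kappa>, 2 * of_nat n:] * p"
  shows "\<exists>m::nat. \<kappa> = 3 * of_nat n / 2 + (of_nat m - of_nat n / 2) * \<delta>"
proof -
  define \<rho> where "\<rho> = (\<delta> - 3) / 4"
  obtain r where r: "p = [:-\<rho>, 1:] ^ order \<rho> p * r" "\<not> [:-\<rho>, 1:] dvd r"
    using order_decomp[OF assms(1), of \<rho>] by blast
  define m where "m = order \<rho> p"
  have r0: "poly r \<rho> \<noteq> 0" using r(2) by (simp add: poly_eq_0_iff_dvd)
  have cc: "c = (9 - \<delta>\<^sup>2) / 8" using assms(2) by (simp add: field_simps)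
  have f: "[:c, 3, 2:] = [:-\<rho>, 1:] * [:(\<delta> + 3) / 2, 2:]"
    by (simp add: \<rho>_def cc power2_eq_square field_simps)
  have X: "X * pderiv (X ^ m * r) = X ^ m * (of_nat m * r + X * pderiv r)"
    if "pderiv X = 1" for X :: "complex poly"
  proof (cases m)
    case (Suc k)
    have "pderiv (X ^ m * r) = X ^ m * pderiv r + of_nat m * X ^ k * r"
      using that by (simp add: pderiv_mult pderiv_power_Suc Suc of_nat_poly mult.commute del: power_Suc)
    then show ?thesis by (simp add: Suc algebra_simps)
  qed simp
  have d: "[:-\<rho>, 1:] * pderiv p = [:-\<rho>, 1:] ^ m * (smult (of_nat m) r + [:-\<rho>, 1:] * pderiv r)"
    using X[of "[:-\<rho>, 1:]"] r(1) of_nat_mult_conv_smult[of m r]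
    by (simp add: m_def pderiv_pCons del: mult_pCons_left)
  have p: "p = [:-\<rho>, 1:] ^ m * r" using r(1) m_def by simp
  have "[:-\<rho>, 1:] ^ m * ([:(\<delta> + 3) / 2, 2:] * (smult (of_nat m) r + [:-\<rho>, 1:] * pderiv r))
      = [:(\<delta> + 3) / 2, 2:] * ([:-\<rho>, 1:] * pderiv p)"
    unfolding d by (simp only: mult_ac)
  also have "\<dots> = [:\<kappa>, 2 * of_nat n:] * p"
    using eq unfolding f by (simp only: mult_ac)
  also have "\<dots> = [:-\<rho>, 1:] ^ m * ([:\<kappa>, 2 * of_nat n:] * r)"
    by (subst p) (simp only: mult_ac)
  finally have "[:(\<delta> + 3) / 2, 2:] * (smult (of_nat m) r + [:-\<rho>, 1:] * pderiv r)
      = [:\<kappa>, 2 * of_nat n:] * r"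
    by (subst (asm) mult_cancel_left) simp
  then have "poly ([:(\<delta> + 3) / 2, 2:] * (smult (of_nat m) r + [:-\<rho>, 1:] * pderiv r)) \<rho>
      = poly ([:\<kappa>, 2 * of_nat n:] * r) \<rho>" by (simp only:)
  then have "((\<delta> + 3) / 2 + 2 * \<rho>) * of_nat m * poly r \<rho> = (\<kappa> + 2 * of_nat n * \<rho>) * poly r \<rho>"
    by (simp add: algebra_simps)
  then have "((\<delta> + 3) / 2 + 2 * \<rho>) * of_nat m = \<kappa> + 2 * of_nat n * \<rho>"
    using r0 by simp
  then have "\<kappa> = ((\<delta> + 3) / 2 + 2 * \<rho>) * of_nat m - 2 * of_nat n * \<rho>"
    by (simp add: algebra_simps)
  also have "\<dots> = 3 * of_nat n / 2 + (of_nat m - of_nat n / 2) * \<delta>"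
    by (simp add: \<rho>_def field_simps)
  finally have "\<kappa> = 3 * of_nat n / 2 + (of_nat m - of_nat n / 2) * \<delta>" .
  then show ?thesis by blast
qed

text \<open>
  The Riccati foliation \<open>w' = w (w\<^sup>2 + 1)\<close>, \<open>x' = 2 \<beta> x\<^sup>2 + 3 \<beta> x + 2 \<beta> + \<alpha>\<close> with \<open>\<beta> = w\<^sup>2 - 1\<close> (\<open>b_coeff\<close>)
  and \<open>\<alpha> = \<i> (w\<^sup>2 + 1)\<close> (\<open>a_coeff\<close>), as a derivation of
  polynomials in \<open>x\<close> (outer variable) with coefficients in \<open>\<complex>[w]\<close> (inner variable).
\<close>

definition speed :: "complex poly" where "speed = [:0, 1, 0, 1:]"
definition b_coeff :: "complex poly" where "b_coeff = [:-1, 0, 1:]"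
definition a_coeff :: "complex poly" where "a_coeff = [:\<i>, 0, \<i>:]"
definition riccati_coeff :: "complex poly poly" where "riccati_coeff = [: 2 * b_coeff + a_coeff, 3 * b_coeff, 2 * b_coeff :]"
definition riccati :: "complex poly poly \<Rightarrow> complex poly poly" where
  "riccati P = smult speed (map_poly pderiv P) + riccati_coeff * pderiv P"

text \<open>
  A rational nonzero root would make the discriminant \<open>7\<^sup>2 + 4 \<cdot> 16 = 113\<close> a rational square.
\<close>

lemma irrational_relation:
  fixes r :: real and N :: int and d :: nat
  assumes "r ^ 4 + 7 * r\<^sup>2 = 16" and "real d = of_int N * r"
  shows "d = 0"
proof (rule ccontr)
  assume "d \<noteq> 0"
  then have N: "N \<noteq> 0" using assms(2) by auto
  have "real d ^ 4 + 7 * (real d)\<^sup>2 * (of_int N)\<^sup>2 = (of_int N) ^ 4 * (r ^ 4 + 7 * r\<^sup>2)"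
    unfolding assms(2) by (simp add: power_mult_distrib algebra_simps power2_eq_square power4_eq_xxxx)
  then have "real d ^ 4 + 7 * (real d)\<^sup>2 * (of_int N)\<^sup>2 = 16 * (of_int N) ^ 4"
    using assms(1) by simp
  then have "real_of_int (int d ^ 4 + 7 * (int d)\<^sup>2 * N\<^sup>2) = of_int (16 * N ^ 4)" by simp
  then have e: "int d ^ 4 + 7 * (int d)\<^sup>2 * N\<^sup>2 = 16 * N ^ 4" by linarith
  have sq: "(2 * (int d)\<^sup>2 + 7 * N\<^sup>2)\<^sup>2 = 113 * (N\<^sup>2)\<^sup>2"
    using e by (simp add: power2_eq_square power4_eq_xxxx algebra_simps)
  have p: "prime (113::nat)" by simp
  define x y where "x = nat (2 * (int d)\<^sup>2 + 7 * N\<^sup>2)" and "y = nat (N\<^sup>2)"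
  have "int (x\<^sup>2) = int (113 * y\<^sup>2)" using sq by (simp add: x_def y_def)
  then have xy: "x\<^sup>2 = 113 * y\<^sup>2" by linarith
  have y0: "y \<noteq> 0" using N by (simp add: y_def)
  have x0: "x \<noteq> 0"
  proof
    assume "x = 0"
    then show False using xy y0 by simp
  qed
  have "multiplicity 113 (x\<^sup>2) = 2 * multiplicity 113 x"
    using p x0 by (simp add: prime_elem_multiplicity_power_distrib)
  moreover have "multiplicity 113 (113 * y\<^sup>2) = Suc (2 * multiplicity 113 y)"
    using p y0 by (simp add: prime_elem_multiplicity_mult_distrib prime_elem_multiplicity_power_distrib)
  ultimately show False using xy by (metis Suc_double_not_eq_double)
qed

lemma riccati_smult:
  "riccati (smult a P) = smult a (riccati P) + smult (speed * pderiv a) P"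
proof -
  have "map_poly pderiv (smult a P) = smult (pderiv a) P + smult a (map_poly pderiv P)"
    by (rule poly_eqI) (simp add: coeff_map_poly pderiv_mult algebra_simps)
  then show ?thesis
    by (simp add: riccati_def pderiv_smult smult_add_right algebra_simps)
qed

abbreviation at_fibre :: "complex \<Rightarrow> complex poly poly \<Rightarrow> complex poly" where
  "at_fibre w \<equiv> map_poly (\<lambda>c. poly c w)"

lemma at_fibre_pderiv: "at_fibre w (pderiv P) = pderiv (at_fibre w P)"
  by (rule poly_eqI) (simp add: coeff_map_poly coeff_pderiv)

lemma at_fibre_mult: "at_fibre w (P * Q) = at_fibre w P * at_fibre w Q"
  by (rule map_poly_mult_hom) simp_all

lemma at_fibre_add: "at_fibre w (P + Q) = at_fibre w P + at_fibre w Q"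
  by (rule map_poly_add_hom) simp_all

lemma at_fibre_smult: "at_fibre w (smult a P) = smult (poly a w) (at_fibre w P)"
  by (rule poly_eqI) (simp add: coeff_map_poly)

lemma at_fibre_pCons: "at_fibre w (pCons a P) = pCons (poly a w) (at_fibre w P)"
  by (rule poly_eqI) (simp add: coeff_map_poly coeff_pCons split: nat.split)

lemma poly_two: "poly 2 (w::complex) = 2"
  by (metis of_nat_numeral poly_of_nat)

lemma poly_three: "poly 3 (w::complex) = 3"
  by (metis of_nat_numeral poly_of_nat)

text \<open>
  The derivation raises the degree in \<open>x\<close> by at most one, so the cofactor \<open>K\<close> of an invariant curve is
  linear in \<open>x\<close>, and the leading coefficients determine its linear term. Only its value at \<open>x = 0\<close>, a
  polynomial in \<open>w\<close>, remains unknown.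
\<close>

lemma riccati_cofactor:
  assumes eq: "riccati P = K * P" and "P \<noteq> 0"
  obtains k where "K = [:k, 2 * of_nat (degree P) * b_coeff:]"
proof -
  define n where "n = degree P"
  have d: "coeff (riccati P) l = 0" if "l > n + 1" for l
  proof -
    have "coeff (map_poly pderiv P) l = 0"
      using that by (simp add: coeff_map_poly coeff_eq_0 n_def)
    moreover have "degree (riccati_coeff * pderiv P) \<le> n + 1"
    proof (cases n)
      case 0
      then have "pderiv P = 0" by (simp add: pderiv_eq_0_iff n_def)
      then show ?thesis by simp
    next
      case (Suc k)
      have "degree (riccati_coeff * pderiv P) \<le> degree riccati_coeff + degree (pderiv P)" by (rule degree_mult_le)
      also have "\<dots> \<le> 2 + (n - 1)"
        by (intro add_mono) (simp_all add: riccati_coeff_def degree_pderiv n_def)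
      finally show ?thesis using Suc by simp
    qed
    then have "coeff (riccati_coeff * pderiv P) l = 0" using that by (simp add: coeff_eq_0)
    ultimately show ?thesis by (simp add: riccati_def)
  qed
  have "degree K \<le> 1"
  proof (rule ccontr)
    assume a: "\<not> degree K \<le> 1"
    then have "K \<noteq> 0" by auto
    then have "degree (K * P) = degree K + n" using assms(2) by (simp add: degree_mult_eq n_def)
    then have "coeff (riccati P) (degree K + n) \<noteq> 0"
      using \<open>K \<noteq> 0\<close> assms(2) eq by (metis leading_coeff_0_iff mult_eq_0_iff)
    then show False using d a by simp
  qed
  then have K: "K = [:coeff K 0, coeff K 1:]"
    by (intro poly_eqI) (auto simp: coeff_pCons coeff_eq_0 split: nat.split)
  have "coeff (riccati P) (n + 1) = coeff (riccati_coeff * pderiv P) (n + 1)"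
    by (simp add: riccati_def coeff_map_poly coeff_eq_0 n_def)
  also have "\<dots> = 2 * of_nat n * b_coeff * coeff P n"
  proof (cases n)
    case 0
    then have "pderiv P = 0" by (simp add: pderiv_eq_0_iff n_def)
    then show ?thesis using 0 by simp
  next
    case (Suc k)
    then have "coeff (riccati_coeff * pderiv P) (n + 1) = coeff riccati_coeff 2 * coeff (pderiv P) k"
      using coeff_mult_top[of riccati_coeff 2 "pderiv P" k]
      by (simp add: riccati_coeff_def degree_pderiv n_def[symmetric])
    then show ?thesis by (simp add: riccati_coeff_def coeff_pderiv Suc numeral_2_eq_2 algebra_simps)
  qed
  finally have "2 * of_nat n * b_coeff * coeff P n = coeff (K * P) (1 + n)" by (simp add: eq)
  also have "\<dots> = coeff K 1 * coeff P n"
    using \<open>degree K \<le> 1\<close> by (intro coeff_mult_top) (simp_all add: n_def)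
  finally have "coeff K 1 = 2 * of_nat n * b_coeff" using assms(2) by (simp add: n_def)
  then show ?thesis using that K n_def by metis
qed

text \<open>
  Where \<open>speed\<close> vanishes the fibre is invariant, and the equation of an invariant curve restricts to it. The
  result has the form treated in \<open>riccati_exponent\<close>.
\<close>

lemma riccati_at_point:
  assumes eq: "riccati P = [:k, 2 * of_nat n * b_coeff:] * P" and speed: "poly speed w = 0"
    and b_coeff: "poly b_coeff w \<noteq> 0" and c: "c = 2 + poly a_coeff w / poly b_coeff w"
  shows "[:c, 3, 2:] * pderiv (at_fibre w P) = [:poly k w / poly b_coeff w, 2 * of_nat n:] * at_fibre w P"
proof -
  have "at_fibre w (riccati P) = at_fibre w riccati_coeff * pderiv (at_fibre w P)"
    by (simp add: riccati_def at_fibre_add at_fibre_smult speed at_fibre_mult at_fibre_pderiv)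
  also have "at_fibre w riccati_coeff = smult (poly b_coeff w) [:c, 3, 2:]"
    using b_coeff by (simp add: riccati_coeff_def at_fibre_pCons c distrib_left poly_two poly_three mult.commute)
  finally have "smult (poly b_coeff w) ([:c, 3, 2:] * pderiv (at_fibre w P)) = at_fibre w ([:k, 2 * of_nat n * b_coeff:] * P)"
    by (simp only: mult_smult_left eq)
  also have "\<dots> = smult (poly b_coeff w) ([:poly k w / poly b_coeff w, 2 * of_nat n:] * at_fibre w P)"
    using b_coeff unfolding at_fibre_mult
    by (simp add: at_fibre_pCons poly_two smult_add_right mult_ac)
  finally show ?thesis by (rule smult_left_inj[rotated]) (use b_coeff in simp)
qed

text \<open>
  Induct on a bound \<open>d\<close> for the degree in \<open>w\<close>. If the curve contains a singular fibre \<open>w = w\<^sub>0\<close>, or the coefficient of \<open>w\<^sup>d\<close> vanishes, a curve with smaller bound is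
  available. Otherwise the restrictions to the singular fibres \<open>0\<close>, \<open>\<plusminus>\<i>\<close> and to \<open>w = \<infinity>\<close> are nonzero, and
  the four relations of \<open>riccati_exponent\<close> involve one polynomial \<open>k = k\<^sub>0 + k\<^sub>1 w + k\<^sub>2 w\<^sup>2\<close>. Eliminating \<open>k\<close>
  from their real parts gives \<open>d\<close> as an integer multiple of the irrational number \<open>Re (sqrt (-7 + 8\<i>))\<close>,
  hence \<open>d = 0\<close>. Finally \<open>w = 1\<close>, where \<open>\<beta>\<close> vanishes and \<open>x' = \<alpha>\<close> is constant, excludes a polynomial in \<open>x\<close>.
\<close>

lemma riccati_invariant_fibre:
  assumes eq: "riccati P = K * P" and "P \<noteq> 0"
  shows "degree P = 0"
proof -
  have "\<And>l. degree (coeff P l) \<le> Max ((\<lambda>l. degree (coeff P l)) ` {..degree P})"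
  proof -
    fix l show "degree (coeff P l) \<le> Max ((\<lambda>l. degree (coeff P l)) ` {..degree P})"
    proof (cases "l \<le> degree P")
      case False
      then show ?thesis by (simp add: coeff_eq_0)
    qed auto
  qed
  then obtain d where "\<And>l. degree (coeff P l) \<le> d" by blast
  then show ?thesis using assms
  proof (induction d arbitrary: P K rule: less_induct)
    case (less d)
    note deg = less.prems(1) and eq = less.prems(2) and P0 = less.prems(3)
    define n where "n = degree P"
    show ?case
    proof (cases "\<exists>w. poly speed w = 0 \<and> at_fibre w P = 0")
      case True
      then obtain w where w: "poly speed w = 0" "at_fibre w P = 0" by blast
      have "[:-w, 1:] dvd coeff P l" for l
      proof -
        have "coeff (at_fibre w P) l = 0" using w by simp
        then show ?thesis by (simp add: coeff_map_poly poly_eq_0_iff_dvd)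
      qed
      then have "[:[:-w, 1:]:] dvd P" by (simp add: const_poly_dvd_iff)
      then obtain P' where P': "P = [:[:-w, 1:]:] * P'" by (rule dvdE)
      then have P': "P = smult [:-w, 1:] P'" by simp
      have P'0: "P' \<noteq> 0" using P' P0 by auto
      obtain \<mu> where \<mu>: "speed = [:-w, 1:] * \<mu>" using w(1) by (auto simp: poly_eq_0_iff_dvd elim: dvdE)
      have "smult [:-w, 1:] (riccati P' + smult \<mu> P') = smult [:-w, 1:] (K * P')"
        using eq unfolding P' riccati_smult
        by (simp add: pderiv_pCons smult_add_right \<mu> del: mult_pCons_left)
      then have "riccati P' + smult \<mu> P' = K * P'" by (rule smult_left_inj[rotated]) simp
      then have eq': "riccati P' = (K - [:\<mu>:]) * P'" by (simp add: algebra_simps)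
      have dl: "degree (coeff P' l) < d \<or> coeff P' l = 0" for l
      proof (cases "coeff P' l = 0")
        case False
        then have "degree (coeff P l) = 1 + degree (coeff P' l)"
          unfolding P' coeff_smult by (subst degree_mult_eq) simp_all
        then show ?thesis using deg[of l] by simp
      qed simp
      have "0 < d" using dl[of "degree P'"] P'0 by auto
      have "degree P' = 0"
      proof (rule less.IH[of "d - 1", OF _ _ eq' P'0])
        show "d - 1 < d" using \<open>0 < d\<close> by simp
        show "degree (coeff P' l) \<le> d - 1" for l using dl[of l] \<open>0 < d\<close> by auto
      qed
      then show ?thesis using P' by (metis degree_smult_le le_zero_eq)
    next
      case False
      then have nz: "at_fibre w P \<noteq> 0" if "poly speed w = 0" for w using that by blast
      \<comment> \<open>The coefficient of the highest power of w plays the role of the restriction to the fibre over infinity.\<close>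
      define top where "top = map_poly (\<lambda>c. coeff c d) P"
      show ?thesis
      proof (cases "top = 0")
        case True
        have dl: "degree (coeff P l) < d \<or> coeff P l = 0" for l
        proof -
          have "coeff top l = 0" using True by simp
          then have "coeff (coeff P l) d = 0" by (simp add: top_def coeff_map_poly)
          then show ?thesis using deg[of l]
            by (metis leading_coeff_0_iff order_le_imp_less_or_eq)
        qed
        have "0 < d" using dl[of "degree P"] P0 by auto
        then show ?thesis
          using less.IH[of "d - 1" P K] dl eq P0
          by (metis One_nat_def Suc_pred degree_0 diff_less less_Suc_eq_le zero_le zero_less_one)
      next
        case top: False
        obtain k where K: "K = [:k, 2 * of_nat n * b_coeff:]"
          using riccati_cofactor[OF eq P0] n_def by metis
        note eqK = eq[unfolded K]
        have k: "k = [:coeff k 0, coeff k 1, coeff k 2:]"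
          and inf: "[:2 + \<i>, 3, 2:] * pderiv top = [:coeff k 2 - of_nat d, 2 * of_nat n:] * top"
        proof -
          \<comment> \<open>The cofactor is not yet known to be quadratic in w; compare the coefficients of w ^ (e + d)
            for an e that bounds its degree, and deduce e = 2.\<close>
          define e where "e = max (degree k) 2"
          have b_coeff: "2 * of_nat n * b_coeff = [:- 2 * of_nat n, 0, 2 * of_nat n:]"
            by (simp add: b_coeff_def of_nat_poly numeral_poly)
          have tK: "map_poly (\<lambda>c. coeff c (e + d)) (riccati P) =
              map_poly (\<lambda>c. coeff c e) K * top"
            unfolding eq top_def
          proof (rule coeff_coeff_mult_top)
            show "degree (coeff K l) \<le> e" for l
              by (auto simp: K b_coeff e_def coeff_pCons split: nat.split)
          qed (rule deg)
          have speed: "speed * c = pCons 0 (c + pCons 0 (pCons 0 c))" for c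
            by (simp add: speed_def)
          have t1: "map_poly (\<lambda>c. coeff c (2 + d)) (smult speed (map_poly pderiv P)) = smult (of_nat d) top"
          proof (rule poly_eqI)
            fix l
            have "coeff (pCons 0 (pderiv (coeff P l))) d = of_nat d * coeff (coeff P l) d"
              by (cases d) (simp_all add: coeff_pderiv)
            then show "coeff (map_poly (\<lambda>c. coeff c (2 + d)) (smult speed (map_poly pderiv P))) l =
              coeff (smult (of_nat d) top) l"
              using deg[of l] by (simp add: coeff_map_poly speed top_def coeff_pderiv coeff_eq_0)
          qed
          have dp: "degree (coeff (pderiv P) l) \<le> d" for l
            using deg by (simp add: coeff_pderiv of_nat_poly)
          have pt: "map_poly (\<lambda>c. coeff c d) (pderiv P) = pderiv top"
            by (rule poly_eqI) (simp add: coeff_map_poly coeff_pderiv top_def of_nat_poly)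
          have rd: "degree (coeff riccati_coeff l) \<le> 2" for l
            by (simp add: riccati_coeff_def b_coeff_def a_coeff_def coeff_pCons numeral_poly split: nat.split)
          have rt: "map_poly (\<lambda>c. coeff c 2) riccati_coeff = [:2 + \<i>, 3, 2:]"
            by (simp add: riccati_coeff_def b_coeff_def a_coeff_def numeral_poly map_poly_pCons numeral_2_eq_2)
          have t2: "map_poly (\<lambda>c. coeff c (2 + d)) (riccati_coeff * pderiv P) = [:2 + \<i>, 3, 2:] * pderiv top"
            using coeff_coeff_mult_top[of riccati_coeff 2 "pderiv P" d, OF rd dp] pt rt by simp
          have "degree k \<le> 2"
          proof (rule ccontr)
            assume "\<not> degree k \<le> 2"
            then have e: "e = degree k" "2 < e" by (simp_all add: e_def)
            have "degree (coeff (riccati P) l) \<le> d + 2" for l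
            proof -
              have "degree (speed * pderiv (coeff P l)) \<le> d + 2"
              proof (cases "degree (coeff P l)")
                case 0
                then have "pderiv (coeff P l) = 0" by (simp add: pderiv_eq_0_iff)
                then show ?thesis by simp
              next
                case (Suc i)
                have "degree (speed * pderiv (coeff P l)) \<le> degree speed + degree (pderiv (coeff P l))"
                  by (rule degree_mult_le)
                then show ?thesis using Suc deg[of l] by (simp add: speed_def degree_pderiv)
              qed
              moreover have "degree (coeff (riccati_coeff * pderiv P) l) \<le> 2 + d"
                using rd dp by (rule degree_coeff_mult_le)
              ultimately show ?thesis
                by (simp add: riccati_def coeff_map_poly degree_add_le)
            qed
            moreover have "d + 2 < e + d" using e by simp
            ultimately have "degree (coeff (riccati P) l) < e + d" for l
              using le_less_trans by blast
            then have "map_poly (\<lambda>c. coeff c (e + d)) (riccati P) = 0"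
              by (intro poly_eqI) (auto simp: coeff_map_poly intro!: coeff_eq_0)
            then have "map_poly (\<lambda>c. coeff c e) K = 0" using tK top by simp
            then have "coeff (map_poly (\<lambda>c. coeff c e) K) 0 = 0" by simp
            then show False using e by (simp add: coeff_map_poly K)
          qed
          then show k: "k = [:coeff k 0, coeff k 1, coeff k 2:]"
            by (intro poly_eqI) (auto simp: coeff_pCons coeff_eq_0 numeral_2_eq_2 split: nat.split)
          have e: "e = 2" using \<open>degree k \<le> 2\<close> by (simp add: e_def)
          have tk: "map_poly (\<lambda>c. coeff c 2) K = [:coeff k 2, 2 * of_nat n:]"
            by (simp add: K b_coeff map_poly_pCons numeral_2_eq_2)
          have "map_poly (\<lambda>c. coeff c (2 + d)) (riccati P) =
             smult (of_nat d) top + [:2 + \<i>, 3, 2:] * pderiv top"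
            unfolding riccati_def t1[symmetric] t2[symmetric] by (rule map_poly_add_hom) simp_all
          then have "smult (of_nat d) top + [:2 + \<i>, 3, 2:] * pderiv top = [:coeff k 2, 2 * of_nat n:] * top"
            using tK unfolding e tk by simp
          then have "[:2 + \<i>, 3, 2:] * pderiv top = [:coeff k 2, 2 * of_nat n:] * top - smult (of_nat d) top"
            by (metis add_diff_cancel_left')
          also have "\<dots> = [:coeff k 2 - of_nat d, 2 * of_nat n:] * top"
            by (simp add: smult_diff_left)
          finally show "[:2 + \<i>, 3, 2:] * pderiv top = [:coeff k 2 - of_nat d, 2 * of_nat n:] * top" .
        qed
        \<comment> \<open>The exponents over 0 and over infinity are complex conjugate, so they have the same real part r;
          over \<i> and -\<i> they are purely imaginary.\<close>
        define \<delta> where "\<delta> = csqrt (-7 + 8 * \<i>)"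
        define r where "r = Re \<delta>"
        have \<delta>: "\<delta>\<^sup>2 = -7 + 8 * \<i>" by (simp add: \<delta>_def)
        have \<delta>': "(cnj \<delta>)\<^sup>2 = -7 - 8 * \<i>"
          using arg_cong[OF \<delta>, of cnj] by simp
        have s: "(\<i> * of_real (sqrt 7))\<^sup>2 = (-7::complex)"
          by (simp add: power_mult_distrib flip: of_real_power)
        have r: "r ^ 4 + 7 * r\<^sup>2 = 16"
        proof -
          have "Re (\<delta>\<^sup>2) = -7" "Im (\<delta>\<^sup>2) = 8" by (simp_all add: \<delta>)
          then have a: "r\<^sup>2 - (Im \<delta>)\<^sup>2 = -7" and b: "r * Im \<delta> = 4"
            by (simp_all add: r_def power2_eq_square mult.commute)
          have "r ^ 4 + 7 * r\<^sup>2 = r\<^sup>2 * (r\<^sup>2 + 7)" by (simp add: algebra_simps power4_eq_xxxx power2_eq_square)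
          also have "\<dots> = (r * Im \<delta>)\<^sup>2" using a by (simp add: power_mult_distrib)
          finally show ?thesis by (simp add: b)
        qed
        have omz: "poly speed 0 = 0" "poly speed \<i> = 0" "poly speed (-\<i>) = 0" by (simp_all add: speed_def)
        obtain m0 :: nat where m0: "poly k 0 / -1 = 3 * of_nat n / 2 + (of_nat m0 - of_nat n / 2) * \<delta>"
          using riccati_exponent[OF nz[OF omz(1)] _ riccati_at_point[OF eqK omz(1) _ refl], of \<delta>]
          by (auto simp: b_coeff_def a_coeff_def \<delta>)
        obtain m1 :: nat where m1: "coeff k 2 - of_nat d = 3 * of_nat n / 2 + (of_nat m1 - of_nat n / 2) * cnj \<delta>"
          using riccati_exponent[OF top _ inf, of "cnj \<delta>"] by (auto simp: \<delta>')
        obtain m2 :: nat where m2: "poly k \<i> / -2 = 3 * of_nat n / 2 + (of_nat m2 - of_nat n / 2) * (\<i> * of_real (sqrt 7))"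
          using riccati_exponent[OF nz[OF omz(2)] _ riccati_at_point[OF eqK omz(2) _ refl], of "\<i> * of_real (sqrt 7)"]
          by (auto simp: b_coeff_def a_coeff_def s)
        obtain m3 :: nat where m3: "poly k (-\<i>) / -2 = 3 * of_nat n / 2 + (of_nat m3 - of_nat n / 2) * (\<i> * of_real (sqrt 7))"
          using riccati_exponent[OF nz[OF omz(3)] _ riccati_at_point[OF eqK omz(3) _ refl], of "\<i> * of_real (sqrt 7)"]
          by (auto simp: b_coeff_def a_coeff_def s)
        have pk: "poly k x = coeff k 0 + x * coeff k 1 + x\<^sup>2 * coeff k 2" for x
          by (subst k) (simp add: algebra_simps power2_eq_square)
        \<comment> \<open>The values of k at \<i> and -\<i> sum to 2 (k0 - k2); their real parts do not involve m2 and m3,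
          and r is the only irrational quantity left.\<close>
        have q0: "Re (coeff k 0) = - 3 * n / 2 - (m0 - n / 2) * r"
          using arg_cong[OF m0, of Re] by (simp add: pk r_def)
        have q1: "Re (coeff k 2) - d = 3 * n / 2 + (m1 - n / 2) * r"
          using arg_cong[OF m1, of Re] by (simp add: r_def)
        have q2: "Re (poly k \<i>) = - 3 * n" using arg_cong[OF m2, of Re] by simp
        have q3: "Re (poly k (-\<i>)) = - 3 * n" using arg_cong[OF m3, of Re] by simp
        have "real d = of_int (int n - int m0 - int m1) * r"
          using q0 q1 q2 q3 by (simp add: pk algebra_simps)
        then have d: "d = 0" using irrational_relation[OF r] by blast
        \<comment> \<open>The coefficients of the curve do not depend on w, so the equation may be evaluated at w = 1.\<close>
        have "map_poly pderiv P = 0"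
          using deg pderiv_eq_0_iff[of "coeff P l" for l] unfolding d
          by (intro poly_eqI[of "map_poly pderiv P"]) (simp add: coeff_map_poly)
        then have "riccati_coeff * pderiv P = K * P" using eq by (simp add: riccati_def)
        then have "at_fibre 1 riccati_coeff * pderiv (at_fibre 1 P) = at_fibre 1 K * at_fibre 1 P"
          by (metis at_fibre_mult at_fibre_pderiv)
        then have e: "smult (2 * \<i>) (pderiv (at_fibre 1 P)) = smult (poly k 1) (at_fibre 1 P)"
          by (simp add: riccati_coeff_def K at_fibre_pCons b_coeff_def a_coeff_def)
        have lc: "coeff (at_fibre 1 P) n \<noteq> 0"
        proof -
          obtain a where a: "coeff P n = [:a:]" using deg[of n] d by (auto elim: degree_eq_zeroE)
          then have "a \<noteq> 0" using P0 by (auto simp: n_def)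
          then show ?thesis by (simp add: coeff_map_poly a)
        qed
        have "coeff (pderiv (at_fibre 1 P)) n = 0"
          by (simp add: coeff_pderiv coeff_map_poly coeff_eq_0 n_def)
        then have "poly k 1 * coeff (at_fibre 1 P) n = 0" using arg_cong[OF e, of "\<lambda>p. coeff p n"] by simp
        then have "poly k 1 = 0" using lc by simp
        then have "pderiv (at_fibre 1 P) = 0" using e by simp
        then have "degree (at_fibre 1 P) = 0" by (simp add: pderiv_eq_0_iff)
        moreover have "n \<le> degree (at_fibre 1 P)" using lc by (rule le_degree)
        ultimately show ?thesis by (simp add: n_def)
      qed
    qed
  qed
qed

section \<open>The linearised normal equation\<close>

definition growth :: "complex poly poly" where "growth = [:- 2 * b_coeff, - 2 * b_coeff:]"

text \<open>
  The system linearised along its invariant plane, in projective form: the base point \<open>w\<close>, the direction \<open>x\<close>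
  governed by the Riccati equation, and the size \<open>v\<close>, multiplied at the rate \<open>growth = -2 \<beta> (1 + x)\<close>. The
  variables are nested with \<open>v\<close> outermost and \<open>w\<close> innermost.
\<close>

definition normal_der :: "complex poly poly poly \<Rightarrow> complex poly poly poly" where
  "normal_der N = map_poly riccati N + [:0, growth:] * pderiv N"

lemma riccati_0 [simp]: "riccati 0 = 0"
  by (simp add: riccati_def)

lemma riccati_add: "riccati (P + Q) = riccati P + riccati Q"
  by (simp add: riccati_def map_poly_pderiv_add smult_add_right pderiv_add algebra_simps)

lemma riccati_mult: "riccati (P * Q) = riccati P * Q + P * riccati Q"
proof -
  have "map_poly pderiv (P * Q) = map_poly pderiv P * Q + P * map_poly pderiv Q"
    by (rule map_poly_derivation_mult) (simp_all add: pderiv_add pderiv_mult algebra_simps)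
  then show ?thesis
    by (simp add: riccati_def pderiv_mult smult_add_right algebra_simps)
qed

lemma normal_der_mult:
  "normal_der (M * N) = normal_der M * N + M * normal_der N"
proof -
  have "map_poly riccati (M * N) = map_poly riccati M * N + M * map_poly riccati N"
    by (rule map_poly_derivation_mult) (simp_all add: riccati_add riccati_mult)
  then show ?thesis
    by (simp add: normal_der_def pderiv_mult algebra_simps del: mult_pCons_left mult_pCons_right)
qed

lemma normal_der_add: "normal_der (M + N) = normal_der M + normal_der N"
proof -
  have "map_poly riccati (M + N) = map_poly riccati M + map_poly riccati N"
    by (rule map_poly_add_hom) (simp_all add: riccati_add)
  then show ?thesis
    by (simp add: normal_der_def pderiv_add algebra_simps del: mult_pCons_left mult_pCons_right)
qed

lemma coeff_normal_der:
  "coeff (normal_der N) j = riccati (coeff N j) + of_nat j * growth * coeff N j"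
  by (cases j) (simp_all add: normal_der_def coeff_map_poly coeff_pderiv algebra_simps)

text \<open>
  The derivation preserves the degree in \<open>v\<close>, so each coefficient of \<open>N\<close> in \<open>v\<close> is an invariant curve of the Riccati
  foliation and by \<open>riccati_invariant_fibre\<close> free of \<open>x\<close>. The cofactor of the power \<open>v\<^sup>j\<close> has the term
  \<open>-2 j \<beta> x\<close>, so two different powers cannot share one.
\<close>

lemma normal_der_invariant_monomial:
  assumes eq: "normal_der N = K * N" and "N \<noteq> 0"
  obtains p j where "N = monom [:p:] j"
proof -
  define n where "n = degree N"
  have "degree (normal_der N) \<le> n"
    by (rule degree_le) (simp add: coeff_normal_der coeff_eq_0 n_def)
  then have "degree K = 0"
    using eq assms(2) by (cases "K = 0") (simp_all add: degree_mult_eq n_def)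
  then obtain \<kappa> where K: "K = [:\<kappa>:]" by (rule degree_eq_zeroE)
  have coefficient: "riccati (coeff N j) = (\<kappa> - of_nat j * growth) * coeff N j" for j
    using arg_cong[OF eq, of "\<lambda>p. coeff p j"] by (simp add: coeff_normal_der K algebra_simps)
  have c1: "coeff \<kappa> 1 = - 2 * of_nat j * b_coeff" and d0: "degree (coeff N j) = 0"
    if nzj: "coeff N j \<noteq> 0" for j
  proof -
    show d0: "degree (coeff N j) = 0" by (rule riccati_invariant_fibre[OF coefficient nzj])
    obtain k where "\<kappa> - of_nat j * growth = [:k, 2 * of_nat (degree (coeff N j)) * b_coeff:]"
      by (rule riccati_cofactor[OF coefficient nzj])
    then have "coeff (\<kappa> - of_nat j * growth) 1 = 0" by (simp add: d0)
    then have "coeff \<kappa> 1 + 2 * of_nat j * b_coeff = 0"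
      by (simp add: growth_def of_nat_poly algebra_simps)
    then show "coeff \<kappa> 1 = - 2 * of_nat j * b_coeff"
      by (simp add: add_eq_0_iff)
  qed
  have ln: "coeff N n \<noteq> 0" using assms(2) by (simp add: n_def)
  have z: "coeff N j = 0" if "j \<noteq> n" for j
  proof (rule ccontr)
    assume "coeff N j \<noteq> 0"
    then have "- 2 * of_nat j * b_coeff = - 2 * of_nat n * b_coeff" using c1 ln by metis
    moreover have "b_coeff \<noteq> 0" by (simp add: b_coeff_def)
    ultimately show False using that by simp
  qed
  obtain p where "coeff N n = [:p:]" using d0[OF ln] by (rule degree_eq_zeroE)
  then have "N = monom [:p:] n"
    using z by (intro poly_eqI) auto
  then show ?thesis by (rule that)
qed

text \<open>
  In lowest terms, the numerator and the denominator of a rational first integral are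
  invariant, hence of the form \<open>p(w) v\<^sup>j\<close>. The coefficients of \<open>x\<close> in the cofactors force equal exponents \<open>j\<close>, and
  the remaining relation \<open>p1' p2 = p1 p2'\<close> between coprime polynomials makes both constant.
\<close>

lemma normal_der_no_invariants:
  assumes eq: "normal_der N1 * N2 = N1 * normal_der N2" and nz: "N1 \<noteq> 0" "N2 \<noteq> 0"
  shows "\<exists>c. N1 = [:[:[:c:]:]:] * N2"
proof -
  define d where "d = gcd N1 N2"
  have "d \<noteq> 0" using nz by (simp add: d_def)
  obtain P1 P2 where P: "N1 = d * P1" "N2 = d * P2" and cop: "coprime P1 P2"
    using gcd_coprime_exists[of N1 N2] \<open>d \<noteq> 0\<close> unfolding d_def by (metis mult.commute)
  have P0: "P1 \<noteq> 0" "P2 \<noteq> 0" using P nz by auto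
  have "d * d * (normal_der P1 * P2) = d * d * (P1 * normal_der P2)"
    using eq unfolding P normal_der_mult by (simp add: algebra_simps)
  then have e: "normal_der P1 * P2 = P1 * normal_der P2" using \<open>d \<noteq> 0\<close> by simp
  have "P1 dvd normal_der P1"
    using e cop by (metis coprime_dvd_mult_left_iff dvd_triv_left)
  then obtain p1 j1 where p1: "P1 = monom [:p1:] j1"
    by (metis dvdE mult.commute normal_der_invariant_monomial P0(1))
  have "P2 dvd normal_der P2"
    using e cop by (metis coprime_commute coprime_dvd_mult_right_iff dvd_triv_right)
  then obtain p2 j2 where p2: "P2 = monom [:p2:] j2"
    by (metis dvdE mult.commute normal_der_invariant_monomial P0(2))
  have pn: "p1 \<noteq> 0" "p2 \<noteq> 0" using p1 p2 P0 by auto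
  have r: "riccati [:p:] = [:speed * pderiv p:]" for p
    by (simp add: riccati_def map_poly_pCons pderiv_pCons)
  have nd: "normal_der (monom [:p:] j) = monom ([:speed * pderiv p:] + of_nat j * growth * [:p:]) j" for p j
    by (rule poly_eqI) (simp add: coeff_normal_der r)
  have "([:speed * pderiv p1:] + of_nat j1 * growth * [:p1:]) * [:p2:] =
        [:p1:] * ([:speed * pderiv p2:] + of_nat j2 * growth * [:p2:])"
    using e unfolding p1 p2 nd mult_monom by simp
  then have c: "coeff (([:speed * pderiv p1:] + of_nat j1 * growth * [:p1:]) * [:p2:]) i =
        coeff ([:p1:] * ([:speed * pderiv p2:] + of_nat j2 * growth * [:p2:])) i" for i by simp
  have "of_nat j1 * (2 * b_coeff * p1 * p2) = of_nat j2 * (2 * b_coeff * p1 * p2)"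
    using c[of 1] by (simp add: growth_def of_nat_poly algebra_simps)
  moreover have "b_coeff \<noteq> 0" by (simp add: b_coeff_def)
  ultimately have j: "j1 = j2" using pn by simp
  have "speed * (pderiv p1 * p2) = speed * (p1 * pderiv p2)"
    using c[of 0] by (simp add: growth_def of_nat_poly algebra_simps j)
  moreover have "speed \<noteq> 0" by (simp add: speed_def)
  ultimately have pe: "pderiv p1 * p2 = p1 * pderiv p2" by (simp only: mult_cancel_left) simp
  have "coprime p1 p2"
  proof (rule coprimeI)
    fix q assume "q dvd p1" "q dvd p2"
    then have "[:[:q:]:] dvd P1" "[:[:q:]:] dvd P2"
      by (auto simp: p1 p2 const_poly_dvd_iff coeff_pCons split: nat.split)
    then have "is_unit [:[:q:]:]" using cop by (meson coprime_common_divisor)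
    then show "is_unit q" by (simp add: is_unit_const_poly_iff)
  qed
  have un: "degree p = 0" if "p dvd pderiv p" for p :: "complex poly"
    using that by (metis dvd_pderiv_iff)
  have "p1 dvd pderiv p1"
    using pe \<open>coprime p1 p2\<close> by (metis coprime_dvd_mult_left_iff dvd_triv_left)
  then have "degree p1 = 0" by (rule un)
  have "p2 dvd pderiv p2"
    using pe \<open>coprime p1 p2\<close> by (metis coprime_commute coprime_dvd_mult_right_iff dvd_triv_right)
  then have "degree p2 = 0" by (rule un)
  then obtain a b where ab: "p1 = [:a:]" "p2 = [:b:]"
    using \<open>degree p1 = 0\<close> by (metis degree_eq_zeroE)
  have "b \<noteq> 0" using pn ab by auto
  then have "P1 = smult [:[:a / b:]:] P2"
    by (simp add: p1 p2 ab j smult_monom)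
  then have "N1 = [:[:[:a / b:]:]:] * N2" by (simp add: P)
  then show ?thesis by blast
qed

section \<open>A chart adapted to the level sets\<close>

text \<open>
  Coordinates on a level set of the two known integrals. Put \<open>\<epsilon> = \<eta> A\<close>. The point \<open>chart J \<sigma> \<eta> A x v\<close>, with
  \<open>J\<^sup>2 = -1\<close>, has transverse coordinates \<open>x v\<close>, \<open>v\<close> and \<open>y\<close> in units of \<open>4 \<epsilon>\<^sup>2\<close>; the value of \<open>y\<close> is dictated by the
  linear integral \<open>4 \<epsilon>\<^sup>3 \<sigma>\<close>. The coordinates along the invariant plane are \<open>\<epsilon> (A + B)\<close> and \<open>J \<epsilon> (A - B)\<close>, and the
  quadratic integral equals \<open>8 \<epsilon>\<^sup>2\<close> exactly when \<open>A B = 1 - \<epsilon>\<^sup>2 q\<close>. Multiplying by \<open>A\<close> removes the division,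
  which is why \<open>\<eta>\<close> occurs: \<open>chart_a\<close> and \<open>chart_b\<close> are \<open>A (A + B)\<close> and \<open>A (A - B)\<close>. The formulas are stated over any ring
  in order to serve both for complex numbers and for polynomials.
\<close>

definition chart_y :: "'a::comm_ring_1 \<Rightarrow> 'a \<Rightarrow> 'a \<Rightarrow> 'a \<Rightarrow> 'a \<Rightarrow> 'a" where
  "chart_y \<sigma> \<eta> A x v = \<eta> * A * \<sigma> - 2 * (x * v) - 2 * v"

definition chart_q :: "'a::comm_ring_1 \<Rightarrow> 'a \<Rightarrow> 'a \<Rightarrow> 'a \<Rightarrow> 'a \<Rightarrow> 'a" where
  "chart_q \<sigma> \<eta> A x v = 4 * (x * v)\<^sup>2 + 4 * v\<^sup>2 + 2 * (chart_y \<sigma> \<eta> A x v)\<^sup>2"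

definition chart_a :: "'a::comm_ring_1 \<Rightarrow> 'a \<Rightarrow> 'a \<Rightarrow> 'a \<Rightarrow> 'a \<Rightarrow> 'a" where
  "chart_a \<sigma> \<eta> A x v = A\<^sup>2 + 1 - (\<eta> * A)\<^sup>2 * chart_q \<sigma> \<eta> A x v"

definition chart_b :: "'a::comm_ring_1 \<Rightarrow> 'a \<Rightarrow> 'a \<Rightarrow> 'a \<Rightarrow> 'a \<Rightarrow> 'a" where
  "chart_b \<sigma> \<eta> A x v = A\<^sup>2 - 1 + (\<eta> * A)\<^sup>2 * chart_q \<sigma> \<eta> A x v"

definition chart :: "'a::comm_ring_1 \<Rightarrow> 'a \<Rightarrow> 'a \<Rightarrow> 'a \<Rightarrow> 'a \<Rightarrow> 'a \<Rightarrow> 'a ^ 5" where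
  "chart J \<sigma> \<eta> A x v = vector
     [\<eta> * chart_a \<sigma> \<eta> A x v + 4 * (\<eta> * A)\<^sup>2 * (x * v),
      4 * (\<eta> * A)\<^sup>2 * v - J * \<eta> * chart_b \<sigma> \<eta> A x v,
      4 * (\<eta> * A)\<^sup>2 * v + J * \<eta> * chart_b \<sigma> \<eta> A x v,
      4 * (\<eta> * A)\<^sup>2 * (x * v) - \<eta> * chart_a \<sigma> \<eta> A x v,
      4 * (\<eta> * A)\<^sup>2 * chart_y \<sigma> \<eta> A x v]"

text \<open>
  The logarithmic derivative of \<open>A\<close> along the flow, in the time scale of \<open>chart_der\<close> and divided by \<open>v\<close>.
\<close>

definition chart_rate :: "'a::comm_ring_1 \<Rightarrow> 'a \<Rightarrow> 'a \<Rightarrow> 'a \<Rightarrow> 'a \<Rightarrow> 'a \<Rightarrow> 'a" where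
  "chart_rate J \<sigma> \<eta> A x v = chart_a \<sigma> \<eta> A x v + 8 * J * (\<eta> * A)\<^sup>2 *
     ((1 - J) * v * chart_y \<sigma> \<eta> A x v - (x * v) * v + J * (x * v)\<^sup>2)"

lemma vector_5 [simp]:
  "(vector [a, b, c, d, e] :: 'a::zero ^ 5) $ 1 = a"
  "(vector [a, b, c, d, e] :: 'a::zero ^ 5) $ 2 = b"
  "(vector [a, b, c, d, e] :: 'a::zero ^ 5) $ 3 = c"
  "(vector [a, b, c, d, e] :: 'a::zero ^ 5) $ 4 = d"
  "(vector [a, b, c, d, e] :: 'a::zero ^ 5) $ 5 = e"
  by (simp_all add: vector_def)

text \<open>
  The five components of the vector field in the chart, with \<open>u = x v\<close> and the derivatives of the ingredients
  given by name, so that each becomes a polynomial identity modulo \<open>J\<^sup>2 = -1\<close>.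
\<close>

lemma level_identity:
  fixes A :: "'a::comm_ring_1"
  assumes J: "J * J = -1" and "BB = 2 * A\<^sup>2 - AA" "e = \<eta> * A"
    "\<theta> = AA + 8 * J * e\<^sup>2 * ((1 - J) * v * y - u * v + J * u\<^sup>2)"
    "dQ = 4 * v * (- 2 * BB * u\<^sup>2 + 2 * J * AA * u * v + 2 * BB * v * y - 2 * J * AA * v * y)"
    "du = v * (- BB * y - BB * u + J * AA * v)"
    "dAA = \<eta> * v * \<theta> * BB - \<eta> * e\<^sup>2 * dQ"
    "dBB = \<eta> * v * \<theta> * AA + \<eta> * e\<^sup>2 * dQ"
    "X1 = \<eta> * AA + 4 * e\<^sup>2 * u" "X2 = 4 * e\<^sup>2 * v - J * \<eta> * BB"
    "X3 = 4 * e\<^sup>2 * v + J * \<eta> * BB" "X4 = 4 * e\<^sup>2 * u - \<eta> * AA" "X5 = 4 * e\<^sup>2 * y"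
  shows "\<eta> * (dAA + 4 * e\<^sup>2 * du) = J * v * (X3 * X5 - X2 * X4)"
    "\<eta> * (4 * e\<^sup>2 * (v * BB * y) - J * dBB) = J * v * (X4 * X1 - X3 * X5)"
    "\<eta> * (4 * e\<^sup>2 * (v * BB * y) + J * dBB) = J * v * (X5 * X2 - X4 * X1)"
    "\<eta> * (4 * e\<^sup>2 * du - dAA) = J * v * (X1 * X3 - X5 * X2)"
    "\<eta> * (4 * e\<^sup>2 * (v * (2 * BB * u - 2 * J * AA * v))) = J * v * (X2 * X4 - X1 * X3)"
proof -
  have JJ: "J * (J * z) = - z" for z
    using J by (simp flip: mult.assoc)
  note simps = assms(2-) JJ J algebra_simps power2_eq_square
  show "\<eta> * (dAA + 4 * e\<^sup>2 * du) = J * v * (X3 * X5 - X2 * X4)"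
    by (simp add: simps)
  show "\<eta> * (4 * e\<^sup>2 * (v * BB * y) - J * dBB) = J * v * (X4 * X1 - X3 * X5)"
    by (simp add: simps)
  show "\<eta> * (4 * e\<^sup>2 * (v * BB * y) + J * dBB) = J * v * (X5 * X2 - X4 * X1)"
    by (simp add: simps)
  show "\<eta> * (4 * e\<^sup>2 * du - dAA) = J * v * (X1 * X3 - X5 * X2)"
    by (simp add: simps)
  show "\<eta> * (4 * e\<^sup>2 * (v * (2 * BB * u - 2 * J * AA * v))) = J * v * (X2 * X4 - X1 * X3)"
    by (simp add: simps)
qed

section \<open>Derivations and the system in the chart\<close>

definition derivation :: "('a::comm_ring_1 \<Rightarrow> 'a) \<Rightarrow> bool" where
  "derivation d \<longleftrightarrow> (\<forall>a b. d (a + b) = d a + d b) \<and> (\<forall>a b. d (a * b) = d a * b + a * d b)"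

lemma derivation_add: "derivation d \<Longrightarrow> d (a + b) = d a + d b"
  and derivation_mult: "derivation d \<Longrightarrow> d (a * b) = d a * b + a * d b"
  by (simp_all add: derivation_def)

lemma derivation_0: "derivation d \<Longrightarrow> d 0 = 0"
  by (metis add_cancel_right_right add_0 derivation_add)

lemma derivation_1: "derivation d \<Longrightarrow> d 1 = 0"
  by (metis add_cancel_right_right derivation_mult mult_1 mult_1_right)

lemma derivation_minus: "derivation d \<Longrightarrow> d (- a) = - d a"
  by (metis add.right_inverse derivation_0 derivation_add add_eq_0_iff)

lemma derivation_diff: "derivation d \<Longrightarrow> d (a - b) = d a - d b"
  by (metis diff_conv_add_uminus derivation_add derivation_minus)

lemma derivation_of_nat: "derivation d \<Longrightarrow> d (of_nat n) = 0"
  by (induction n) (simp_all add: derivation_0 derivation_1 derivation_add)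

lemma derivation_numeral: "derivation d \<Longrightarrow> d (numeral n) = 0"
  by (metis derivation_of_nat of_nat_numeral)

lemma derivation_power2: "derivation d \<Longrightarrow> d (a\<^sup>2) = 2 * a * d a"
  by (simp add: power2_eq_square derivation_mult algebra_simps)

lemma derivation_power: "derivation d \<Longrightarrow> a * d (a ^ n) = of_nat n * a ^ n * d a"
proof (induction n)
  case (Suc n)
  then have "a * d (a ^ Suc n) = a ^ Suc n * d a + a * (a * d (a ^ n))"
    by (simp add: derivation_mult algebra_simps)
  then show ?case using Suc by (simp add: algebra_simps)
qed (simp add: derivation_1)

lemmas derivation_simps = derivation_add derivation_mult derivation_0 derivation_1
  derivation_minus derivation_diff derivation_numeral derivation_power2

lemma derivation_pderiv: "derivation (pderiv :: 'a::idom poly \<Rightarrow> _)"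
  by (simp add: derivation_def pderiv_add pderiv_mult algebra_simps)

lemma derivation_map_poly: "derivation d \<Longrightarrow> derivation (map_poly d)"
  unfolding derivation_def[of "map_poly d"]
  by (auto intro!: map_poly_add_hom map_poly_derivation_mult simp: derivation_0 derivation_add derivation_mult)

lemma derivation_scale: "derivation d \<Longrightarrow> derivation (\<lambda>a. c * d a)"
  by (simp add: derivation_def algebra_simps)

lemma derivation_plus: "derivation d \<Longrightarrow> derivation d' \<Longrightarrow> derivation (\<lambda>a. d a + d' a)"
  by (simp add: derivation_def algebra_simps)

type_synonym ring3 = "complex poly poly poly"
type_synonym ring4 = "complex poly poly poly poly"

text \<open>
  The four variables in nesting order \<open>\<eta>, v, x, A\<close> from the outside, so that setting \<open>\<eta> = 0\<close> leaves the ring on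
  which \<open>normal_der\<close> acts.
\<close>

definition cst :: "complex \<Rightarrow> ring4" where "cst c = [:[:[:[:c:]:]:]:]"
definition var_A :: ring4 where "var_A = [:[:[:[:0, 1:]:]:]:]"
definition var_x :: ring4 where "var_x = [:[:[:0, 1:]:]:]"
definition var_v :: ring4 where "var_v = [:[:0, 1:]:]"
definition var_eta :: ring4 where "var_eta = [:0, 1:]"

abbreviation "ring_y \<sigma> \<equiv> chart_y (cst \<sigma>) var_eta var_A var_x var_v"
abbreviation "ring_a \<sigma> \<equiv> chart_a (cst \<sigma>) var_eta var_A var_x var_v"
abbreviation "ring_b \<sigma> \<equiv> chart_b (cst \<sigma>) var_eta var_A var_x var_v"
abbreviation "ring_q \<sigma> \<equiv> chart_q (cst \<sigma>) var_eta var_A var_x var_v"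
abbreviation "ring_rate \<sigma> \<equiv> chart_rate (cst \<i>) (cst \<sigma>) var_eta var_A var_x var_v"
abbreviation "ring_chart \<sigma> \<equiv> chart (cst \<i>) (cst \<sigma>) var_eta var_A var_x var_v"

text \<open>
  The Karabut field in the coordinates \<open>A, x, v, \<eta>\<close>, in the complex time scaled by \<open>\<i> v / \<eta>\<close>. This scaling makes it
  polynomial with a nonzero limit for \<open>\<eta> \<rightarrow> 0\<close>.
\<close>

definition chart_der :: "complex \<Rightarrow> ring4 \<Rightarrow> ring4" where
  "chart_der \<sigma> s = var_v * var_A * ring_rate \<sigma> * map_poly (map_poly (map_poly pderiv)) s
     + ((- ring_b \<sigma> * ring_y \<sigma> - ring_b \<sigma> * var_x * var_v + cst \<i> * ring_a \<sigma> * var_v - var_x * ring_b \<sigma> * ring_y \<sigma>)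
          * map_poly (map_poly pderiv) s
     + (var_v * ring_b \<sigma> * ring_y \<sigma> * map_poly pderiv s
     + (- var_eta * var_v * ring_rate \<sigma>) * pderiv s))"

lemma derivation_chart_der: "derivation (chart_der \<sigma>)"
  unfolding chart_der_def
  by (intro derivation_plus derivation_scale derivation_map_poly derivation_pderiv)

lemma partials_generators:
  "map_poly (map_poly (map_poly pderiv)) (cst c) = 0" "map_poly (map_poly pderiv) (cst c) = 0"
  "map_poly pderiv (cst c) = 0" "pderiv (cst c) = 0"
  "map_poly (map_poly (map_poly pderiv)) var_A = 1" "map_poly (map_poly pderiv) var_A = 0"
  "map_poly pderiv var_A = 0" "pderiv var_A = 0"
  "map_poly (map_poly (map_poly pderiv)) var_x = 0" "map_poly (map_poly pderiv) var_x = 1"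
  "map_poly pderiv var_x = 0" "pderiv var_x = 0"
  "map_poly (map_poly (map_poly pderiv)) var_v = 0" "map_poly (map_poly pderiv) var_v = 0"
  "map_poly pderiv var_v = 1" "pderiv var_v = 0"
  "map_poly (map_poly (map_poly pderiv)) var_eta = 0" "map_poly (map_poly pderiv) var_eta = 0"
  "map_poly pderiv var_eta = 0" "pderiv var_eta = 1"
  by (simp_all add: cst_def var_A_def var_x_def var_v_def var_eta_def map_poly_pCons pderiv_pCons
      derivation_1[OF derivation_map_poly] derivation_map_poly derivation_pderiv flip: one_pCons)

lemma chart_der_generators:
  "chart_der \<sigma> (cst c) = 0"
  "chart_der \<sigma> var_A = var_v * var_A * ring_rate \<sigma>"
  "chart_der \<sigma> var_x = - ring_b \<sigma> * ring_y \<sigma> - ring_b \<sigma> * var_x * var_v + cst \<i> * ring_a \<sigma> * var_v - var_x * ring_b \<sigma> * ring_y \<sigma>"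
  "chart_der \<sigma> var_v = var_v * ring_b \<sigma> * ring_y \<sigma>"
  "chart_der \<sigma> var_eta = - var_eta * var_v * ring_rate \<sigma>"
  by (simp_all add: chart_der_def partials_generators)

text \<open>
  The parameter \<open>\<epsilon> = \<eta> A\<close> is fixed by the value of the quadratic integral. Polynomials in it act as
  constants and may be subtracted from an integral.
\<close>

lemma chart_der_param: "chart_der \<sigma> (var_eta * var_A) = 0"
  by (simp add: derivation_mult[OF derivation_chart_der] chart_der_generators)

text \<open>
  The vector field over an arbitrary ring, for substitution of polynomials.
\<close>

definition karabut_rhs :: "'a::comm_ring_1 ^ 5 \<Rightarrow> 'a ^ 5" where
  "karabut_rhs X = vector
     [X$3 * X$5 - X$2 * X$4,
      X$4 * X$1 - X$3 * X$5,
      X$5 * X$2 - X$4 * X$1,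
      X$1 * X$3 - X$5 * X$2,
      X$2 * X$4 - X$1 * X$3]"

lemma exhaust_5: "x = 1 \<or> x = 2 \<or> x = 3 \<or> x = 4 \<or> x = (5::5)"
proof (induct x)
  case (of_int z)
  then have "0 \<le> z" and "z < 5" by simp_all
  then have "z = 0 \<or> z = 1 \<or> z = 2 \<or> z = 3 \<or> z = 4" by arith
  then show ?case by auto
qed

lemma karabut_rhs_nth [simp]:
  "karabut_rhs X $ 1 = X$3 * X$5 - X$2 * X$4"
  "karabut_rhs X $ 2 = X$4 * X$1 - X$3 * X$5"
  "karabut_rhs X $ 3 = X$5 * X$2 - X$4 * X$1"
  "karabut_rhs X $ 4 = X$1 * X$3 - X$5 * X$2"
  "karabut_rhs X $ 5 = X$2 * X$4 - X$1 * X$3"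
  by (simp_all add: karabut_rhs_def)

lemma chart_der_karabut: "var_eta * chart_der \<sigma> (ring_chart \<sigma> $ i) = cst \<i> * var_v * karabut_rhs (ring_chart \<sigma>) $ i"
proof -
  note d = derivation_simps[OF derivation_chart_der]
  define y u AA BB \<theta> e where "y = ring_y \<sigma>" and "u = var_x * var_v" and "AA = ring_a \<sigma>" and "BB = ring_b \<sigma>"
    and "\<theta> = ring_rate \<sigma>" and "e = var_eta * var_A"
  define dQ where "dQ = 4 * var_v * (- 2 * BB * u\<^sup>2 + 2 * cst \<i> * AA * u * var_v + 2 * BB * var_v * y - 2 * cst \<i> * AA * var_v * y)"
  define du where "du = var_v * (- BB * y - BB * u + cst \<i> * AA * var_v)"
  have JJ: "cst \<i> * cst \<i> = -1" by (simp add: cst_def one_pCons)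
  have de: "chart_der \<sigma> e = 0" by (simp add: e_def chart_der_param)
  have dv: "chart_der \<sigma> var_v = var_v * BB * y" by (simp add: chart_der_generators BB_def y_def)
  have dx: "chart_der \<sigma> var_x = - BB * y - BB * var_x * var_v + cst \<i> * AA * var_v - var_x * BB * y"
    by (simp add: chart_der_generators AA_def BB_def y_def)
  have du: "chart_der \<sigma> u = du"
    by (simp add: d(2) dv dx u_def du_def algebra_simps)
  have y: "y = e * cst \<sigma> - 2 * u - 2 * var_v" by (simp add: y_def chart_y_def e_def u_def)
  have dy: "chart_der \<sigma> y = var_v * (2 * BB * u - 2 * cst \<i> * AA * var_v)"
    unfolding y d de chart_der_generators(1) du dv by (simp add: du_def y algebra_simps)
  have Q: "ring_q \<sigma> = 4 * u\<^sup>2 + 4 * var_v\<^sup>2 + 2 * y\<^sup>2" by (simp add: chart_q_def u_def y_def)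
  have dQ: "chart_der \<sigma> (ring_q \<sigma>) = dQ"
    unfolding Q d du dv dy by (simp add: du_def dQ_def algebra_simps power2_eq_square)
  have AA: "AA = var_A\<^sup>2 + 1 - e\<^sup>2 * ring_q \<sigma>" by (simp add: AA_def chart_a_def e_def)
  have BB: "BB = var_A\<^sup>2 - 1 + e\<^sup>2 * ring_q \<sigma>" by (simp add: BB_def chart_b_def e_def)
  have BA: "BB = 2 * var_A\<^sup>2 - AA" by (simp add: AA BB)
  have dA: "chart_der \<sigma> var_A = var_v * var_A * \<theta>" by (simp add: chart_der_generators \<theta>_def)
  have dge: "chart_der \<sigma> var_eta = - var_eta * var_v * \<theta>" by (simp add: chart_der_generators \<theta>_def)
  have \<theta>: "\<theta> = AA + 8 * cst \<i> * e\<^sup>2 * ((1 - cst \<i>) * var_v * y - u * var_v + cst \<i> * u\<^sup>2)"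
    by (simp add: \<theta>_def chart_rate_def AA_def e_def y_def u_def)
  have dAA': "chart_der \<sigma> AA = 2 * var_A * (var_v * var_A * \<theta>) - e\<^sup>2 * dQ"
    unfolding AA d dA de dQ by (simp add: algebra_simps)
  have dBB': "chart_der \<sigma> BB = 2 * var_A * (var_v * var_A * \<theta>) + e\<^sup>2 * dQ"
    unfolding BB d dA de dQ by (simp add: algebra_simps)
  have dAA: "chart_der \<sigma> (var_eta * AA) = var_eta * var_v * \<theta> * BB - var_eta * e\<^sup>2 * dQ"
    unfolding d dge dAA' BA by (simp add: algebra_simps power2_eq_square)
  have dBB: "chart_der \<sigma> (var_eta * BB) = var_eta * var_v * \<theta> * AA + var_eta * e\<^sup>2 * dQ"
    unfolding d dge dBB' unfolding BA by (simp add: algebra_simps power2_eq_square)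
  have X: "ring_chart \<sigma> $ 1 = var_eta * AA + 4 * e\<^sup>2 * u" "ring_chart \<sigma> $ 2 = 4 * e\<^sup>2 * var_v - cst \<i> * var_eta * BB"
    "ring_chart \<sigma> $ 3 = 4 * e\<^sup>2 * var_v + cst \<i> * var_eta * BB" "ring_chart \<sigma> $ 4 = 4 * e\<^sup>2 * u - var_eta * AA"
    "ring_chart \<sigma> $ 5 = 4 * e\<^sup>2 * y"
    by (simp_all add: chart_def AA_def BB_def e_def u_def y_def)
  have dX: "chart_der \<sigma> (ring_chart \<sigma> $ 1) = chart_der \<sigma> (var_eta * AA) + 4 * e\<^sup>2 * du"
    "chart_der \<sigma> (ring_chart \<sigma> $ 2) = 4 * e\<^sup>2 * (var_v * BB * y) - cst \<i> * chart_der \<sigma> (var_eta * BB)"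
    "chart_der \<sigma> (ring_chart \<sigma> $ 3) = 4 * e\<^sup>2 * (var_v * BB * y) + cst \<i> * chart_der \<sigma> (var_eta * BB)"
    "chart_der \<sigma> (ring_chart \<sigma> $ 4) = 4 * e\<^sup>2 * du - chart_der \<sigma> (var_eta * AA)"
    "chart_der \<sigma> (ring_chart \<sigma> $ 5) = 4 * e\<^sup>2 * (var_v * (2 * BB * u - 2 * cst \<i> * AA * var_v))"
    unfolding X by (simp_all add: d chart_der_generators(1) de du dv dy algebra_simps)
  note L = level_identity[OF JJ BA e_def \<theta> dQ_def du_def dAA dBB X]
  show ?thesis using exhaust_5[of i] by (auto simp: dX L)
qed

section \<open>Order in eta, and the absence of formal integrals\<close>

definition eval4 :: "ring4 \<Rightarrow> complex \<Rightarrow> complex \<Rightarrow> complex \<Rightarrow> complex \<Rightarrow> complex" where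
  "eval4 s \<eta> A x v = poly (poly (poly (poly s [:[:[:\<eta>:]:]:]) [:[:v:]:]) [:x:]) A"

lemma eval4_simps [simp]:
  "eval4 (s + t) \<eta> A x v = eval4 s \<eta> A x v + eval4 t \<eta> A x v"
  "eval4 (s - t) \<eta> A x v = eval4 s \<eta> A x v - eval4 t \<eta> A x v"
  "eval4 (s * t) \<eta> A x v = eval4 s \<eta> A x v * eval4 t \<eta> A x v"
  "eval4 (- s) \<eta> A x v = - eval4 s \<eta> A x v"
  "eval4 (s ^ n) \<eta> A x v = eval4 s \<eta> A x v ^ n"
  "eval4 (cst c) \<eta> A x v = c"
  "eval4 var_A \<eta> A x v = A" "eval4 var_x \<eta> A x v = x" "eval4 var_v \<eta> A x v = v" "eval4 var_eta \<eta> A x v = \<eta>"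
  "eval4 0 \<eta> A x v = 0" "eval4 1 \<eta> A x v = 1"
  by (simp_all add: eval4_def cst_def var_A_def var_x_def var_v_def var_eta_def poly_power)

lemma eval4_of_nat: "eval4 (of_nat n) \<eta> A x v = of_nat n"
  by (induction n) simp_all

lemma eval4_numeral [simp]: "eval4 (numeral n) \<eta> A x v = numeral n"
  by (metis eval4_of_nat of_nat_numeral)

lemma eval4_chart: "eval4 (ring_chart \<sigma> $ i) \<eta> A x v = chart \<i> \<sigma> \<eta> A x v $ i"
  using exhaust_5[of i] by (auto simp: chart_def chart_a_def chart_b_def chart_q_def chart_y_def)

lemma continuous_eval4: "isCont (\<lambda>\<eta>. eval4 s \<eta> A x v) \<eta>0"
proof (induction s)
  case (pCons r s)
  have "eval4 (pCons r s) \<eta> A x v = eval4 [:r:] 0 A x v + \<eta> * eval4 s \<eta> A x v" for \<eta>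
    by (simp add: eval4_def)
  then show ?case using pCons by (auto intro!: continuous_intros)
qed (simp add: eval4_def)

text \<open>
  Polynomial identities may be checked at points. The points with \<open>A = 0\<close> are left out because
  the curves divide by \<open>A\<close>.
\<close>

lemma ring3_eq_0:
  fixes r :: ring3
  assumes "\<And>A x v. A \<noteq> 0 \<Longrightarrow> poly (poly (poly r [:[:v:]:]) [:x:]) A = 0"
  shows "r = 0"
proof -
  have inf: "p = 0" if "\<And>c. poly p (f c) = 0" and "inj f" for p :: "'a::idom poly" and f :: "complex \<Rightarrow> 'a"
  proof (rule ccontr)
    assume "p \<noteq> 0"
    then have "finite {a. poly p a = 0}" by (rule poly_roots_finite)
    moreover have "range f \<subseteq> {a. poly p a = 0}" using that by auto
    ultimately have "finite (range f)" by (rule finite_subset[rotated])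
    then show False using \<open>inj f\<close> finite_imageD infinite_UNIV_char_0 by blast
  qed
  have a: "poly (poly r [:[:v:]:]) [:x:] = 0" for x v
  proof (rule ccontr)
    let ?p = "poly (poly r [:[:v:]:]) [:x:]"
    assume "?p \<noteq> 0"
    then have "finite {a. poly ?p a = 0}" by (rule poly_roots_finite)
    moreover have "- {0} \<subseteq> {a. poly ?p a = 0}" using assms by auto
    ultimately have "finite (- {0 :: complex})" by (rule finite_subset[rotated])
    then show False by (simp add: infinite_UNIV_char_0)
  qed
  have "poly r [:[:v:]:] = 0" for v
    by (rule inf[of _ "\<lambda>x. [:x:]"]) (simp_all add: a inj_def)
  then show ?thesis
    by (intro inf[of _ "\<lambda>v. [:[:v:]:]"]) (simp_all add: inj_def)
qed

lemma var_eta_power_dvd_iff: "var_eta ^ m dvd s \<longleftrightarrow> (\<forall>k<m. coeff s k = 0)"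
proof -
  have "var_eta ^ m = monom 1 m" by (simp add: var_eta_def monom_altdef)
  then show ?thesis by (simp add: monom_1_dvd_iff')
qed

text \<open>
  An analytic estimate becomes an algebraic divisibility: the lowest nonzero coefficient in \<open>\<eta>\<close> is a nonzero
  polynomial, and at a point where it does not vanish it would violate the bound.
\<close>

lemma var_eta_power_dvdI:
  assumes "\<And>A x v. A \<noteq> 0 \<Longrightarrow> \<exists>C. \<forall>\<^sub>F \<eta> in at 0. norm (eval4 s \<eta> A x v) \<le> C * norm \<eta> ^ m"
  shows "var_eta ^ m dvd s"
proof (rule ccontr)
  assume "\<not> var_eta ^ m dvd s"
  then have ex: "\<exists>k. k < m \<and> coeff s k \<noteq> 0" by (simp add: var_eta_power_dvd_iff)
  define k where "k = (LEAST k. k < m \<and> coeff s k \<noteq> 0)"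
  have k: "k < m" "coeff s k \<noteq> 0" using LeastI_ex[OF ex] by (auto simp: k_def)
  have "coeff s l = 0" if "l < k" for l
    using not_less_Least[of l "\<lambda>k. k < m \<and> coeff s k \<noteq> 0"] that k by (auto simp: k_def)
  then have "var_eta ^ k dvd s" by (simp add: var_eta_power_dvd_iff)
  then obtain t where t: "s = var_eta ^ k * t" by (rule dvdE)
  have "coeff t 0 = coeff s k"
    by (simp add: t var_eta_def coeff_mult_0 flip: monom_altdef[of 1, simplified])
     (simp add: coeff_monom_mult monom_altdef[symmetric])
  then obtain A x v where A: "A \<noteq> 0" "poly (poly (poly (coeff t 0) [:[:v:]:]) [:x:]) A \<noteq> 0"
    using ring3_eq_0 k by metis
  then have t0: "eval4 t 0 A x v \<noteq> 0" by (simp add: eval4_def poly_0_coeff_0)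
  obtain C where C: "\<forall>\<^sub>F \<eta> in at 0. norm (eval4 s \<eta> A x v) \<le> C * norm \<eta> ^ m" using assms A by blast
  have "\<forall>\<^sub>F \<eta> in at 0. norm (eval4 t \<eta> A x v) \<le> C * norm \<eta> ^ (m - k)"
    using C eventually_neq_at_within[of 0 0 UNIV]
  proof eventually_elim
    case (elim \<eta>)
    have "norm \<eta> ^ k * norm (eval4 t \<eta> A x v) \<le> norm \<eta> ^ k * (C * norm \<eta> ^ (m - k))"
      using elim(1) k(1) by (simp add: t norm_mult norm_power algebra_simps flip: power_add)
    then show ?case using elim(2) by (simp add: mult_le_cancel_left)
  qed
  moreover have "isCont (\<lambda>\<eta>::complex. C * norm \<eta> ^ (m - k)) 0"
    by (intro continuous_intros)
  then have "((\<lambda>\<eta>::complex. C * norm \<eta> ^ (m - k)) \<longlongrightarrow> C * norm (0::complex) ^ (m - k)) (at 0)"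
    by (simp add: isCont_def)
  then have "((\<lambda>\<eta>::complex. C * norm \<eta> ^ (m - k)) \<longlongrightarrow> 0) (at 0)"
    using k(1) by (simp add: power_0_left)
  ultimately have "((\<lambda>\<eta>. eval4 t \<eta> A x v) \<longlongrightarrow> 0) (at 0)"
    by (rule Lim_null_comparison)
  moreover have "((\<lambda>\<eta>. eval4 t \<eta> A x v) \<longlongrightarrow> eval4 t 0 A x v) (at 0)"
    using continuous_eval4 by (simp add: isCont_def)
  ultimately show False using t0 LIM_unique by blast
qed

lemma eval4_bound_eta:
  assumes "var_eta ^ m dvd s"
  shows "\<exists>C. \<forall>\<^sub>F \<eta> in at 0. norm (eval4 s \<eta> A x v) \<le> C * norm \<eta> ^ m"
proof -
  obtain t where t: "s = var_eta ^ m * t" using assms by (rule dvdE)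
  have "((\<lambda>\<eta>. norm (eval4 t \<eta> A x v)) \<longlongrightarrow> norm (eval4 t 0 A x v)) (at 0)"
    using continuous_eval4 by (intro tendsto_norm) (simp add: isCont_def)
  then have "\<forall>\<^sub>F \<eta> in at 0. norm (eval4 t \<eta> A x v) < norm (eval4 t 0 A x v) + 1"
    by (rule order_tendstoD(2)) simp
  then have "\<forall>\<^sub>F \<eta> in at 0. norm (eval4 s \<eta> A x v) \<le> (norm (eval4 t 0 A x v) + 1) * norm \<eta> ^ m"
  proof eventually_elim
    case (elim \<eta>)
    have "norm (eval4 s \<eta> A x v) = norm \<eta> ^ m * norm (eval4 t \<eta> A x v)"
      by (simp add: t norm_mult norm_power)
    also have "\<dots> \<le> norm \<eta> ^ m * (norm (eval4 t 0 A x v) + 1)"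
      using elim by (intro mult_left_mono) auto
    finally show ?case by (simp add: mult.commute)
  qed
  then show ?thesis by blast
qed

lemma eval4_bound:
  assumes "var_eta ^ m dvd s" "A \<noteq> 0"
  shows "\<exists>C. \<forall>\<^sub>F \<epsilon> in at 0. norm (eval4 s (\<epsilon> / A) A x v) \<le> C * norm \<epsilon> ^ m"
proof -
  obtain C where C: "\<forall>\<^sub>F \<eta> in at 0. norm (eval4 s \<eta> A x v) \<le> C * norm \<eta> ^ m"
    using eval4_bound_eta[OF assms(1)] by blast
  have "filterlim (\<lambda>\<epsilon>. \<epsilon> / A) (at 0) (at 0)"
    using assms(2) by (auto simp: filterlim_at eventually_at_filter intro!: tendsto_eq_intros)
  from eventually_compose_filterlim[OF C this]
  have "\<forall>\<^sub>F \<epsilon> in at 0. norm (eval4 s (\<epsilon> / A) A x v) \<le> (C / norm A ^ m) * norm \<epsilon> ^ m"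
    by (simp add: norm_divide power_divide)
  then show ?thesis by blast
qed

lemma power_bound_le:
  fixes c C :: real
  assumes "\<forall>\<^sub>F \<epsilon> in at (0::complex). c * norm \<epsilon> ^ a \<le> C * norm \<epsilon> ^ b" "c > 0"
  shows "b \<le> a"
proof (rule ccontr)
  assume "\<not> b \<le> a"
  then have ab: "a < b" by simp
  have "\<forall>\<^sub>F \<epsilon> in at (0::complex). c \<le> C * norm \<epsilon> ^ (b - a)"
    using assms(1) eventually_neq_at_within[of 0 0 UNIV]
  proof eventually_elim
    case (elim \<epsilon>)
    have "norm \<epsilon> ^ a * c \<le> norm \<epsilon> ^ a * (C * norm \<epsilon> ^ (b - a))"
      using elim(1) ab by (simp add: algebra_simps flip: power_add)
    then show ?case using elim(2) by (simp add: mult_le_cancel_left)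
  qed
  moreover have "isCont (\<lambda>\<epsilon>::complex. C * norm \<epsilon> ^ (b - a)) 0"
    by (intro continuous_intros)
  then have "((\<lambda>\<epsilon>::complex. C * norm \<epsilon> ^ (b - a)) \<longlongrightarrow> C * norm (0::complex) ^ (b - a)) (at 0)"
    by (simp add: isCont_def)
  ultimately have "c \<le> C * norm (0::complex) ^ (b - a)"
    by (intro tendsto_lowerbound[of _ _ "at (0::complex)"]) simp_all
  then show False using ab assms(2) by (simp add: power_0_left)
qed

text \<open>
  The limit \<open>\<eta> \<rightarrow> 0\<close> linearises the system along the invariant plane, up to the time scale \<open>v\<close>. Through this identity the lack of
  rational integrals of the linearised system acts on the nonlinear one.
\<close>

lemma chart_der_at_0: "poly (chart_der \<sigma> s) 0 = [:0, 1:] * normal_der (poly s 0)"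
proof -
  have m: "poly (map_poly d s) 0 = d (poly s 0)" if "derivation d" for d :: "ring3 \<Rightarrow> ring3"
    using that by (simp add: poly_0_coeff_0 coeff_map_poly derivation_0)
  have g: "poly var_v 0 = [:0, 1:]" "poly var_A 0 = [:[:[:0, 1:]:]:]" "poly var_x 0 = [:[:0, 1:]:]"
    "poly var_eta 0 = 0" "poly (cst c) 0 = [:[:[:c:]:]:]" for c
    by (simp_all add: var_A_def var_x_def var_v_def var_eta_def cst_def)
  have r: "map_poly riccati N = [:[:speed:]:] * map_poly (map_poly pderiv) N + [:riccati_coeff:] * map_poly pderiv N" for N
    by (rule poly_eqI) (simp add: coeff_map_poly riccati_def)
  have n: "normal_der N = [:[:speed:]:] * map_poly (map_poly pderiv) N
       + ([:riccati_coeff:] * map_poly pderiv N + [:0, growth:] * pderiv N)" for N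
    by (simp add: normal_der_def r)
  have a: "poly (var_v * var_A * ring_rate \<sigma>) 0 = [:0, 1:] * [:[:speed:]:]"
    by (simp add: g chart_rate_def chart_a_def speed_def power2_eq_square one_pCons)
  have b: "poly (- ring_b \<sigma> * ring_y \<sigma> - ring_b \<sigma> * var_x * var_v + cst \<i> * ring_a \<sigma> * var_v - var_x * ring_b \<sigma> * ring_y \<sigma>) 0
     = [:0, 1:] * [:riccati_coeff:]"
    by (simp add: g chart_b_def chart_a_def chart_y_def riccati_coeff_def b_coeff_def a_coeff_def power2_eq_square one_pCons numeral_poly)
  have c: "poly (var_v * ring_b \<sigma> * ring_y \<sigma>) 0 = [:0, 1:] * [:0, growth:]"
    by (simp add: g chart_b_def chart_y_def growth_def b_coeff_def power2_eq_square one_pCons numeral_poly)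
  have e: "poly (- var_eta * var_v * ring_rate \<sigma>) 0 = 0" by (simp add: g)
  have "poly (chart_der \<sigma> s) 0 = poly (var_v * var_A * ring_rate \<sigma>) 0 * poly (map_poly (map_poly (map_poly pderiv)) s) 0
     + (poly (- ring_b \<sigma> * ring_y \<sigma> - ring_b \<sigma> * var_x * var_v + cst \<i> * ring_a \<sigma> * var_v - var_x * ring_b \<sigma> * ring_y \<sigma>) 0
          * poly (map_poly (map_poly pderiv) s) 0
     + (poly (var_v * ring_b \<sigma> * ring_y \<sigma>) 0 * poly (map_poly pderiv s) 0
     + poly (- var_eta * var_v * ring_rate \<sigma>) 0 * poly (pderiv s) 0))"
    unfolding chart_der_def by (simp only: poly_add poly_mult)
  then show ?thesis
    unfolding a b c e n by (simp only: m derivation_map_poly derivation_pderiv) (simp only: algebra_simps mult_zero_left add_0_right add_0_left)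
qed

text \<open>
  The two-point difference of \<open>G / H\<close>, cleared of denominators, at two points of the same level set. The parameter
  \<open>\<epsilon> = \<eta> A\<close> is shared, so the values of \<open>\<eta>\<close> are \<open>\<epsilon> / A\<close> and \<open>\<epsilon> / A'\<close>.
\<close>

definition cross_term :: "ring4 \<Rightarrow> ring4 \<Rightarrow> complex \<Rightarrow> complex \<Rightarrow> complex \<Rightarrow> complex \<Rightarrow> complex \<Rightarrow> complex \<Rightarrow> complex \<Rightarrow> complex" where
  "cross_term G H A x v A' x' v' \<epsilon> = eval4 G (\<epsilon> / A) A x v * eval4 H (\<epsilon> / A') A' x' v'
     - eval4 G (\<epsilon> / A') A' x' v' * eval4 H (\<epsilon> / A) A x v"

text \<open>
  As \<open>\<eta>\<close> itself has derivative \<open>-\<eta> v T\<close> with \<open>T = A\<^sup>2 + 1 + O(\<eta>)\<close>, dividing by powers of \<open>\<eta>\<close> adds a multiple of \<open>T\<close> to the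
  derivations of the leading coefficients. The power \<open>w\<^sup>j\<^sup>-\<^sup>n\<close> compensates for this: since \<open>\<eta> A\<close> is constant,
  \<open>w\<close> grows at the rate at which \<open>\<eta>\<close> decays. So the leading coefficient of \<open>G\<close> divided by \<open>w\<^sup>j\<^sup>-\<^sup>n\<close>
  times that of \<open>H\<close> is a rational integral of the linearised system, and \<open>normal_der_no_invariants\<close> applies.
\<close>

lemma leading_coefficients:
  assumes G: "G = var_eta ^ j * G'" and H: "H = var_eta ^ n * H'" and "j < k + n"
    and "var_eta ^ (k + n) dvd chart_der \<sigma> G * H - G * chart_der \<sigma> H" "k > j" "n \<le> j"
    and "poly G' 0 \<noteq> 0" "poly H' 0 \<noteq> 0"
  shows "\<exists>c. poly G' 0 = [:[:[:c:]:]:] * [:[:[:0, 1:]:]:] ^ (j - n) * poly H' 0"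
proof -
  have ge0: "var_eta \<noteq> 0" by (simp add: var_eta_def)
  have dp: "chart_der \<sigma> (var_eta ^ m) = - of_nat m * var_eta ^ m * var_v * ring_rate \<sigma>" for m
  proof -
    have "var_eta * chart_der \<sigma> (var_eta ^ m) = var_eta * (- of_nat m * var_eta ^ m * var_v * ring_rate \<sigma>)"
      by (simp add: derivation_power[OF derivation_chart_der] chart_der_generators algebra_simps)
    then show ?thesis using ge0 by (metis mult_left_cancel)
  qed
  \<comment> \<open>The Wronskian of G and H with the powers of \<eta> taken out.\<close>
  define W where "W = (chart_der \<sigma> G' - of_nat j * var_v * ring_rate \<sigma> * G') * H' - G' * (chart_der \<sigma> H' - of_nat n * var_v * ring_rate \<sigma> * H')"
  have "chart_der \<sigma> G * H - G * chart_der \<sigma> H = var_eta ^ (j + n) * W"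
    by (simp add: G H derivation_mult[OF derivation_chart_der] dp W_def power_add algebra_simps)
  moreover have "k + n = (j + n) + (k - j)" using \<open>j < k\<close> by simp
  ultimately have "var_eta ^ (j + n) * var_eta ^ (k - j) dvd var_eta ^ (j + n) * W"
    using assms(4) by (simp only: power_add)
  then have "var_eta ^ (k - j) dvd W" using ge0 by (simp add: dvd_mult_cancel_left)
  then have "var_eta dvd W" using \<open>j < k\<close> by (meson dvd_power dvd_trans zero_less_diff)
  then have W0: "poly W 0 = 0" by (auto simp: var_eta_def elim!: dvdE)
  define N1 N2 where "N1 = poly G' 0" and "N2 = poly H' 0"
  define w :: ring3 where "w = [:[:[:0, 1:]:]:]"
  have T0: "poly (ring_rate \<sigma>) 0 = w\<^sup>2 + 1"
    by (simp add: chart_rate_def chart_a_def var_A_def var_eta_def w_def)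
  have v0: "poly var_v 0 = [:0, 1:]" by (simp add: var_v_def)
  have "[:0, 1:] * ((normal_der N1 - of_nat j * (w\<^sup>2 + 1) * N1) * N2 - N1 * (normal_der N2 - of_nat n * (w\<^sup>2 + 1) * N2)) = 0"
    using W0 unfolding W_def
    by (simp only: poly_add poly_diff poly_mult chart_der_at_0 T0 v0 N1_def[symmetric] N2_def[symmetric] poly_of_nat)
       (simp only: algebra_simps)
  then have e: "(normal_der N1 - of_nat j * (w\<^sup>2 + 1) * N1) * N2 = N1 * (normal_der N2 - of_nat n * (w\<^sup>2 + 1) * N2)"
    by simp
  have dn: "derivation normal_der"
    unfolding derivation_def by (simp add: normal_der_add normal_der_mult)
  have dw: "normal_der w = w * (w\<^sup>2 + 1)"
    by (simp add: w_def normal_der_def riccati_def speed_def map_poly_pCons pderiv_pCons power2_eq_square one_pCons)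
  have w0: "w \<noteq> 0" by (simp add: w_def)
  have dwp: "normal_der (w ^ m) = of_nat m * (w\<^sup>2 + 1) * w ^ m" for m
  proof -
    have "w * normal_der (w ^ m) = w * (of_nat m * (w\<^sup>2 + 1) * w ^ m)"
      by (simp add: derivation_power[OF dn] dw algebra_simps)
    then show ?thesis using w0 by simp
  qed
  have "normal_der N1 * (w ^ (j - n) * N2) = N1 * normal_der (w ^ (j - n) * N2)"
  proof -
    have "normal_der (w ^ (j - n) * N2) = w ^ (j - n) * (normal_der N2 + of_nat (j - n) * (w\<^sup>2 + 1) * N2)"
      by (simp add: derivation_mult[OF dn] dwp algebra_simps)
    moreover have "normal_der N1 * N2 = N1 * (normal_der N2 + of_nat (j - n) * (w\<^sup>2 + 1) * N2)"
      using e \<open>n \<le> j\<close> by (simp add: of_nat_diff algebra_simps)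
    ultimately show ?thesis by (simp add: mult.left_commute)
  qed
  then obtain c where "N1 = [:[:[:c:]:]:] * (w ^ (j - n) * N2)"
    using normal_der_no_invariants assms(7,8) w0 unfolding N1_def N2_def by (metis no_zero_divisors power_not_zero)
  then show ?thesis by (auto simp: N1_def N2_def w_def mult.assoc)
qed

text \<open>
  If \<open>G / H\<close> is an integral to order \<open>M\<close>, its two-point difference cannot have order \<open>w < M\<close>. After
  multiplication of \<open>G\<close> by \<open>\<epsilon>\<^sup>n\<close>, where \<open>n\<close> is the order of \<open>H\<close>, the leading part of \<open>G\<close> equals that of \<open>c \<epsilon>\<^sup>j\<^sup>-\<^sup>n H\<close>
  by \<open>leading_coefficients\<close>. Subtracting this multiple raises the order of \<open>G\<close>, but changes
  neither the Wronskian nor the two-point difference, as \<open>\<epsilon>\<close> is constant on the level set. Once the order of \<open>G\<close>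
  exceeds \<open>w\<close>, the two-point difference is too small.
\<close>

lemma no_formal_integral:
  assumes "w < M" "c > 0" "A \<noteq> 0" "A' \<noteq> 0"
    and dv: "var_eta ^ M dvd chart_der \<sigma> G * H - G * chart_der \<sigma> H"
    and lb: "\<forall>\<^sub>F \<epsilon> in at 0. c * norm \<epsilon> ^ w \<le> norm (cross_term G H A x v A' x' v' \<epsilon>)"
  shows False
proof -
  note d = derivation_simps[OF derivation_chart_der]
  have H0: "H \<noteq> 0"
  proof
    assume "H = 0"
    then have "\<forall>\<^sub>F \<epsilon> in at (0::complex). c * norm \<epsilon> ^ w \<le> 0 * norm \<epsilon> ^ Suc w"
      using lb by (simp add: cross_term_def)
    then have "Suc w \<le> w" using \<open>c > 0\<close> by (rule power_bound_le)
    then show False by simp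
  qed
  have dec: "\<exists>n H'. H = var_eta ^ n * H' \<and> poly H' 0 \<noteq> 0" if nz: "H \<noteq> 0" for H
  proof -
    obtain H' where "H = [:-0, 1:] ^ order 0 H * H'" "\<not> [:-0, 1:] dvd H'"
      using order_decomp[OF nz, of 0] by blast
    then show ?thesis unfolding poly_eq_0_iff_dvd by (auto simp: var_eta_def)
  qed
  obtain n H' where H: "H = var_eta ^ n * H'" "poly H' 0 \<noteq> 0" using dec[OF H0] by blast
  \<comment> \<open>The invariant of the procedure that raises the order of G. The factor \<epsilon> ^ n has been multiplied in
    beforehand, so that only nonnegative powers of \<epsilon> are needed to match the order of H.\<close>
  define good where "good G \<longleftrightarrow> var_eta ^ (M + n) dvd chart_der \<sigma> G * H - G * chart_der \<sigma> H
     \<and> (\<forall>\<^sub>F \<epsilon> in at 0. c * norm \<epsilon> ^ (w + n) \<le> norm (cross_term G H A x v A' x' v' \<epsilon>)) \<and> var_eta ^ n dvd G" for G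
  have good_order: "j \<le> w" if gG: "good G" and jG: "var_eta ^ j dvd G" for G j
  proof -
    have Hn: "var_eta ^ n dvd H" by (simp add: H)
    obtain C1 C2 D1 D2 where
      "\<forall>\<^sub>F \<epsilon> in at 0. norm (eval4 G (\<epsilon> / A) A x v) \<le> C1 * norm \<epsilon> ^ j"
      "\<forall>\<^sub>F \<epsilon> in at 0. norm (eval4 G (\<epsilon> / A') A' x' v') \<le> C2 * norm \<epsilon> ^ j"
      "\<forall>\<^sub>F \<epsilon> in at 0. norm (eval4 H (\<epsilon> / A) A x v) \<le> D1 * norm \<epsilon> ^ n"
      "\<forall>\<^sub>F \<epsilon> in at 0. norm (eval4 H (\<epsilon> / A') A' x' v') \<le> D2 * norm \<epsilon> ^ n"
      using eval4_bound[OF jG assms(3), of x v] eval4_bound[OF jG assms(4), of x' v']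
        eval4_bound[OF Hn assms(3), of x v] eval4_bound[OF Hn assms(4), of x' v'] by blast
    moreover have "\<forall>\<^sub>F \<epsilon> in at 0. c * norm \<epsilon> ^ (w + n) \<le> norm (cross_term G H A x v A' x' v' \<epsilon>)"
      using gG by (simp add: good_def)
    ultimately have "\<forall>\<^sub>F \<epsilon> in at (0::complex). c * norm \<epsilon> ^ (w + n) \<le> (C1 * D2 + C2 * D1) * norm \<epsilon> ^ (j + n)"
    proof eventually_elim
      case (elim \<epsilon>)
      have "norm (cross_term G H A x v A' x' v' \<epsilon>) \<le> norm (eval4 G (\<epsilon> / A) A x v) * norm (eval4 H (\<epsilon> / A') A' x' v')
         + norm (eval4 G (\<epsilon> / A') A' x' v') * norm (eval4 H (\<epsilon> / A) A x v)"
        unfolding cross_term_def by (metis norm_triangle_ineq4 norm_mult)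
      also have "\<dots> \<le> (C1 * norm \<epsilon> ^ j) * (D2 * norm \<epsilon> ^ n) + (C2 * norm \<epsilon> ^ j) * (D1 * norm \<epsilon> ^ n)"
        using elim by (intro add_mono mult_mono) (auto intro: order.trans[OF norm_ge_zero])
      finally show ?case using elim(5) by (simp add: power_add algebra_simps)
    qed
    then have "j + n \<le> w + n" using \<open>c > 0\<close> by (rule power_bound_le)
    then show ?thesis by simp
  qed
  have good_step: "\<exists>G'. good G' \<and> var_eta ^ Suc j dvd G'" if G: "good G" and j: "var_eta ^ j dvd G" for G j
  proof (cases "var_eta ^ Suc j dvd G")
    case True
    then show ?thesis using G by blast
  next
    case False
    obtain G' where G': "G = var_eta ^ j * G'" using j by (rule dvdE)
    have nz: "poly G' 0 \<noteq> 0"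
    proof
      assume "poly G' 0 = 0"
      then have "var_eta dvd G'" unfolding poly_eq_0_iff_dvd by (simp add: var_eta_def)
      then show False using False by (simp add: G' mult.commute mult_dvd_mono)
    qed
    have "j \<le> w" using good_order[OF G j] .
    have "n \<le> j"
    proof (rule ccontr)
      assume "\<not> n \<le> j"
      then have "var_eta ^ Suc j dvd var_eta ^ n" by (intro le_imp_power_dvd) simp
      then show False using False G by (meson good_def dvd_trans)
    qed
    obtain a where a: "poly G' 0 = [:[:[:a:]:]:] * [:[:[:0, 1:]:]:] ^ (j - n) * poly H' 0"
      using leading_coefficients[OF G' H(1), of M \<sigma>] G nz H(2) \<open>j \<le> w\<close> \<open>w < M\<close> \<open>n \<le> j\<close>
      unfolding good_def by auto
    \<comment> \<open>The leading part of K H is that of G, and the factor K depends on \<epsilon> = \<eta> A alone.\<close>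
    define K where "K = cst a * (var_eta * var_A) ^ (j - n)"
    have dK: "chart_der \<sigma> K = 0"
    proof -
      have "var_eta * var_A \<noteq> 0" by (simp add: var_eta_def var_A_def)
      moreover have "(var_eta * var_A) * chart_der \<sigma> ((var_eta * var_A) ^ (j - n)) = 0"
        by (simp only: derivation_power[OF derivation_chart_der] chart_der_param mult_zero_right)
      ultimately show ?thesis by (simp add: K_def d(2) chart_der_generators(1))
    qed
    have eK: "eval4 K (\<epsilon> / A) A x v = a * \<epsilon> ^ (j - n)" if "A \<noteq> 0" for \<epsilon> A x v
      using that by (simp add: K_def)
    have K: "K * H = var_eta ^ j * (cst a * var_A ^ (j - n) * H')"
      using \<open>n \<le> j\<close> by (simp add: K_def H power_mult_distrib algebra_simps flip: power_add)
    have "good (G - K * H)"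
      unfolding good_def
    proof (intro conjI)
      have "chart_der \<sigma> (G - K * H) * H - (G - K * H) * chart_der \<sigma> H = chart_der \<sigma> G * H - G * chart_der \<sigma> H"
        by (simp add: d(2,6) dK algebra_simps)
      then show "var_eta ^ (M + n) dvd chart_der \<sigma> (G - K * H) * H - (G - K * H) * chart_der \<sigma> H"
        using G by (simp add: good_def)
      have "cross_term (G - K * H) H A x v A' x' v' \<epsilon> = cross_term G H A x v A' x' v' \<epsilon>" for \<epsilon>
        using assms(3,4) by (simp add: cross_term_def eK algebra_simps)
      then show "\<forall>\<^sub>F \<epsilon> in at 0. c * norm \<epsilon> ^ (w + n) \<le> norm (cross_term (G - K * H) H A x v A' x' v' \<epsilon>)"
        using G by (simp add: good_def)
      show "var_eta ^ n dvd G - K * H" using G H by (auto simp: good_def)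
    qed
    moreover have "var_eta ^ Suc j dvd G - K * H"
    proof -
      have "G - K * H = var_eta ^ j * (G' - cst a * var_A ^ (j - n) * H')"
        unfolding K G' by (simp add: algebra_simps)
      moreover have "poly (G' - cst a * var_A ^ (j - n) * H') 0 = 0"
        by (simp add: a cst_def var_A_def poly_power)
      then have "var_eta dvd G' - cst a * var_A ^ (j - n) * H'"
        unfolding poly_eq_0_iff_dvd by (simp add: var_eta_def)
      ultimately show ?thesis by (simp add: mult.commute mult_dvd_mono)
    qed
    ultimately show ?thesis by blast
  qed
  have "good ((var_eta * var_A) ^ n * G)"
    unfolding good_def
  proof (intro conjI)
    let ?K = "(var_eta * var_A) ^ n"
    have dK: "chart_der \<sigma> ?K = 0"
    proof -
      have "var_eta * var_A \<noteq> 0" by (simp add: var_eta_def var_A_def)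
      moreover have "(var_eta * var_A) * chart_der \<sigma> ?K = 0"
        by (simp only: derivation_power[OF derivation_chart_der] chart_der_param mult_zero_right)
      ultimately show ?thesis by simp
    qed
    have "chart_der \<sigma> (?K * G) * H - ?K * G * chart_der \<sigma> H = ?K * (chart_der \<sigma> G * H - G * chart_der \<sigma> H)"
      by (simp only: d(2) dK) (simp only: algebra_simps mult_zero_left mult_zero_right add_0_left)
    also have "\<dots> = var_eta ^ n * (var_A ^ n * (chart_der \<sigma> G * H - G * chart_der \<sigma> H))"
      by (simp only: power_mult_distrib mult.assoc)
    finally show "var_eta ^ (M + n) dvd chart_der \<sigma> (?K * G) * H - ?K * G * chart_der \<sigma> H"
      using dv by (simp add: power_add mult_dvd_mono mult.commute[of "var_eta ^ M"] dvd_mult)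
    have e: "cross_term (?K * G) H A x v A' x' v' \<epsilon> = \<epsilon> ^ n * cross_term G H A x v A' x' v' \<epsilon>" for \<epsilon>
    proof -
      have eK: "eval4 ?K (\<epsilon> / B) B y u = \<epsilon> ^ n" if "B \<noteq> 0" for B y u
        using that by simp
      show ?thesis
        unfolding cross_term_def eval4_simps(3)[of ?K] eK[OF assms(3)] eK[OF assms(4)] by (simp only: algebra_simps)
    qed
    show "\<forall>\<^sub>F \<epsilon> in at 0. c * norm \<epsilon> ^ (w + n) \<le> norm (cross_term (?K * G) H A x v A' x' v' \<epsilon>)"
      using lb
    proof eventually_elim
      case (elim \<epsilon>)
      then have "norm \<epsilon> ^ n * (c * norm \<epsilon> ^ w) \<le> norm \<epsilon> ^ n * norm (cross_term G H A x v A' x' v' \<epsilon>)"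
        by (intro mult_left_mono) auto
      then show ?case unfolding e by (simp add: norm_mult norm_power power_add mult_ac)
    qed
    show "var_eta ^ n dvd ?K * G" by (simp add: power_mult_distrib)
  qed
  then have "\<exists>G. good G \<and> var_eta ^ j dvd G" for j
  proof (induction j)
    case (Suc j)
    then show ?case using good_step by blast
  qed auto
  then obtain G where "good G" "var_eta ^ Suc w dvd G" by blast
  then have "Suc w \<le> w" by (rule good_order)
  then show False by simp
qed

section \<open>Taylor polynomials in several complex variables\<close>

definition upd :: "complex ^ 'n \<Rightarrow> 'n \<Rightarrow> complex \<Rightarrow> complex ^ 'n" where
  "upd z i w = (\<chi> j. if j = i then w else z $ j)"

lemma upd_nth [simp]: "upd z i w $ j = (if j = i then w else z $ j)"
  by (simp add: upd_def)

lemma upd_upd [simp]: "upd (upd z i w) i w' = upd z i w'"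
  by (simp add: vec_eq_iff)

lemma upd_commute: "i \<noteq> j \<Longrightarrow> upd (upd z i w) j w' = upd (upd z j w') i w"
  by (auto simp: vec_eq_iff)

lemma upd_id [simp]: "upd z i (z $ i) = z"
  by (auto simp: vec_eq_iff)

lemma continuous_on_upd [continuous_intros]:
  "continuous_on S f \<Longrightarrow> continuous_on S g \<Longrightarrow> continuous_on S (\<lambda>x. upd (f x) i (g x))"
  unfolding upd_def
proof (rule continuous_on_vec_lambda)
  fix j assume "continuous_on S f" "continuous_on S g"
  then show "continuous_on S (\<lambda>x. if j = i then g x else f x $ j)"
    by (cases "j = i") (auto intro!: continuous_intros)
qed

lemma dist_upd_le: "dist (upd z i w) (upd z' i w) \<le> dist z z'"
  unfolding dist_vec_def by (rule L2_set_mono) auto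

lemma dist_upd_same: "dist (upd z i w) (upd z i w') = dist w w'"
proof -
  have "dist (upd z i w) (upd z i w') = L2_set (\<lambda>j. if i = j then dist w w' else 0) UNIV"
    unfolding dist_vec_def by (rule L2_set_cong) auto
  then show ?thesis by (simp add: L2_set_def if_distrib[of "\<lambda>x. x\<^sup>2"] cong: if_cong)
qed

text \<open>
  Polydiscs are used instead of balls because they contain every disc obtained by varying one coordinate.
\<close>

definition polydisc :: "real \<Rightarrow> (complex ^ 'n) set" where
  "polydisc r = {z. \<forall>i. norm (z $ i) < r}"

lemma upd_polydisc: "z \<in> polydisc r \<Longrightarrow> norm w < r \<Longrightarrow> upd z i w \<in> polydisc r"
  by (simp add: polydisc_def)

lemma polydisc_shrink:
  fixes z :: "complex ^ 'n"
  assumes "z \<in> polydisc r"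
  obtains \<rho> where "z \<in> polydisc \<rho>" "\<rho> < r" "0 < \<rho>"
proof -
  define m where "m = Max (range (\<lambda>i. norm (z $ i)))"
  have m: "norm (z $ i) \<le> m" for i by (simp add: m_def)
  have "m \<in> range (\<lambda>i. norm (z $ i))" unfolding m_def by (rule Max_in) auto
  then have "m < r" "0 \<le> m" using assms by (auto simp: polydisc_def)
  show ?thesis
  proof (rule that[of "(m + r) / 2"])
    show "z \<in> polydisc ((m + r) / 2)"
      unfolding polydisc_def
    proof (intro CollectI allI)
      fix i show "norm (z $ i) < (m + r) / 2" using m[of i] \<open>m < r\<close> by simp
    qed
  qed (use \<open>m < r\<close> \<open>0 \<le> m\<close> in auto)
qed

lemma open_polydisc: "open (polydisc r :: (complex ^ 'n) set)"
proof -
  have "polydisc r = (\<Inter>i. {z :: complex ^ 'n. norm (z $ i) < r})" by (auto simp: polydisc_def)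
  moreover have "open {z :: complex ^ 'n. norm (z $ i) < r}" for i
    by (intro open_Collect_less continuous_intros)
  ultimately show ?thesis by (simp add: open_INT)
qed

lemma compact_closed_polydisc: "compact {z :: complex ^ 'n. (\<forall>i. norm (z $ i) \<le> r) \<and> z \<in> T}" if "closed T"
proof -
  have "{z :: complex ^ 'n. (\<forall>i. norm (z $ i) \<le> r) \<and> z \<in> T} = (\<Inter>i. {z. norm (z $ i) \<le> r}) \<inter> T"
    by auto
  moreover have "closed {z :: complex ^ 'n. norm (z $ i) \<le> r}" for i
    by (intro closed_Collect_le continuous_intros)
  ultimately have "closed {z :: complex ^ 'n. (\<forall>i. norm (z $ i) \<le> r) \<and> z \<in> T}"
    using that by (simp add: closed_INT closed_Int)
  moreover have "bounded {z :: complex ^ 'n. (\<forall>i. norm (z $ i) \<le> r) \<and> z \<in> T}"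
  proof (rule boundedI)
    fix z :: "complex ^ 'n" assume "z \<in> {z. (\<forall>i. norm (z $ i) \<le> r) \<and> z \<in> T}"
    then have "(\<Sum>i\<in>UNIV. norm (z $ i)) \<le> (\<Sum>i\<in>(UNIV::'n set). r)" by (intro sum_mono) auto
    then show "norm z \<le> (\<Sum>i\<in>(UNIV::'n set). r)"
      using L2_set_le_sum[of UNIV "\<lambda>i. norm (z $ i)"] by (simp add: norm_vec_def)
  qed
  ultimately show ?thesis by (simp add: compact_eq_bounded_closed)
qed

text \<open>
  Continuous and holomorphic in each variable. This form of holomorphy passes to the quotients
  \<open>(g - g\<^sub>0) / z\<^sub>i\<close> (with \<open>g\<^sub>0\<close> the restriction to \<open>z\<^sub>i = 0\<close>) by one-variable arguments alone.
\<close>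

definition sep_holomorphic :: "(complex ^ 'n \<Rightarrow> complex) \<Rightarrow> real \<Rightarrow> bool" where
  "sep_holomorphic g r \<longleftrightarrow> continuous_on (polydisc r) g \<and>
     (\<forall>z\<in>polydisc r. \<forall>i. (\<lambda>w. g (upd z i w)) holomorphic_on ball 0 r)"

lemma sep_holomorphic_upd:
  assumes "sep_holomorphic g r" "r > 0"
  shows "sep_holomorphic (\<lambda>z. g (upd z i 0)) r"
  unfolding sep_holomorphic_def
proof (intro conjI ballI allI)
  show "continuous_on (polydisc r) (\<lambda>z. g (upd z i 0))"
    by (rule continuous_on_compose2[of "polydisc r" g])
       (use assms in \<open>auto simp: sep_holomorphic_def upd_polydisc intro!: continuous_intros\<close>)
  fix z :: "complex ^ 'a" and j assume z: "z \<in> polydisc r"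
  show "(\<lambda>w. g (upd (upd z j w) i 0)) holomorphic_on ball 0 r"
  proof (cases "i = j")
    case False
    then have "(\<lambda>w. g (upd (upd z j w) i 0)) = (\<lambda>w. g (upd (upd z i 0) j w))"
      by (simp add: upd_commute)
    then show ?thesis using assms z by (simp add: sep_holomorphic_def upd_polydisc)
  qed simp
qed

text \<open>
  In the variable \<open>z\<^sub>i\<close> the singularity at \<open>0\<close> is removable. Joint continuity follows from the maximum principle: on
  \<open>\<bar>z\<^sub>i\<bar> = \<rho>\<close> the quotient is uniformly continuous, and the estimate extends to \<open>\<bar>z\<^sub>i\<bar> \<le> \<rho>\<close>. In another variable,
  a slice with \<open>z\<^sub>i = 0\<close> is a uniform limit of slices with \<open>z\<^sub>i \<noteq> 0\<close>.
\<close>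

lemma hadamard_quotient:
  fixes g :: "complex ^ 'n \<Rightarrow> complex"
  assumes g: "sep_holomorphic g r" and r: "r > 0"
  shows "\<exists>q. sep_holomorphic q r \<and> (\<forall>z. g z = g (upd z i 0) + z $ i * q z)"
proof -
  define q where "q z = (if z $ i = 0 then deriv (\<lambda>w. g (upd z i w)) 0
     else (g z - g (upd z i 0)) / z $ i)" for z
  have eq: "g z = g (upd z i 0) + z $ i * q z" for z
    using upd_id[of z i] by (cases "z $ i = 0") (simp_all add: q_def del: upd_id)
  have slice_i: "(\<lambda>w. q (upd z i w)) holomorphic_on ball 0 r" if "z \<in> polydisc r" for z
  proof -
    have "(\<lambda>w. g (upd z i w)) holomorphic_on ball 0 r" using g that by (simp add: sep_holomorphic_def)
    from pole_lemma[OF this, of 0] r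
    have "(\<lambda>w. if w = 0 then deriv (\<lambda>w. g (upd z i w)) 0 else (g (upd z i w) - g (upd z i 0)) / w)
       holomorphic_on ball 0 r" by (simp cong: if_cong)
    then show ?thesis by (simp add: q_def cong: if_cong)
  qed
  have slice_ne: "(\<lambda>w. q (upd z j w)) holomorphic_on ball 0 r"
    if z: "z \<in> polydisc r" and "z $ i \<noteq> 0" and "j \<noteq> i" for z j
  proof -
    have "(\<lambda>w. (g (upd z j w) - g (upd (upd z i 0) j w)) / z $ i) holomorphic_on ball 0 r"
      using g z that r by (intro holomorphic_intros) (auto simp: sep_holomorphic_def upd_polydisc)
    then show ?thesis using that by (simp add: q_def upd_commute)
  qed
  have cont_ne: "continuous_on {z \<in> polydisc r. z $ i \<noteq> 0} q"
  proof -
    have "continuous_on {z \<in> polydisc r. z $ i \<noteq> 0} (\<lambda>z. (g z - g (upd z i 0)) / z $ i)"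
      using g sep_holomorphic_upd[OF g r, of i]
      by (intro continuous_intros) (auto simp: sep_holomorphic_def intro: continuous_on_subset)
    then show ?thesis by (rule continuous_on_eq) (simp add: q_def)
  qed
  have cont: "continuous_on (polydisc r) q"
    unfolding continuous_on_iff
  proof (intro ballI allI impI)
    fix z0 :: "complex ^ 'n" and e :: real
    assume z0: "z0 \<in> polydisc r" and e: "0 < e"
    obtain \<rho> where \<rho>: "z0 \<in> polydisc \<rho>" "\<rho> < r" "0 < \<rho>" using polydisc_shrink[OF z0] .
    define K where "K = {z :: complex ^ 'n. (\<forall>j. norm (z $ j) \<le> \<rho>) \<and> z \<in> {z. norm (z $ i) = \<rho>}}"
    have "compact K" unfolding K_def
      by (intro compact_closed_polydisc closed_Collect_eq continuous_intros)
    moreover have "continuous_on K q"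
    proof (rule continuous_on_subset[OF cont_ne])
      show "K \<subseteq> {z \<in> polydisc r. z $ i \<noteq> 0}"
      proof
        fix z assume "z \<in> K"
        then show "z \<in> {z \<in> polydisc r. z $ i \<noteq> 0}"
          using \<rho> by (auto simp: K_def polydisc_def intro: le_less_trans)
      qed
    qed
    ultimately have "uniformly_continuous_on K q" by (rule compact_uniformly_continuous[rotated])
    then obtain d where d: "d > 0" "\<And>z z'. z \<in> K \<Longrightarrow> z' \<in> K \<Longrightarrow> dist z z' < d \<Longrightarrow> dist (q z) (q z') < e / 2"
      unfolding uniformly_continuous_on_def using e by (metis half_gt_zero dist_commute)
    \<comment> \<open>The maximum principle in the i-th variable carries the estimate from the circle of radius \<rho> to its interior.\<close>
    have U: "norm (q (upd z i t) - q (upd z0 i t)) \<le> e / 2"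
      if z: "z \<in> polydisc \<rho>" and "dist z z0 < d" "norm t \<le> \<rho>" for z t
    proof (rule maximum_modulus_frontier[of "\<lambda>t. q (upd z i t) - q (upd z0 i t)" "cball 0 \<rho>"])
      have zr: "z \<in> polydisc r" using z \<rho> by (auto simp: polydisc_def intro: less_trans)
      have h: "(\<lambda>t. q (upd z i t) - q (upd z0 i t)) holomorphic_on ball 0 r"
        by (intro holomorphic_intros slice_i zr z0)
      then show "(\<lambda>t. q (upd z i t) - q (upd z0 i t)) holomorphic_on interior (cball 0 \<rho>)"
        using \<rho> by (auto elim: holomorphic_on_subset)
      show "continuous_on (closure (cball 0 \<rho>)) (\<lambda>t. q (upd z i t) - q (upd z0 i t))"
        using holomorphic_on_imp_continuous_on[OF h] \<rho> by (auto elim: continuous_on_subset)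
      show "norm (q (upd z i t) - q (upd z0 i t)) \<le> e / 2" if "t \<in> frontier (cball 0 \<rho>)" for t
      proof -
        have t: "norm t = \<rho>" using that \<rho> by (simp add: frontier_cball)
        have "upd z i t \<in> K" "upd z0 i t \<in> K"
          using t z \<rho>(1) by (auto simp: K_def polydisc_def less_imp_le)
        moreover have "dist (upd z i t) (upd z0 i t) < d"
          using dist_upd_le[of z i t z0] \<open>dist z z0 < d\<close> by simp
        ultimately show ?thesis using d(2) by (force simp: dist_norm)
      qed
    qed (use that in auto)
    have "isCont (\<lambda>w. q (upd z0 i w)) (z0 $ i)"
      using slice_i[OF z0] z0
      by (intro continuous_on_interior[OF holomorphic_on_imp_continuous_on]) (auto simp: polydisc_def)
    then obtain d' where d': "d' > 0"
      "\<And>w. dist w (z0 $ i) < d' \<Longrightarrow> dist (q (upd z0 i w)) (q (upd z0 i (z0 $ i))) < e / 2"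
      unfolding continuous_at_eps_delta using e by (meson half_gt_zero)
    obtain d'' where d'': "d'' > 0" "ball z0 d'' \<subseteq> polydisc \<rho>"
      using \<rho>(1) open_polydisc open_contains_ball by blast
    show "\<exists>d>0. \<forall>z\<in>polydisc r. dist z z0 < d \<longrightarrow> dist (q z) (q z0) < e"
    proof (intro exI[of _ "min d (min d' d'')"] conjI ballI impI)
      fix z :: "complex ^ 'n" assume "dist z z0 < min d (min d' d'')"
      then have z: "dist z z0 < d" "dist z z0 < d'" "z \<in> polydisc \<rho>"
        using d'' by (auto simp: dist_commute subset_iff)
      have a: "norm (q (upd z i (z $ i)) - q (upd z0 i (z $ i))) \<le> e / 2"
        using z by (intro U) (auto simp: polydisc_def less_imp_le)
      have "dist (z $ i) (z0 $ i) < d'" using z dist_vec_nth_le[of z i z0] by simp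
      then have "dist (q (upd z0 i (z $ i))) (q z0) < e / 2" using d'(2) by fastforce
      then show "dist (q z) (q z0) < e"
        using a dist_triangle[of "q z" "q z0" "q (upd z0 i (z $ i))"] by (simp add: dist_norm)
    qed (use d d' d'' in auto)
  qed
  \<comment> \<open>On the hyperplane z $ i = 0 the quotient is a derivative; approach it along z $ i = r / (n + 2).\<close>
  have slice_0: "(\<lambda>w. q (upd z j w)) holomorphic_on ball 0 r"
    if z: "z \<in> polydisc r" and zi: "z $ i = 0" and "j \<noteq> i" for z j
  proof (rule holomorphic_uniform_sequence[of _ "\<lambda>n w. q (upd (upd z i (of_real (r / (2 + real n)))) j w)"])
    fix n
    define t where "t = complex_of_real (r / (2 + real n))"
    have pos: "0 < r / (2 + real n)" using r by (intro divide_pos_pos) auto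
    have "r / (2 + real n) < r" using r by (simp add: field_simps add_pos_nonneg)
    then have t: "norm t < r" "t \<noteq> 0"
      unfolding t_def norm_of_real of_real_eq_0_iff using pos by linarith+
    show "(\<lambda>w. q (upd (upd z i (of_real (r / (2 + real n)))) j w)) holomorphic_on ball 0 r"
      unfolding t_def[symmetric] using slice_ne[OF upd_polydisc[OF z t(1)]] t(2) \<open>j \<noteq> i\<close> by simp
  next
    fix w0 :: complex assume w0: "w0 \<in> ball 0 r"
    then have "upd z j w0 \<in> polydisc r" using z by (simp add: upd_polydisc)
    then obtain \<rho> where \<rho>: "upd z j w0 \<in> polydisc \<rho>" "\<rho> < r" "0 < \<rho>" by (rule polydisc_shrink)
    define K where "K = {z :: complex ^ 'n. (\<forall>j. norm (z $ j) \<le> \<rho>) \<and> z \<in> UNIV}"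
    have "compact K" unfolding K_def by (rule compact_closed_polydisc) simp
    moreover have "continuous_on K q"
      using \<rho> by (intro continuous_on_subset[OF cont]) (auto simp: K_def polydisc_def intro: le_less_trans)
    ultimately have uc: "uniformly_continuous_on K q" by (rule compact_uniformly_continuous[rotated])
    have w0\<rho>: "norm w0 < \<rho>" using \<rho>(1) by (auto simp: polydisc_def dest: spec[of _ j])
    have z\<rho>: "norm (z $ k) < \<rho>" if "k \<noteq> j" for k
      using \<rho>(1) that by (auto simp: polydisc_def dest: spec[of _ k])
    define d where "d = (\<rho> - norm w0) / 2"
    have "d > 0" using w0\<rho> by (simp add: d_def)
    have cb: "norm w < \<rho>" if "w \<in> cball w0 d" for w
    proof -
      have "norm w \<le> norm w0 + d" using that norm_triangle_sub[of w w0] by (simp add: dist_norm norm_minus_commute)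
      then show ?thesis using w0\<rho> by (simp add: d_def field_simps)
    qed
    have "uniform_limit (cball w0 d) (\<lambda>n w. q (upd (upd z i (of_real (r / (2 + real n)))) j w)) (\<lambda>w. q (upd z j w)) sequentially"
      unfolding uniform_limit_iff
    proof (intro allI impI)
      fix e :: real assume "e > 0"
      then obtain \<delta> where \<delta>: "\<delta> > 0" "\<And>z z'. z \<in> K \<Longrightarrow> z' \<in> K \<Longrightarrow> dist z z' < \<delta> \<Longrightarrow> dist (q z) (q z') < e"
        using uc unfolding uniformly_continuous_on_def by (metis dist_commute)
      have "(\<lambda>n. r / (2 + real n)) \<longlonglongrightarrow> 0" by real_asymp
      then have "\<forall>\<^sub>F n in sequentially. r / (2 + real n) < min \<delta> \<rho>"
        using \<delta> \<rho> by (intro order_tendstoD(2)) auto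
      then show "\<forall>\<^sub>F n in sequentially. \<forall>w\<in>cball w0 d. dist (q (upd (upd z i (of_real (r / (2 + real n)))) j w)) (q (upd z j w)) < e"
      proof eventually_elim
        case (elim n)
        define t where "t = complex_of_real (r / (2 + real n))"
        have "0 \<le> r / (2 + real n)" using r by simp
        then have t: "norm t < \<delta>" "norm t < \<rho>"
          unfolding t_def norm_of_real using elim by linarith+
        show ?case
        proof
          fix w assume w: "w \<in> cball w0 d"
          have "upd (upd z i t) j w \<in> K" "upd z j w \<in> K"
            using t cb[OF w] z\<rho> by (auto simp: K_def less_imp_le)
          moreover have "dist (upd (upd z i t) j w) (upd z j w) < \<delta>"
          proof -
            have "upd z j w = upd (upd z j w) i 0" using zi \<open>j \<noteq> i\<close> by (auto simp: vec_eq_iff)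
            then have "dist (upd (upd z i t) j w) (upd z j w) = dist (upd (upd z j w) i t) (upd (upd z j w) i 0)"
              using \<open>j \<noteq> i\<close> by (simp add: upd_commute)
            then show ?thesis using t by (simp add: dist_upd_same)
          qed
          ultimately show "dist (q (upd (upd z i (of_real (r / (2 + real n)))) j w)) (q (upd z j w)) < e"
            using \<delta>(2) by (simp add: t_def)
        qed
      qed
    qed
    moreover have "cball w0 d \<subseteq> ball 0 r"
    proof
      fix w assume "w \<in> cball w0 d"
      then show "w \<in> ball 0 r" using cb[of w] \<rho>(2) by simp
    qed
    ultimately show "\<exists>d>0. cball w0 d \<subseteq> ball 0 r \<and> uniform_limit (cball w0 d)
        (\<lambda>n w. q (upd (upd z i (of_real (r / (2 + real n)))) j w)) (\<lambda>w. q (upd z j w)) sequentially"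
      using \<open>d > 0\<close> by blast
  qed simp
  have "sep_holomorphic q r"
    unfolding sep_holomorphic_def using cont slice_i slice_ne slice_0 by metis
  then show ?thesis using eq by blast
qed

text \<open>
  Polynomials in several variables as expressions, since they have to be evaluated at points, substituted into a
  polynomial ring and differentiated along the flow.
\<close>

datatype 'n pexp = PC complex | PV 'n | PA "'n pexp" "'n pexp" | PM "'n pexp" "'n pexp"

primrec peval :: "'n pexp \<Rightarrow> complex ^ 'n \<Rightarrow> complex" where
  "peval (PC c) z = c"
| "peval (PV i) z = z $ i"
| "peval (PA a b) z = peval a z + peval b z"
| "peval (PM a b) z = peval a z * peval b z"

lemma peval_sum: "finite S \<Longrightarrow> \<exists>e. \<forall>z. peval e z = (\<Sum>i\<in>S. peval (f i) z)"
proof (induction S rule: finite_induct)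
  case empty
  then show ?case by (intro exI[of _ "PC 0"]) simp
next
  case (insert i S)
  then obtain e where "\<forall>z. peval e z = (\<Sum>i\<in>S. peval (f i) z)" by blast
  then show ?case using insert by (intro exI[of _ "PA (f i) e"]) simp
qed

text \<open>
  Set the coordinates to zero one after the other; each step splits off a Hadamard quotient.
\<close>

lemma hadamard_decomposition:
  fixes g :: "complex ^ 'n \<Rightarrow> complex"
  assumes g: "sep_holomorphic g r" and r: "r > 0"
  shows "\<exists>q. (\<forall>i. sep_holomorphic (q i) r) \<and> (\<forall>z. g z = g 0 + (\<Sum>i\<in>UNIV. z $ i * q i z))"
proof -
  define zer where "zer S z = (\<chi> i. if i \<in> S then 0 else z $ i)" for S and z :: "complex ^ 'n"
  have "\<exists>q. (\<forall>i\<in>S. sep_holomorphic (q i) r) \<and> sep_holomorphic (\<lambda>z. g (zer S z)) r \<and>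
      (\<forall>z. g z = g (zer S z) + (\<Sum>i\<in>S. z $ i * q i z))" if "finite S" for S
    using that
  proof (induction S rule: finite_induct)
    case empty
    have "zer {} z = z" for z by (simp add: zer_def vec_eq_iff)
    then show ?case using g by simp
  next
    case (insert i S)
    then obtain q where q: "\<forall>i\<in>S. sep_holomorphic (q i) r" and z: "sep_holomorphic (\<lambda>z. g (zer S z)) r"
      and e: "\<forall>z. g z = g (zer S z) + (\<Sum>i\<in>S. z $ i * q i z)" by blast
    obtain p where p: "sep_holomorphic p r" "\<forall>z. g (zer S z) = g (zer S (upd z i 0)) + z $ i * p z"
      using hadamard_quotient[OF z r, of i] by blast
    have zz: "zer S (upd z i 0) = zer (insert i S) z" for z by (auto simp: zer_def vec_eq_iff)
    show ?case
    proof (intro exI[of _ "q(i := p)"] conjI ballI allI)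
      show "sep_holomorphic (\<lambda>z. g (zer (insert i S) z)) r"
        using sep_holomorphic_upd[OF z r, of i] by (simp add: zz)
      fix z
      have "g z = g (zer (insert i S) z) + (z $ i * p z + (\<Sum>i\<in>S. z $ i * q i z))"
        using e p(2) by (metis zz add.assoc)
      also have "(\<Sum>i\<in>S. z $ i * q i z) = (\<Sum>j\<in>S. z $ j * (q(i := p)) j z)"
        using insert.hyps by (intro sum.cong) auto
      finally show "g z = g (zer (insert i S) z) + (\<Sum>j\<in>insert i S. z $ j * (q(i := p)) j z)"
        using insert.hyps by simp
    qed (use q p insert.hyps in auto)
  qed
  from this[of UNIV] show ?thesis by (auto simp: zer_def zero_vec_def[symmetric])
qed

text \<open>
  Iterate the Hadamard decomposition; the remainder has \<open>M\<close> coordinate factors times quotients that are bounded near the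
  origin by continuity.
\<close>

lemma taylor_polynomial:
  fixes g :: "complex ^ 'n \<Rightarrow> complex"
  assumes "sep_holomorphic g r" "r > 0"
  shows "\<exists>e C. \<forall>\<^sub>F z in nhds 0. norm (g z - peval e z) \<le> C * norm z ^ M"
  using assms(1)
proof (induction M arbitrary: g)
  case 0
  have "isCont g 0"
  proof -
    have "0 \<in> (polydisc r :: (complex ^ 'n) set)" using \<open>r > 0\<close> by (simp add: polydisc_def)
    then show ?thesis
      using 0 continuous_on_eq_continuous_at[OF open_polydisc, of r g] by (simp add: sep_holomorphic_def)
  qed
  then have "((\<lambda>z. norm (g z)) \<longlongrightarrow> norm (g 0)) (nhds 0)"
    using tendsto_at_iff_tendsto_nhds by (metis isCont_def tendsto_norm)
  then have "\<forall>\<^sub>F z in nhds 0. norm (g z) < norm (g 0) + 1"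
    by (rule order_tendstoD(2)) simp
  then have "\<forall>\<^sub>F z in nhds 0. norm (g z - peval (PC 0) z) \<le> (norm (g 0) + 1) * norm z ^ 0"
    by (rule eventually_mono) simp
  then show ?case by blast
next
  case (Suc M)
  obtain q where q: "\<And>i. sep_holomorphic (q i) r" and g: "\<And>z. g z = g 0 + (\<Sum>i\<in>UNIV. z $ i * q i z)"
    using hadamard_decomposition[OF Suc.prems \<open>r > 0\<close>] by blast
  have "\<forall>i. \<exists>e C. \<forall>\<^sub>F z in nhds 0. norm (q i z - peval e z) \<le> C * norm z ^ M"
    using Suc.IH q by blast
  then obtain e C where e: "\<And>i. \<forall>\<^sub>F z in nhds 0. norm (q i z - peval (e i) z) \<le> C i * norm z ^ M"
    by metis
  obtain E where E: "\<And>z. peval E z = (\<Sum>i\<in>UNIV. peval (PM (PV i) (e i)) z)"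
    using peval_sum[of UNIV "\<lambda>i. PM (PV i) (e i)"] by auto
  have "\<forall>\<^sub>F z in nhds 0. \<forall>i\<in>UNIV. norm (q i z - peval (e i) z) \<le> C i * norm z ^ M"
    using e by (intro eventually_ball_finite) auto
  then have "\<forall>\<^sub>F z in nhds 0. norm (g z - peval (PA (PC (g 0)) E) z) \<le> (\<Sum>i\<in>UNIV. C i) * norm z ^ Suc M"
  proof eventually_elim
    case (elim z)
    have "g z - peval (PA (PC (g 0)) E) z = (\<Sum>i\<in>UNIV. z $ i * (q i z - peval (e i) z))"
      by (subst g) (simp add: E sum_subtractf algebra_simps)
    also have "norm \<dots> \<le> (\<Sum>i\<in>UNIV. norm z * (C i * norm z ^ M))"
      using elim by (intro sum_norm_le) (auto simp: norm_mult intro!: mult_mono component_le_norm_cart Finite_Cartesian_Product.norm_nth_le)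
    also have "\<dots> = (\<Sum>i\<in>UNIV. C i) * norm z ^ Suc M"
      by (simp add: sum_distrib_right sum_distrib_left mult_ac)
    finally show ?case .
  qed
  then show ?case by blast
qed

section \<open>Complex derivatives along curves\<close>

lemma complex_curve_derivative:
  fixes f :: "complex ^ 'n \<Rightarrow> complex"
  assumes f: "(f has_derivative D) (at (\<gamma> w))" and D: "\<And>c v. D (c *s v) = c * D v"
    and \<gamma>: "\<And>i. ((\<lambda>w. \<gamma> w $ i) has_field_derivative \<gamma>' $ i) (at w)"
  shows "((\<lambda>w. f (\<gamma> w)) has_field_derivative D \<gamma>') (at w)"
proof -
  have bl: "bounded_linear (\<lambda>h::complex. h *s v)" for v :: "complex ^ 'n"
    by (rule linear_conv_bounded_linear[THEN iffD1]) (auto intro!: linearI simp: vec_eq_iff algebra_simps)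
  have "((\<lambda>w. \<Sum>i\<in>UNIV. \<gamma> w $ i *s axis i 1) has_derivative (\<lambda>h. \<Sum>i\<in>UNIV. (\<gamma>' $ i * h) *s axis i 1)) (at w)"
    using \<gamma> by (intro has_derivative_sum bounded_linear.has_derivative[OF bl]) (simp add: has_field_derivative_def)
  moreover have "(\<Sum>i\<in>UNIV. (\<gamma>' $ i * h) *s axis i 1) = h *s \<gamma>'" for h
    using basis_expansion[of "h *s \<gamma>'"] by (simp add: mult.commute)
  ultimately have "(\<gamma> has_derivative (\<lambda>h. h *s \<gamma>')) (at w)"
    by (simp add: basis_expansion)
  from diff_chain_at[OF this f] show ?thesis
    by (simp add: has_field_derivative_def o_def D mult_commute_abs)
qed

definition dir_deriv :: "(complex ^ 'n \<Rightarrow> complex) \<Rightarrow> complex ^ 'n \<Rightarrow> complex ^ 'n \<Rightarrow> complex" where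
  "dir_deriv f z v = (\<Sum>i\<in>UNIV. v $ i * cpartial i f z)"

lemma cpartial_eq:
  assumes "(f has_derivative D) (at z)" "\<And>c v. D (c *s v) = c * D v"
  shows "cpartial i f z = D (axis i 1)"
proof -
  have "((\<lambda>w. f (upd z i w)) has_field_derivative D (axis i 1)) (at (z $ i))"
  proof (rule complex_curve_derivative)
    show "((\<lambda>w. upd z i w $ j) has_field_derivative axis i 1 $ j) (at (z $ i))" for j
      by (cases "j = i") (auto simp: axis_def)
  qed (use assms in auto)
  then show ?thesis unfolding cpartial_def by (simp add: DERIV_imp_deriv upd_def)
qed

lemma dir_deriv_eq:
  assumes f: "(f has_derivative D) (at z)" and D: "\<And>c v. D (c *s v) = c * D v"
  shows "D v = dir_deriv f z v"
proof -
  note cpartial_eq[OF assms]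
  moreover have "D v = (\<Sum>i\<in>UNIV. v $ i * D (axis i 1))"
  proof -
    have "D v = D (\<Sum>i\<in>UNIV. v $ i *s axis i 1)" by (simp add: basis_expansion)
    also have "\<dots> = (\<Sum>i\<in>UNIV. D (v $ i *s axis i 1))"
      by (rule linear_sum[OF has_derivative_linear[OF f]])
    finally show ?thesis by (simp add: D)
  qed
  ultimately show ?thesis by (simp add: dir_deriv_def)
qed

lemma curve_derivative:
  fixes f :: "complex ^ 'n \<Rightarrow> complex"
  assumes "mv_holomorphic_on f U" "\<gamma> w \<in> U"
    and \<gamma>: "\<And>i. ((\<lambda>w. \<gamma> w $ i) has_field_derivative \<gamma>' $ i) (at w)"
  shows "((\<lambda>w. f (\<gamma> w)) has_field_derivative dir_deriv f (\<gamma> w) \<gamma>') (at w)"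
proof -
  obtain D where "(f has_derivative D) (at (\<gamma> w))" "\<And>c v. D (c *s v) = c * D v"
    using assms unfolding mv_holomorphic_on_def by blast
  from complex_curve_derivative[OF this \<gamma>] dir_deriv_eq[OF this] show ?thesis by simp
qed

lemma holomorphic_on_curve:
  fixes f :: "complex ^ 'n \<Rightarrow> complex"
  assumes f: "mv_holomorphic_on f U" and S: "open S" and U: "\<And>w. w \<in> S \<Longrightarrow> \<gamma> w \<in> U"
    and \<gamma>: "\<And>i. (\<lambda>w. \<gamma> w $ i) holomorphic_on S"
  shows "(\<lambda>w. f (\<gamma> w)) holomorphic_on S"
proof -
  have "(\<lambda>w. f (\<gamma> w)) field_differentiable at w" if "w \<in> S" for w
  proof -
    have "((\<lambda>w. \<gamma> w $ i) has_field_derivative (\<chi> i. deriv (\<lambda>w. \<gamma> w $ i) w) $ i) (at w)" for i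
      using holomorphic_derivI[OF \<gamma> S that] by simp
    from curve_derivative[OF f U[OF that] this] show ?thesis
      using field_differentiable_def by blast
  qed
  then show ?thesis by (simp add: holomorphic_on_def field_differentiable_at_within)
qed

lemma mv_holomorphic_on_subset: "mv_holomorphic_on f U \<Longrightarrow> V \<subseteq> U \<Longrightarrow> mv_holomorphic_on f V"
  unfolding mv_holomorphic_on_def by blast

lemma mv_holomorphic_continuous: "mv_holomorphic_on f U \<Longrightarrow> continuous_on U f"
  unfolding mv_holomorphic_on_def
  by (meson continuous_at_imp_continuous_on has_derivative_continuous)

lemma mv_holomorphic_sep_holomorphic:
  assumes "mv_holomorphic_on g U" "polydisc r \<subseteq> U"
  shows "sep_holomorphic g r"
  unfolding sep_holomorphic_def
proof (intro conjI ballI allI)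
  show "continuous_on (polydisc r) g"
    using mv_holomorphic_continuous assms by (blast intro: continuous_on_subset)
  fix z :: "complex ^ 'a" and i assume z: "z \<in> polydisc r"
  show "(\<lambda>w. g (upd z i w)) holomorphic_on ball 0 r"
  proof (rule holomorphic_on_curve[OF assms(1)])
    show "upd z i w \<in> U" if "w \<in> ball 0 r" for w using upd_polydisc[OF z, of w i] that assms(2) by auto
    show "(\<lambda>w. upd z i w $ j) holomorphic_on ball 0 r" for j
      by (cases "j = i") (auto intro!: holomorphic_intros)
  qed simp
qed

lemma polydisc_subset_ball:
  assumes "r > 0"
  shows "\<exists>s>0. (polydisc s :: (complex ^ 'n) set) \<subseteq> ball 0 r"
proof (intro exI conjI subsetI)
  let ?s = "r / (CARD('n) + 1)"
  show "?s > 0" using assms by simp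
  fix z :: "complex ^ 'n" assume "z \<in> polydisc ?s"
  then have "(\<Sum>i\<in>UNIV. norm (z $ i)) \<le> (\<Sum>i\<in>(UNIV::'n set). ?s)"
    by (intro sum_mono) (auto simp: polydisc_def less_imp_le)
  then have "norm z \<le> CARD('n) * ?s"
    using L2_set_le_sum[of UNIV "\<lambda>i. norm (z $ i)"] by (simp add: norm_vec_def)
  also have "\<dots> < r" using assms by (simp add: field_simps)
  finally show "z \<in> ball 0 r" by simp
qed

lemma mv_holomorphic_taylor:
  fixes g :: "complex ^ 'n \<Rightarrow> complex"
  assumes "mv_holomorphic_on g (ball 0 r)" "r > 0"
  shows "\<exists>e C. \<forall>\<^sub>F z in nhds 0. norm (g z - peval e z) \<le> C * norm z ^ M"
proof -
  obtain s where s: "s > 0" "(polydisc s :: (complex ^ 'n) set) \<subseteq> ball 0 r"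
    using polydisc_subset_ball[OF assms(2)] by blast
  show ?thesis by (rule taylor_polynomial[OF mv_holomorphic_sep_holomorphic[OF assms(1) s(2)] s(1)])
qed

text \<open>
  Otherwise restrict to the complex line from \<open>z\<close> to \<open>q\<close>. It meets the ball in a convex set, on which the identity theorem
  in one variable would give \<open>h q = 0\<close>.
\<close>

lemma mv_holomorphic_nonzero_dense:
  fixes h :: "complex ^ 'n \<Rightarrow> complex"
  assumes h: "mv_holomorphic_on h (ball p r)" and q: "q \<in> ball p r" "h q \<noteq> 0"
    and V: "open V" "z \<in> V" "z \<in> ball p r"
  shows "\<exists>y\<in>V \<inter> ball p r. h y \<noteq> 0"
proof (rule ccontr)
  assume neg: "\<not> ?thesis"
  define \<gamma> where "\<gamma> w = z + w *s (q - z)" for w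
  define W where "W = \<gamma> -` ball p r"
  have c\<gamma>: "continuous_on UNIV \<gamma>"
    unfolding \<gamma>_def vector_scalar_mult_def
    by (intro continuous_intros continuous_on_vec_lambda)
  have W: "open W" unfolding W_def by (intro open_vimage c\<gamma>) simp
  have "convex W"
    unfolding convex_def W_def
  proof (intro ballI allI impI)
    fix x y u v assume xy: "x \<in> \<gamma> -` ball p r" "y \<in> \<gamma> -` ball p r" and uv: "0 \<le> (u::real)" "0 \<le> v" "u + v = 1"
    have v: "u = 1 - v" using uv by simp
    have "\<gamma> (u *\<^sub>R x + v *\<^sub>R y) = u *\<^sub>R \<gamma> x + v *\<^sub>R \<gamma> y"
      unfolding \<gamma>_def v by (simp add: vec_eq_iff algebra_simps)
    moreover have "u *\<^sub>R \<gamma> x + v *\<^sub>R \<gamma> y \<in> ball p r"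
      using xy uv by (intro convexD) auto
    ultimately show "u *\<^sub>R x + v *\<^sub>R y \<in> \<gamma> -` ball p r" by simp
  qed
  then have "connected W" by (rule convex_connected)
  have hol: "(\<lambda>w. h (\<gamma> w)) holomorphic_on W"
    by (rule holomorphic_on_curve[OF h W]) (auto simp: W_def \<gamma>_def intro!: holomorphic_intros)
  have 01: "0 \<in> W" "1 \<in> W" using q V by (auto simp: W_def \<gamma>_def)
  have op: "open (\<gamma> -` (V \<inter> ball p r))" using V c\<gamma> by (intro open_vimage) auto
  have "h (\<gamma> 1) = 0"
  proof (rule analytic_continuation_open[of "\<gamma> -` (V \<inter> ball p r)" W "\<lambda>w. h (\<gamma> w)" "\<lambda>_. 0"])
    show "\<gamma> -` (V \<inter> ball p r) \<noteq> {}"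
    proof -
      have "0 \<in> \<gamma> -` (V \<inter> ball p r)" using V by (simp add: \<gamma>_def)
      then show ?thesis by blast
    qed
    show "h (\<gamma> w) = 0" if "w \<in> \<gamma> -` (V \<inter> ball p r)" for w using neg that by auto
  qed (use op W \<open>connected W\<close> 01 hol in \<open>auto simp: W_def\<close>)
  then show False using q by (simp add: \<gamma>_def)
qed

lemma dir_deriv_quotient:
  fixes f g h :: "complex ^ 'n \<Rightarrow> complex"
  assumes g: "mv_holomorphic_on g U" and h: "mv_holomorphic_on h U" and U: "open U"
    and z: "z \<in> U" "h z \<noteq> 0" and f: "\<And>z. z \<in> U \<Longrightarrow> h z \<noteq> 0 \<Longrightarrow> f z = g z / h z"
  shows "mv_analytic_at f z" "dir_deriv f z v * (h z)\<^sup>2 = dir_deriv g z v * h z - g z * dir_deriv h z v"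
proof -
  define V where "V = {z \<in> U. h z \<noteq> 0}"
  have V: "open V"
    using continuous_open_preimage[OF mv_holomorphic_continuous[OF h] U open_Compl[OF closed_singleton], of 0]
    by (simp add: V_def vimage_def Int_def)
  have fV: "mv_holomorphic_on f V"
    unfolding mv_holomorphic_on_def
  proof
    fix y assume y: "y \<in> V"
    obtain D where D: "(g has_derivative D) (at y)" "\<And>c v. D (c *s v) = c * D v"
      using g y unfolding mv_holomorphic_on_def V_def by blast
    obtain E where E: "(h has_derivative E) (at y)" "\<And>c v. E (c *s v) = c * E v"
      using h y unfolding mv_holomorphic_on_def V_def by blast
    have hy: "h y \<noteq> 0" using y by (simp add: V_def)
    have "((\<lambda>y. g y / h y) has_derivative (\<lambda>v. - g y * (inverse (h y) * E v * inverse (h y)) + D v / h y)) (at y)"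
      using has_derivative_divide[OF D(1) E(1) hy] .
    then have "(f has_derivative (\<lambda>v. - g y * (inverse (h y) * E v * inverse (h y)) + D v / h y)) (at y)"
      by (rule has_derivative_transform_within_open[OF _ V y]) (simp add: V_def f)
    then show "\<exists>D. (f has_derivative D) (at y) \<and> (\<forall>c v. D (c *s v) = c * D v)"
      by (intro exI conjI) (auto simp: D E algebra_simps)
  qed
  have zV: "z \<in> V" using z by (simp add: V_def)
  show "mv_analytic_at f z" unfolding mv_analytic_at_def using V zV fV by blast
  define \<gamma> where "\<gamma> w = z + w *s v" for w
  have \<gamma>: "((\<lambda>w. \<gamma> w $ i) has_field_derivative v $ i) (at 0)" for i
    unfolding \<gamma>_def by (auto intro!: derivative_eq_intros)
  have \<gamma>0: "\<gamma> 0 = z" by (simp add: \<gamma>_def)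
  have df: "((\<lambda>w. f (\<gamma> w)) has_field_derivative dir_deriv f z v) (at 0)"
    using curve_derivative[OF fV _ \<gamma>] zV by (simp add: \<gamma>0)
  have dg: "((\<lambda>w. g (\<gamma> w)) has_field_derivative dir_deriv g z v) (at 0)"
    using curve_derivative[OF g _ \<gamma>] z by (simp add: \<gamma>0)
  have dh: "((\<lambda>w. h (\<gamma> w)) has_field_derivative dir_deriv h z v) (at 0)"
    using curve_derivative[OF h _ \<gamma>] z by (simp add: \<gamma>0)
  have "((\<lambda>w. f (\<gamma> w) * h (\<gamma> w)) has_field_derivative dir_deriv f z v * h z + dir_deriv h z v * f z) (at 0)"
    using DERIV_mult[OF df dh] by (simp add: \<gamma>0)
  moreover have "\<forall>\<^sub>F w in nhds 0. f (\<gamma> w) * h (\<gamma> w) = g (\<gamma> w)"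
  proof -
    have "continuous_on UNIV \<gamma>"
      unfolding \<gamma>_def vector_scalar_mult_def
      by (intro continuous_intros continuous_on_vec_lambda)
    then have "isCont \<gamma> 0" by (simp add: continuous_on_eq_continuous_at)
    then have "\<forall>\<^sub>F w in nhds 0. \<gamma> w \<in> V"
      using V zV \<gamma>0 by (metis isCont_def tendsto_at_iff_tendsto_nhds topological_tendstoD)
    then show ?thesis by (rule eventually_mono) (auto simp: V_def f)
  qed
  ultimately have "((\<lambda>w. g (\<gamma> w)) has_field_derivative dir_deriv f z v * h z + dir_deriv h z v * f z) (at 0)"
    by (subst (asm) DERIV_cong_ev[OF refl _ refl]) auto
  then have "dir_deriv g z v = dir_deriv f z v * h z + dir_deriv h z v * f z" using dg DERIV_unique by blast
  then show "dir_deriv f z v * (h z)\<^sup>2 = dir_deriv g z v * h z - g z * dir_deriv h z v"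
    using f z by (simp add: power2_eq_square algebra_simps)
qed

section \<open>From first integrals to polynomial identities\<close>

definition karabut_pexp :: "5 \<Rightarrow> 5 pexp" where
  "karabut_pexp i = (let m = (\<lambda>a b c d. PA (PM (PV a) (PV b)) (PM (PC (-1)) (PM (PV c) (PV d)))) in
     if i = 1 then m 3 5 2 4 else if i = 2 then m 4 1 3 5 else if i = 3 then m 5 2 4 1
     else if i = 4 then m 1 3 5 2 else m 2 4 1 3)"

text \<open>
  The derivative along the Karabut field, as an operation on expressions.
\<close>

primrec pflow :: "5 pexp \<Rightarrow> 5 pexp" where
  "pflow (PC c) = PC 0"
| "pflow (PV i) = karabut_pexp i"
| "pflow (PA a b) = PA (pflow a) (pflow b)"
| "pflow (PM a b) = PA (PM (pflow a) b) (PM a (pflow b))"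

primrec psub :: "ring4 ^ 5 \<Rightarrow> 5 pexp \<Rightarrow> ring4" where
  "psub X (PC c) = cst c"
| "psub X (PV i) = X $ i"
| "psub X (PA a b) = psub X a + psub X b"
| "psub X (PM a b) = psub X a * psub X b"

lemma peval_karabut: "peval (karabut_pexp i) z = karabut z $ i"
  using exhaust_5[of i] by (auto simp: karabut_pexp_def karabut_nth)

lemma psub_karabut: "psub X (karabut_pexp i) = karabut_rhs X $ i"
proof -
  have "cst (-1) = -1" by (simp add: cst_def one_pCons)
  then show ?thesis using exhaust_5[of i] by (auto simp: karabut_pexp_def)
qed

text \<open>
  Derivative along the flow and substitution of the chart commute up to the time scale. It suffices to know
  this for the coordinates, which is \<open>chart_der_karabut\<close>.
\<close>

lemma chart_der_psub: "var_eta * chart_der \<sigma> (psub (ring_chart \<sigma>) e) = cst \<i> * var_v * psub (ring_chart \<sigma>) (pflow e)"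
proof (induction e)
  case (PC c)
  then show ?case by (simp add: chart_der_generators) (simp add: cst_def)
next
  case (PV i)
  then show ?case by (simp add: chart_der_karabut psub_karabut)
next
  case (PA a b)
  then show ?case by (simp add: derivation_add[OF derivation_chart_der] distrib_left)
next
  case (PM a b)
  have "var_eta * chart_der \<sigma> (psub (ring_chart \<sigma>) (PM a b)) = (var_eta * chart_der \<sigma> (psub (ring_chart \<sigma>) a)) * psub (ring_chart \<sigma>) b
     + psub (ring_chart \<sigma>) a * (var_eta * chart_der \<sigma> (psub (ring_chart \<sigma>) b))"
    by (simp add: derivation_mult[OF derivation_chart_der] algebra_simps)
  then show ?case unfolding PM.IH by (simp add: algebra_simps)
qed

lemma eval4_psub: "eval4 (psub (ring_chart \<sigma>) e) \<eta> A x v = peval e (chart \<i> \<sigma> \<eta> A x v)"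
  by (induction e) (simp_all add: eval4_chart)

lemma peval_flow:
  "\<exists>D. (peval e has_derivative D) (at z) \<and> (\<forall>c v. D (c *s v) = c * D v) \<and> D (karabut z) = peval (pflow e) z"
proof (induction e)
  case (PC c)
  have "(peval (PC c) has_derivative (\<lambda>_. 0)) (at z)" by (simp add: peval.simps(1)[abs_def])
  then show ?case by fastforce
next
  case (PV i)
  have "(peval (PV i) has_derivative (\<lambda>v. v $ i)) (at z)"
    unfolding peval.simps(2)[abs_def] by (intro bounded_linear_imp_has_derivative bounded_linear_vec_nth)
  then show ?case using peval_karabut by fastforce
next
  case (PA a b)
  then obtain D E where "(peval a has_derivative D) (at z)" "\<forall>c v. D (c *s v) = c * D v" "D (karabut z) = peval (pflow a) z"
    "(peval b has_derivative E) (at z)" "\<forall>c v. E (c *s v) = c * E v" "E (karabut z) = peval (pflow b) z" by blast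
  then show ?case unfolding peval.simps(3)[abs_def]
    by (intro exI[of _ "\<lambda>v. D v + E v"] conjI has_derivative_add) (auto simp: algebra_simps)
next
  case (PM a b)
  then obtain D E where "(peval a has_derivative D) (at z)" "\<forall>c v. D (c *s v) = c * D v" "D (karabut z) = peval (pflow a) z"
    "(peval b has_derivative E) (at z)" "\<forall>c v. E (c *s v) = c * E v" "E (karabut z) = peval (pflow b) z" by blast
  then show ?case unfolding peval.simps(4)[abs_def]
    by (intro exI[of _ "\<lambda>v. peval a z * E v + D v * peval b z"] conjI has_derivative_mult) (auto simp: algebra_simps)
qed

lemma mv_holomorphic_peval: "mv_holomorphic_on (peval (e :: 5 pexp)) U"
  unfolding mv_holomorphic_on_def using peval_flow by blast

lemma dir_deriv_peval: "dir_deriv (peval e) z (karabut z) = peval (pflow e) z"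
  using peval_flow[of e z] dir_deriv_eq by metis

lemma continuous_peval: "isCont (peval (e :: 5 pexp)) z"
  using peval_flow[of e z] has_derivative_continuous by blast

lemma norm_karabut_le: "norm (karabut z) \<le> 10 * (norm z)\<^sup>2"
proof -
  have m: "norm (z $ i * z $ j) \<le> (norm z)\<^sup>2" for i j
    by (simp add: norm_mult power2_eq_square mult_mono Finite_Cartesian_Product.norm_nth_le)
  have d: "norm (z $ i * z $ j - z $ k * z $ l) \<le> 2 * (norm z)\<^sup>2" for i j k l
    using norm_triangle_ineq4[of "z $ i * z $ j" "z $ k * z $ l"] m[of i j] m[of k l] by linarith
  have "norm (karabut z $ i) \<le> 2 * (norm z)\<^sup>2" for i
    using exhaust_5[of i] d by (auto simp: karabut_nth)
  then have "(\<Sum>i\<in>UNIV. norm (karabut z $ i)) \<le> (\<Sum>i\<in>(UNIV::5 set). 2 * (norm z)\<^sup>2)"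
    by (intro sum_mono)
  then show ?thesis
    using L2_set_le_sum[of UNIV "\<lambda>i. norm (karabut z $ i)"] by (simp add: norm_vec_def)
qed

text \<open>
  Apply the Cauchy inequality on the complex segment \<open>w \<mapsto> z + w F(z)\<close>, \<open>\<bar>w\<bar> \<le> 1\<close>. The field \<open>F\<close> is quadratic, so near the origin
  this segment stays within norm \<open>2 \<bar>z\<bar>\<close>, and the order \<open>M\<close> is not lowered by differentiation.
\<close>

lemma flow_derivative_estimate:
  fixes g :: "complex ^ 5 \<Rightarrow> complex"
  assumes g: "mv_holomorphic_on g (ball 0 r)" "r > 0"
    and e: "\<forall>\<^sub>F z in nhds 0. norm (g z - peval e z) \<le> C * norm z ^ M"
  shows "\<exists>C. \<forall>\<^sub>F z in nhds 0. norm (dir_deriv g z (karabut z) - peval (pflow e) z) \<le> C * norm z ^ M"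
proof -
  obtain d where d: "d > 0" "\<And>z. norm z < d \<Longrightarrow> norm (g z - peval e z) \<le> C * norm z ^ M"
    using e unfolding eventually_nhds_metric by (auto simp: dist_norm)
  \<comment> \<open>For norm z < 1/20 the points z + w F(z) with norm w < 2 have at most twice the norm of z.\<close>
  define \<delta> where "\<delta> = min (1/20) (min r d / 2)"
  have \<delta>: "\<delta> > 0" using g(2) d by (simp add: \<delta>_def)
  have "norm (dir_deriv g z (karabut z) - peval (pflow e) z) \<le> (\<bar>C\<bar> * 2 ^ M) * norm z ^ M" if z: "norm z < \<delta>" for z
  proof -
    define \<gamma> where "\<gamma> w = z + w *s karabut z" for w
    define \<phi> where "\<phi> w = g (\<gamma> w) - peval e (\<gamma> w)" for w
    have nK: "norm (karabut z) \<le> norm z / 2"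
    proof -
      have "10 * (norm z)\<^sup>2 \<le> 10 * (norm z * (1/20))"
        using z by (simp add: power2_eq_square mult_left_mono \<delta>_def del: times_divide_eq_right)
      then show ?thesis using norm_karabut_le[of z] by simp
    qed
    have ns: "norm (w *s v) = norm w * norm v" for w and v :: "complex ^ 5"
      by (simp add: norm_vec_def norm_mult L2_set_right_distrib)
    have n\<gamma>: "norm (\<gamma> w) \<le> 2 * norm z" if "norm w < 2" for w
    proof -
      have "norm (\<gamma> w) \<le> norm z + norm w * norm (karabut z)"
        unfolding \<gamma>_def by (metis norm_triangle_ineq ns)
      also have "norm w * norm (karabut z) \<le> 2 * (norm z / 2)"
        using that nK by (intro mult_mono) auto
      finally show ?thesis by simp
    qed
    have b\<gamma>: "\<gamma> w \<in> ball 0 r" "norm (\<gamma> w) < d" if "norm w < 2" for w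
      using n\<gamma>[OF that] z g(2) d by (auto simp: \<delta>_def)
    have h\<gamma>: "(\<lambda>w. \<gamma> w $ i) holomorphic_on S" for i S
      unfolding \<gamma>_def by (auto intro!: holomorphic_intros)
    have hol: "\<phi> holomorphic_on ball 0 2"
      unfolding \<phi>_def
      by (intro holomorphic_intros holomorphic_on_curve[OF g(1)] holomorphic_on_curve[OF mv_holomorphic_peval[of e UNIV]] h\<gamma>)
         (use b\<gamma> in auto)
    have bd: "norm (\<phi> w) \<le> \<bar>C\<bar> * 2 ^ M * norm z ^ M" if "norm w < 2" for w
    proof -
      have "norm (\<phi> w) \<le> \<bar>C\<bar> * norm (\<gamma> w) ^ M"
        unfolding \<phi>_def by (rule order.trans[OF d(2)[OF b\<gamma>(2)[OF that]]]) (simp add: mult_right_mono)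
      also have "\<dots> \<le> \<bar>C\<bar> * (2 * norm z) ^ M"
        using n\<gamma>[OF that] by (intro mult_left_mono power_mono) auto
      finally show ?thesis by (simp add: power_mult_distrib mult.assoc)
    qed
    have "norm ((deriv ^^ 1) \<phi> 0) \<le> fact 1 * (\<bar>C\<bar> * 2 ^ M * norm z ^ M) / 1 ^ 1"
      by (rule Cauchy_inequality)
         (auto intro: holomorphic_on_subset[OF hol] continuous_on_subset[OF holomorphic_on_imp_continuous_on[OF hol]] bd)
    moreover have "(\<phi> has_field_derivative (dir_deriv g z (karabut z) - peval (pflow e) z)) (at 0)"
    proof -
      have \<gamma>': "((\<lambda>w. \<gamma> w $ i) has_field_derivative karabut z $ i) (at 0)" for i
        unfolding \<gamma>_def by (auto intro!: derivative_eq_intros)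
      have \<gamma>0: "\<gamma> 0 = z" by (simp add: \<gamma>_def)
      have "((\<lambda>w. g (\<gamma> w)) has_field_derivative dir_deriv g z (karabut z)) (at 0)"
        using curve_derivative[OF g(1) b\<gamma>(1) \<gamma>'] by (simp add: \<gamma>0)
      moreover have "((\<lambda>w. peval e (\<gamma> w)) has_field_derivative peval (pflow e) z) (at 0)"
        using curve_derivative[OF mv_holomorphic_peval[of e UNIV] _ \<gamma>'] dir_deriv_peval[of e z] by (simp add: \<gamma>0)
      ultimately show ?thesis unfolding \<phi>_def by (rule DERIV_diff)
    qed
    then have "deriv \<phi> 0 = dir_deriv g z (karabut z) - peval (pflow e) z" by (rule DERIV_imp_deriv)
    ultimately show ?thesis by simp
  qed
  then have "\<forall>\<^sub>F z in nhds 0. norm (dir_deriv g z (karabut z) - peval (pflow e) z) \<le> (\<bar>C\<bar> * 2 ^ M) * norm z ^ M"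
    unfolding eventually_nhds_metric using \<delta> by (auto simp: dist_norm)
  then show ?thesis by blast
qed

lemma norm_four_le:
  fixes a b c d :: "'a::real_normed_vector"
  shows "norm (a - b + c + d) \<le> norm a + norm b + norm c + norm d"
  using norm_triangle_ineq[of "a - b + c" d] norm_triangle_ineq[of "a - b" c]
    norm_triangle_ineq4[of a b] by linarith

lemma isCont_bounded_nhds:
  assumes "isCont f a"
  shows "\<forall>\<^sub>F z in nhds a. norm (f z) < norm (f a) + 1"
proof -
  have "(f \<longlongrightarrow> f a) (nhds a)"
    using assms unfolding isCont_def tendsto_at_iff_tendsto_nhds .
  then have "((\<lambda>z. norm (f z)) \<longlongrightarrow> norm (f a)) (nhds a)" by (rule tendsto_norm)
  then show ?thesis by (rule order_tendstoD(2)) simp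
qed

text \<open>
  The Wronskian of \<open>g\<close> and \<open>h\<close> along the flow vanishes where \<open>h \<noteq> 0\<close>, and replacing the functions by their Taylor
  polynomials changes it by \<open>O(\<bar>z\<bar>\<^sup>M)\<close>. The zeros of \<open>h\<close> are then covered by density and continuity.
\<close>

lemma first_integral_polynomials:
  fixes g h :: "complex ^ 5 \<Rightarrow> complex"
  assumes g: "mv_holomorphic_on g (ball 0 r)" and h: "mv_holomorphic_on h (ball 0 r)" and r: "r > 0"
    and nz: "\<exists>q\<in>ball 0 r. h q \<noteq> 0"
    and rel: "\<And>z. z \<in> ball 0 r \<Longrightarrow> h z \<noteq> 0 \<Longrightarrow> dir_deriv g z (karabut z) * h z = g z * dir_deriv h z (karabut z)"
    and P: "\<forall>\<^sub>F z in nhds 0. norm (g z - peval P z) \<le> C1 * norm z ^ M"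
    and Q: "\<forall>\<^sub>F z in nhds 0. norm (h z - peval Q z) \<le> C2 * norm z ^ M"
  shows "\<exists>C. \<forall>\<^sub>F z in nhds 0. norm (peval (pflow P) z * peval Q z - peval P z * peval (pflow Q) z) \<le> C * norm z ^ M"
proof -
  obtain C3 where C3: "\<forall>\<^sub>F z in nhds 0. norm (dir_deriv g z (karabut z) - peval (pflow P) z) \<le> C3 * norm z ^ M"
    using flow_derivative_estimate[OF g r P] by blast
  obtain C4 where C4: "\<forall>\<^sub>F z in nhds 0. norm (dir_deriv h z (karabut z) - peval (pflow Q) z) \<le> C4 * norm z ^ M"
    using flow_derivative_estimate[OF h r Q] by blast
  have gc: "isCont g 0" and hc: "isCont h 0"
    using mv_holomorphic_continuous[OF g] mv_holomorphic_continuous[OF h] r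
    by (simp_all add: continuous_on_eq_continuous_at)
  define B where "B = norm (g 0) + norm (peval Q 0) + norm (peval (pflow P) 0) + norm (peval (pflow Q) 0) + 1"
  have "\<forall>\<^sub>F z in nhds 0. z \<in> ball (0 :: complex ^ 5) r" using r by (intro eventually_nhds_in_open) auto
  moreover have "\<forall>\<^sub>F z in nhds 0. z \<in> ball (0 :: complex ^ 5) 1" by (intro eventually_nhds_in_open) auto
  ultimately have "\<forall>\<^sub>F z in nhds 0. h z \<noteq> 0 \<longrightarrow> norm (peval (pflow P) z * peval Q z - peval P z * peval (pflow Q) z)
      \<le> (B * \<bar>C3\<bar> + (B + \<bar>C3\<bar>) * \<bar>C2\<bar> + \<bar>C1\<bar> * B + B * \<bar>C4\<bar>) * norm z ^ M"
    using P Q C3 C4 isCont_bounded_nhds[OF gc] isCont_bounded_nhds[OF continuous_peval[where e = Q]] isCont_bounded_nhds[OF continuous_peval[where e = "pflow P"]]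
      isCont_bounded_nhds[OF continuous_peval[where e = "pflow Q"]]
  proof eventually_elim
    case (elim z)
    define n where "n = norm z ^ M"
    have n: "0 \<le> n" "n \<le> 1" using elim(2) by (auto simp: n_def intro: power_le_one)
    have b: "norm (g z) \<le> B" "norm (peval Q z) \<le> B" "norm (peval (pflow P) z) \<le> B" "norm (peval (pflow Q) z) \<le> B"
      using elim(7-10) by (auto simp: B_def add_nonneg_nonneg intro: order.trans[OF less_imp_le])
    have ab: "C * n \<le> \<bar>C\<bar> * n" for C :: real using n by (simp add: mult_right_mono)
    have e: "norm (g z - peval P z) \<le> \<bar>C1\<bar> * n" "norm (h z - peval Q z) \<le> \<bar>C2\<bar> * n"
       "norm (dir_deriv g z (karabut z) - peval (pflow P) z) \<le> \<bar>C3\<bar> * n"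
       "norm (dir_deriv h z (karabut z) - peval (pflow Q) z) \<le> \<bar>C4\<bar> * n"
      using elim(3-6) ab unfolding n_def by (meson order.trans)+
    have B: "0 \<le> B" by (simp add: B_def)
    have dg: "norm (dir_deriv g z (karabut z)) \<le> B + \<bar>C3\<bar>"
    proof -
      have "norm (dir_deriv g z (karabut z)) \<le> norm (peval (pflow P) z) + norm (dir_deriv g z (karabut z) - peval (pflow P) z)"
        by (metis norm_triangle_sub)
      moreover have "\<bar>C3\<bar> * n \<le> \<bar>C3\<bar> * 1" using n by (intro mult_left_mono) auto
      ultimately show ?thesis using b(3) e(3) by linarith
    qed
    show ?case
    proof
    assume hz: "h z \<noteq> 0"
    have eq: "peval (pflow P) z * peval Q z - peval P z * peval (pflow Q) z =
        - (dir_deriv g z (karabut z) - peval (pflow P) z) * peval Q z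
        - dir_deriv g z (karabut z) * (h z - peval Q z) + (g z - peval P z) * peval (pflow Q) z
        + g z * (dir_deriv h z (karabut z) - peval (pflow Q) z)"
      using rel[OF elim(1) hz] by (simp add: algebra_simps)
    have "norm (peval (pflow P) z * peval Q z - peval P z * peval (pflow Q) z)
        \<le> norm (dir_deriv g z (karabut z) - peval (pflow P) z) * norm (peval Q z)
        + norm (dir_deriv g z (karabut z)) * norm (h z - peval Q z) + norm (g z - peval P z) * norm (peval (pflow Q) z)
        + norm (g z) * norm (dir_deriv h z (karabut z) - peval (pflow Q) z)"
      unfolding eq by (rule order.trans[OF norm_four_le]) (simp add: norm_mult norm_minus_commute)
    also have "\<dots> \<le> (\<bar>C3\<bar> * n) * B + (B + \<bar>C3\<bar>) * (\<bar>C2\<bar> * n) + (\<bar>C1\<bar> * n) * B + B * (\<bar>C4\<bar> * n)"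
    proof (intro add_mono)
      show "norm (dir_deriv g z (karabut z) - peval (pflow P) z) * norm (peval Q z) \<le> (\<bar>C3\<bar> * n) * B"
        using n by (intro mult_mono[OF e(3) b(2)]) simp_all
      show "norm (dir_deriv g z (karabut z)) * norm (h z - peval Q z) \<le> (B + \<bar>C3\<bar>) * (\<bar>C2\<bar> * n)"
        using B by (intro mult_mono[OF dg e(2)]) simp_all
      show "norm (g z - peval P z) * norm (peval (pflow Q) z) \<le> (\<bar>C1\<bar> * n) * B"
        using n by (intro mult_mono[OF e(1) b(4)]) simp_all
      show "norm (g z) * norm (dir_deriv h z (karabut z) - peval (pflow Q) z) \<le> B * (\<bar>C4\<bar> * n)"
        using B by (intro mult_mono[OF b(1) e(4)]) simp_all
    qed
    also have "\<dots> = (B * \<bar>C3\<bar> + (B + \<bar>C3\<bar>) * \<bar>C2\<bar> + \<bar>C1\<bar> * B + B * \<bar>C4\<bar>) * n"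
      by (simp only: algebra_simps)
    finally show "norm (peval (pflow P) z * peval Q z - peval P z * peval (pflow Q) z)
      \<le> (B * \<bar>C3\<bar> + (B + \<bar>C3\<bar>) * \<bar>C2\<bar> + \<bar>C1\<bar> * B + B * \<bar>C4\<bar>) * norm z ^ M"
      unfolding n_def .
    qed
  qed
  then obtain C d where d: "d > 0" and C: "\<And>z. norm z < d \<Longrightarrow> h z \<noteq> 0 \<Longrightarrow>
      norm (peval (pflow P) z * peval Q z - peval P z * peval (pflow Q) z) \<le> C * norm z ^ M"
    unfolding eventually_nhds_metric by (auto simp: dist_norm)
  have "norm (peval (pflow P) z * peval Q z - peval P z * peval (pflow Q) z) \<le> C * norm z ^ M"
    if z: "norm z < min r d" for z
  proof (rule ccontr)
    define V where "V = {z. C * norm z ^ M < norm (peval (pflow P) z * peval Q z - peval P z * peval (pflow Q) z)}"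
    have c: "continuous_on UNIV (peval (e :: 5 pexp))" for e
      using continuous_peval by (simp add: continuous_on_eq_continuous_at)
    have V: "open V" unfolding V_def by (intro open_Collect_less continuous_intros c)
    assume "\<not> ?thesis"
    then have zV: "z \<in> V \<inter> ball 0 d" using z by (simp add: V_def)
    obtain q where q: "q \<in> ball 0 r" "h q \<noteq> 0" using nz by blast
    have "\<exists>y\<in>(V \<inter> ball 0 d) \<inter> ball 0 r. h y \<noteq> 0"
      by (rule mv_holomorphic_nonzero_dense[OF h q _ zV]) (use V z in auto)
    then obtain y where "y \<in> V" "norm y < d" "h y \<noteq> 0" by auto
    then show False using C[of y] by (simp add: V_def)
  qed
  then show ?thesis
    unfolding eventually_nhds_metric using d r
    by (intro exI[of _ C] exI[of _ "min r d"]) (auto simp: dist_norm)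
qed

lemma holomorphic_lower_bound:
  assumes "\<phi> holomorphic_on ball 0 \<delta>" "e \<in> ball 0 \<delta>" "\<phi> e \<noteq> 0"
  shows "\<exists>w c. 0 < c \<and> (\<forall>\<^sub>F \<epsilon> in at 0. c * norm \<epsilon> ^ w \<le> norm (\<phi> \<epsilon>))"
proof -
  have \<delta>: "0 < \<delta>" using assms(2) by (simp add: le_less_trans[OF norm_ge_zero])
  have lb: "\<exists>c>0. \<forall>\<^sub>F \<epsilon> in at 0. c \<le> norm (\<psi> \<epsilon>)" if "isCont \<psi> 0" "\<psi> 0 \<noteq> 0" for \<psi> :: "complex \<Rightarrow> complex"
  proof (intro exI conjI)
    have "((\<lambda>\<epsilon>. norm (\<psi> \<epsilon>)) \<longlongrightarrow> norm (\<psi> 0)) (at 0)"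
      using that by (intro tendsto_norm) (simp add: isCont_def)
    then have "\<forall>\<^sub>F \<epsilon> in at 0. norm (\<psi> 0) / 2 < norm (\<psi> \<epsilon>)"
      using that by (intro order_tendstoD(1)) auto
    then show "\<forall>\<^sub>F \<epsilon> in at 0. norm (\<psi> 0) / 2 \<le> norm (\<psi> \<epsilon>)" by (rule eventually_mono) simp
  qed (use that in simp)
  have ic: "isCont \<psi> 0" if "\<psi> holomorphic_on ball 0 \<rho>" "\<rho> > 0" for \<psi> \<rho>
    using holomorphic_on_imp_continuous_on[OF that(1)] that(2) by (simp add: continuous_on_eq_continuous_at)
  show ?thesis
  proof (cases "\<phi> 0 = 0")
    case False
    then obtain c where "c > 0" "\<forall>\<^sub>F \<epsilon> in at 0. c \<le> norm (\<phi> \<epsilon>)" using lb ic assms(1) \<delta> by blast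
    then show ?thesis by (intro exI[of _ 0] exI[of _ c]) simp
  next
    case True
    have "\<not> \<phi> constant_on ball 0 \<delta>"
      using True assms(2,3) \<delta> unfolding constant_on_def by (metis centre_in_ball)
    moreover have "0 \<in> ball 0 \<delta>" using \<delta> by simp
    ultimately obtain g \<rho> n where g: "0 < \<rho>" "g holomorphic_on ball 0 \<rho>"
      "\<And>w. w \<in> ball 0 \<rho> \<Longrightarrow> \<phi> w = (w - 0) ^ n * g w" "\<And>w. w \<in> ball 0 \<rho> \<Longrightarrow> g w \<noteq> 0"
      using holomorphic_factor_zero_nonconstant[OF assms(1) open_ball connected_ball _ True] by metis
    obtain c where c: "c > 0" "\<forall>\<^sub>F \<epsilon> in at 0. c \<le> norm (g \<epsilon>)"
      using lb[OF ic[OF g(2,1)]] g(1,4) by auto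
    have "\<forall>\<^sub>F \<epsilon> in at 0. \<epsilon> \<in> ball 0 \<rho>" using g(1) by (intro eventually_at_in_open') auto
    with c(2) have "\<forall>\<^sub>F \<epsilon> in at 0. c * norm \<epsilon> ^ n \<le> norm (\<phi> \<epsilon>)"
    proof eventually_elim
      case (elim \<epsilon>)
      then have "norm (\<phi> \<epsilon>) = norm \<epsilon> ^ n * norm (g \<epsilon>)" by (simp add: g(3) norm_mult norm_power)
      then show ?case using elim(1) by (simp add: mult.commute[of "norm \<epsilon> ^ n"] mult_right_mono)
    qed
    then show ?thesis using c(1) by blast
  qed
qed

section \<open>First integrals are constant on level sets\<close>

text \<open>
  The points with fixed \<open>\<sigma>, A, x, v\<close> on varying level sets, running into the origin as \<open>\<epsilon> \<rightarrow> 0\<close>.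
\<close>

definition curve :: "complex \<Rightarrow> complex \<Rightarrow> complex \<Rightarrow> complex \<Rightarrow> complex \<Rightarrow> complex ^ 5" where
  "curve \<sigma> A x v \<epsilon> = chart \<i> \<sigma> (\<epsilon> / A) A x v"

lemma curve_nth:
  fixes \<sigma> A x v \<epsilon> :: complex
  assumes "A \<noteq> 0"
  defines "y \<equiv> \<lambda>\<epsilon>. \<epsilon> * \<sigma> - 2 * (x * v) - 2 * v"
  defines "B \<equiv> \<lambda>\<epsilon>. (1 - \<epsilon>\<^sup>2 * (4 * (x * v)\<^sup>2 + 4 * v\<^sup>2 + 2 * (y \<epsilon>)\<^sup>2)) / A"
  shows "curve \<sigma> A x v \<epsilon> $ 1 = \<epsilon> * (A + B \<epsilon>) + 4 * \<epsilon>\<^sup>2 * (x * v)"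
    "curve \<sigma> A x v \<epsilon> $ 2 = 4 * \<epsilon>\<^sup>2 * v - \<i> * \<epsilon> * (A - B \<epsilon>)"
    "curve \<sigma> A x v \<epsilon> $ 3 = 4 * \<epsilon>\<^sup>2 * v + \<i> * \<epsilon> * (A - B \<epsilon>)"
    "curve \<sigma> A x v \<epsilon> $ 4 = 4 * \<epsilon>\<^sup>2 * (x * v) - \<epsilon> * (A + B \<epsilon>)"
    "curve \<sigma> A x v \<epsilon> $ 5 = 4 * \<epsilon>\<^sup>2 * y \<epsilon>"
  using assms(1) unfolding curve_def chart_def chart_a_def chart_b_def chart_q_def chart_y_def B_def y_def
  by (simp_all add: field_simps power2_eq_square)

lemma norm_vec5_le:
  fixes z :: "complex ^ 5"
  assumes "\<And>i. norm (z $ i) \<le> c"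
  shows "norm z \<le> 5 * c"
proof -
  have "(\<Sum>i\<in>UNIV. norm (z $ i)) \<le> (\<Sum>i\<in>(UNIV::5 set). c)" by (intro sum_mono assms)
  then show ?thesis using L2_set_le_sum[of UNIV "\<lambda>i. norm (z $ i)"] by (simp add: norm_vec_def)
qed

lemma curve_bound:
  assumes "A \<noteq> 0"
  shows "\<exists>C. \<forall>\<^sub>F \<epsilon> in at 0. norm (curve \<sigma> A x v \<epsilon>) \<le> C * norm \<epsilon>"
proof -
  have "var_eta ^ 1 dvd ring_chart \<sigma> $ i" for i
  proof -
    have "var_eta dvd (var_eta * var_A)\<^sup>2" by (simp add: power2_eq_square)
    then show ?thesis
      using exhaust_5[of i] by (auto simp: chart_def mult.assoc intro!: dvd_add dvd_diff dvd_mult dvd_mult2)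
  qed
  then have "\<exists>C. \<forall>\<^sub>F \<epsilon> in at 0. norm (curve \<sigma> A x v \<epsilon> $ i) \<le> C * norm \<epsilon>" for i
    using eval4_bound[OF _ assms, of 1 "ring_chart \<sigma> $ i" x v] by (simp add: curve_def eval4_chart)
  then obtain C where "\<And>i. \<forall>\<^sub>F \<epsilon> in at 0. norm (curve \<sigma> A x v \<epsilon> $ i) \<le> C i * norm \<epsilon>" by metis
  then have "\<forall>\<^sub>F \<epsilon> in at 0. \<forall>i\<in>UNIV. norm (curve \<sigma> A x v \<epsilon> $ i) \<le> C i * norm \<epsilon>"
    by (intro eventually_ball_finite) auto
  then have "\<forall>\<^sub>F \<epsilon> in at 0. norm (curve \<sigma> A x v \<epsilon>) \<le> (\<Sum>i\<in>UNIV. C i) * norm \<epsilon>"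
  proof eventually_elim
    case (elim \<epsilon>)
    have "norm (curve \<sigma> A x v \<epsilon>) \<le> (\<Sum>i\<in>UNIV. norm (curve \<sigma> A x v \<epsilon> $ i))"
      unfolding norm_vec_def by (rule L2_set_le_sum) simp
    also have "\<dots> \<le> (\<Sum>i\<in>UNIV. C i * norm \<epsilon>)" using elim by (intro sum_mono) auto
    finally show ?case by (simp add: sum_distrib_right)
  qed
  then show ?thesis by blast
qed

lemma curve_eventually:
  assumes "A \<noteq> 0" "\<forall>\<^sub>F z in nhds 0. R z"
  shows "\<forall>\<^sub>F \<epsilon> in at 0. R (curve \<sigma> A x v \<epsilon>)"
proof -
  obtain C where C: "\<forall>\<^sub>F \<epsilon> in at 0. norm (curve \<sigma> A x v \<epsilon>) \<le> C * norm \<epsilon>"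
    using curve_bound[OF assms(1)] by blast
  have "isCont (\<lambda>\<epsilon>::complex. C * norm \<epsilon>) 0" by (intro continuous_intros)
  then have "((\<lambda>\<epsilon>::complex. C * norm \<epsilon>) \<longlongrightarrow> 0) (at 0)" by (simp add: isCont_def)
  with C have "(curve \<sigma> A x v \<longlongrightarrow> 0) (at 0)" by (rule Lim_null_comparison)
  then have "filterlim (curve \<sigma> A x v) (nhds 0) (at 0)" .
  from eventually_compose_filterlim[OF assms(2) this] show ?thesis .
qed

lemma curve_power_estimate:
  assumes A: "A \<noteq> 0" and R: "\<forall>\<^sub>F z in nhds 0. norm (R z :: complex) \<le> C * norm z ^ M"
  shows "\<exists>C\<ge>0. \<forall>\<^sub>F \<epsilon> in at 0. norm (R (curve \<sigma> A x v \<epsilon>)) \<le> C * norm \<epsilon> ^ M"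
proof -
  obtain D where D: "\<forall>\<^sub>F \<epsilon> in at 0. norm (curve \<sigma> A x v \<epsilon>) \<le> D * norm \<epsilon>"
    using curve_bound[OF A] by blast
  have "\<forall>\<^sub>F \<epsilon> in at 0. norm (R (curve \<sigma> A x v \<epsilon>)) \<le> (\<bar>C\<bar> * \<bar>D\<bar> ^ M) * norm \<epsilon> ^ M"
    using D curve_eventually[OF A R, of \<sigma> x v]
  proof eventually_elim
    case (elim \<epsilon>)
    have "D * norm \<epsilon> \<le> \<bar>D\<bar> * norm \<epsilon>" by (intro mult_right_mono) auto
    then have "norm (curve \<sigma> A x v \<epsilon>) ^ M \<le> (\<bar>D\<bar> * norm \<epsilon>) ^ M"
      using elim(1) by (intro power_mono) auto
    then have "\<bar>C\<bar> * norm (curve \<sigma> A x v \<epsilon>) ^ M \<le> \<bar>C\<bar> * (\<bar>D\<bar> * norm \<epsilon>) ^ M"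
      by (intro mult_left_mono) auto
    moreover have "C * norm (curve \<sigma> A x v \<epsilon>) ^ M \<le> \<bar>C\<bar> * norm (curve \<sigma> A x v \<epsilon>) ^ M"
      by (intro mult_right_mono) auto
    ultimately show ?case using elim(2) by (simp add: power_mult_distrib mult.assoc)
  qed
  then show ?thesis by (intro exI[of _ "\<bar>C\<bar> * \<bar>D\<bar> ^ M"]) simp
qed

lemma curve_holomorphic:
  assumes "A \<noteq> 0"
  shows "(\<lambda>\<epsilon>. curve \<sigma> A x v \<epsilon> $ i) holomorphic_on S"
  using exhaust_5[of i] assms
  by (auto simp: curve_nth intro!: holomorphic_intros)

text \<open>
  The cross difference of \<open>g / h\<close> at the points \<open>curve \<sigma> A x v \<epsilon>\<close> and \<open>curve \<sigma> A' x' v' \<epsilon>\<close> is holomorphic in \<open>\<epsilon>\<close>. Were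
  it nonzero at \<open>e\<close>, it would have a finite order \<open>w\<close> at \<open>0\<close>, unaffected by passing to
  Taylor polynomials of order \<open>w + 2\<close>. After substitution of the chart these contradict \<open>no_formal_integral\<close>.
\<close>

lemma no_separating_integral:
  fixes g h :: "complex ^ 5 \<Rightarrow> complex"
  assumes g: "mv_holomorphic_on g (ball 0 r)" and h: "mv_holomorphic_on h (ball 0 r)" and r: "r > 0"
    and nz: "\<exists>q\<in>ball 0 r. h q \<noteq> 0"
    and rel: "\<And>z. z \<in> ball 0 r \<Longrightarrow> h z \<noteq> 0 \<Longrightarrow> dir_deriv g z (karabut z) * h z = g z * dir_deriv h z (karabut z)"
    and A: "A \<noteq> 0" "A' \<noteq> 0" and e: "e \<in> ball 0 \<delta>"
    and ball: "\<And>\<epsilon>. \<epsilon> \<in> ball 0 \<delta> \<Longrightarrow> curve \<sigma> A x v \<epsilon> \<in> ball 0 r \<and> curve \<sigma> A' x' v' \<epsilon> \<in> ball 0 r"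
  shows "g (curve \<sigma> A x v e) * h (curve \<sigma> A' x' v' e) = g (curve \<sigma> A' x' v' e) * h (curve \<sigma> A x v e)"
proof (rule ccontr)
  assume ne: "\<not> ?thesis"
  let ?c = "curve \<sigma> A x v" and ?c' = "curve \<sigma> A' x' v'"
  define T where "T \<epsilon> = g (?c \<epsilon>) * h (?c' \<epsilon>) - g (?c' \<epsilon>) * h (?c \<epsilon>)" for \<epsilon>
  have "T holomorphic_on ball 0 \<delta>"
    unfolding T_def using ball A
    by (intro holomorphic_intros holomorphic_on_curve[OF g] holomorphic_on_curve[OF h] curve_holomorphic) auto
  moreover have "T e \<noteq> 0" using ne by (simp add: T_def)
  ultimately obtain w c where c: "0 < c" "\<forall>\<^sub>F \<epsilon> in at 0. c * norm \<epsilon> ^ w \<le> norm (T \<epsilon>)"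
    using holomorphic_lower_bound e by blast
  \<comment> \<open>One order is lost to the factor \<eta> of the time scale, and one makes the comparison of orders strict.\<close>
  define M where "M = w + 2"
  obtain P C1 where P: "\<forall>\<^sub>F z in nhds 0. norm (g z - peval P z) \<le> C1 * norm z ^ M"
    using mv_holomorphic_taylor[OF g r] by blast
  obtain Q C2 where Q: "\<forall>\<^sub>F z in nhds 0. norm (h z - peval Q z) \<le> C2 * norm z ^ M"
    using mv_holomorphic_taylor[OF h r] by blast
  obtain C where PQ: "\<forall>\<^sub>F z in nhds 0. norm (peval (pflow P) z * peval Q z - peval P z * peval (pflow Q) z) \<le> C * norm z ^ M"
    using first_integral_polynomials[OF g h r nz rel P Q] by blast
  define G H where "G = psub (ring_chart \<sigma>) P" and "H = psub (ring_chart \<sigma>) Q"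
  have "var_eta ^ M dvd psub (ring_chart \<sigma>) (pflow P) * H - G * psub (ring_chart \<sigma>) (pflow Q)"
  proof (rule var_eta_power_dvdI)
    fix A x v :: complex assume A: "A \<noteq> 0"
    obtain D where D: "\<forall>\<^sub>F \<epsilon> in at 0. norm (peval (pflow P) (curve \<sigma> A x v \<epsilon>) * peval Q (curve \<sigma> A x v \<epsilon>)
        - peval P (curve \<sigma> A x v \<epsilon>) * peval (pflow Q) (curve \<sigma> A x v \<epsilon>)) \<le> D * norm \<epsilon> ^ M"
      using curve_power_estimate[OF A PQ] by blast
    have "filterlim (\<lambda>\<eta>. \<eta> * A) (at 0) (at 0)"
      using A by (auto simp: filterlim_at eventually_at_filter intro!: tendsto_eq_intros)
    from eventually_compose_filterlim[OF D this]
    have "\<forall>\<^sub>F \<eta> in at 0. norm (eval4 (psub (ring_chart \<sigma>) (pflow P) * H - G * psub (ring_chart \<sigma>) (pflow Q)) \<eta> A x v) \<le> (D * norm A ^ M) * norm \<eta> ^ M"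
      using A by (simp add: curve_def eval4_psub G_def H_def norm_mult power_mult_distrib mult_ac)
    then show "\<exists>C. \<forall>\<^sub>F \<eta> in at 0. norm (eval4 (psub (ring_chart \<sigma>) (pflow P) * H - G * psub (ring_chart \<sigma>) (pflow Q)) \<eta> A x v) \<le> C * norm \<eta> ^ M"
      by blast
  qed
  moreover have "var_eta * (chart_der \<sigma> G * H - G * chart_der \<sigma> H) =
      cst \<i> * var_v * (psub (ring_chart \<sigma>) (pflow P) * H - G * psub (ring_chart \<sigma>) (pflow Q))"
  proof -
    have "var_eta * (chart_der \<sigma> G * H - G * chart_der \<sigma> H) = (var_eta * chart_der \<sigma> G) * H - G * (var_eta * chart_der \<sigma> H)"
      by (simp add: algebra_simps)
    then show ?thesis unfolding G_def H_def chart_der_psub by (simp add: algebra_simps)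
  qed
  ultimately have "var_eta ^ M dvd var_eta * (chart_der \<sigma> G * H - G * chart_der \<sigma> H)" by simp
  then have "var_eta * var_eta ^ (w + 1) dvd var_eta * (chart_der \<sigma> G * H - G * chart_der \<sigma> H)" by (simp add: M_def)
  then have dv: "var_eta ^ (w + 1) dvd chart_der \<sigma> G * H - G * chart_der \<sigma> H"
    by (subst (asm) dvd_mult_cancel_left) (simp add: var_eta_def)
  obtain D1 where D1: "0 \<le> D1" "\<forall>\<^sub>F \<epsilon> in at 0. norm (g (?c \<epsilon>) - peval P (?c \<epsilon>)) \<le> D1 * norm \<epsilon> ^ M"
    using curve_power_estimate[OF A(1) P] by blast
  obtain D2 where D2: "0 \<le> D2" "\<forall>\<^sub>F \<epsilon> in at 0. norm (g (?c' \<epsilon>) - peval P (?c' \<epsilon>)) \<le> D2 * norm \<epsilon> ^ M"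
    using curve_power_estimate[OF A(2) P] by blast
  obtain D3 where D3: "0 \<le> D3" "\<forall>\<^sub>F \<epsilon> in at 0. norm (h (?c \<epsilon>) - peval Q (?c \<epsilon>)) \<le> D3 * norm \<epsilon> ^ M"
    using curve_power_estimate[OF A(1) Q] by blast
  obtain D4 where D4: "0 \<le> D4" "\<forall>\<^sub>F \<epsilon> in at 0. norm (h (?c' \<epsilon>) - peval Q (?c' \<epsilon>)) \<le> D4 * norm \<epsilon> ^ M"
    using curve_power_estimate[OF A(2) Q] by blast
  have hc: "isCont h 0"
    using mv_holomorphic_continuous[OF h] r by (simp add: continuous_on_eq_continuous_at)
  define B where "B = norm (h 0) + norm (peval P 0) + 1"
  have "0 \<le> B" by (simp add: B_def)
  define E where "E = (D1 + D4 + D2 + D3) * B"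
  have "isCont (\<lambda>\<epsilon>::complex. E * norm \<epsilon> ^ 2) 0" by (intro continuous_intros)
  then have "((\<lambda>\<epsilon>::complex. E * norm \<epsilon> ^ 2) \<longlongrightarrow> 0) (at 0)" by (simp add: isCont_def)
  then have "\<forall>\<^sub>F \<epsilon> in at (0::complex). E * norm \<epsilon> ^ 2 < c / 2"
    by (rule order_tendstoD(2)) (use c in simp)
  then have "\<forall>\<^sub>F \<epsilon> in at 0. c / 2 * norm \<epsilon> ^ w \<le> norm (cross_term G H A x v A' x' v' \<epsilon>)"
    using c(2) D1(2) D2(2) D3(2) D4(2) curve_eventually[OF A(1) isCont_bounded_nhds[OF hc], of \<sigma> x v] curve_eventually[OF A(2) isCont_bounded_nhds[OF hc], of \<sigma> x' v']
      curve_eventually[OF A(1) isCont_bounded_nhds[OF continuous_peval[where e = P]], of \<sigma> x v]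
      curve_eventually[OF A(2) isCont_bounded_nhds[OF continuous_peval[where e = P]], of \<sigma> x' v']
  proof eventually_elim
    case (elim \<epsilon>)
    have cr: "cross_term G H A x v A' x' v' \<epsilon> = peval P (?c \<epsilon>) * peval Q (?c' \<epsilon>) - peval P (?c' \<epsilon>) * peval Q (?c \<epsilon>)"
      by (simp add: cross_term_def G_def H_def eval4_psub curve_def)
    have b: "norm (h (?c \<epsilon>)) \<le> B" "norm (h (?c' \<epsilon>)) \<le> B" "norm (peval P (?c \<epsilon>)) \<le> B" "norm (peval P (?c' \<epsilon>)) \<le> B"
      using elim(7-10) by (auto simp: B_def intro: order.trans[OF less_imp_le])
    have eq: "T \<epsilon> - cross_term G H A x v A' x' v' \<epsilon> = (g (?c \<epsilon>) - peval P (?c \<epsilon>)) * h (?c' \<epsilon>)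
        - (g (?c' \<epsilon>) - peval P (?c' \<epsilon>)) * h (?c \<epsilon>)
        + peval P (?c \<epsilon>) * (h (?c' \<epsilon>) - peval Q (?c' \<epsilon>))
        + - (peval P (?c' \<epsilon>) * (h (?c \<epsilon>) - peval Q (?c \<epsilon>)))"
      unfolding cr T_def by (simp add: algebra_simps)
    have "norm (T \<epsilon> - cross_term G H A x v A' x' v' \<epsilon>) \<le> norm (g (?c \<epsilon>) - peval P (?c \<epsilon>)) * norm (h (?c' \<epsilon>))
        + norm (g (?c' \<epsilon>) - peval P (?c' \<epsilon>)) * norm (h (?c \<epsilon>))
        + norm (peval P (?c \<epsilon>)) * norm (h (?c' \<epsilon>) - peval Q (?c' \<epsilon>))
        + norm (peval P (?c' \<epsilon>)) * norm (h (?c \<epsilon>) - peval Q (?c \<epsilon>))"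
      unfolding eq by (rule order.trans[OF norm_four_le]) (simp add: norm_mult)
    also have "\<dots> \<le> (D1 * norm \<epsilon> ^ M) * B + (D2 * norm \<epsilon> ^ M) * B + B * (D4 * norm \<epsilon> ^ M) + B * (D3 * norm \<epsilon> ^ M)"
      using \<open>0 \<le> B\<close> D1(1) D2(1)
      by (intro add_mono mult_mono[OF elim(3) b(2)] mult_mono[OF elim(4) b(1)]
          mult_mono[OF b(3) elim(6)] mult_mono[OF b(4) elim(5)]) simp_all
    also have "\<dots> = E * norm \<epsilon> ^ 2 * norm \<epsilon> ^ w" by (simp add: E_def M_def power_add power2_eq_square algebra_simps)
    also have "\<dots> \<le> c / 2 * norm \<epsilon> ^ w" using elim(1) by (intro mult_right_mono) auto
    finally have "norm (T \<epsilon> - cross_term G H A x v A' x' v' \<epsilon>) \<le> c / 2 * norm \<epsilon> ^ w" .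
    moreover have "norm (T \<epsilon>) \<le> norm (cross_term G H A x v A' x' v' \<epsilon>) + norm (T \<epsilon> - cross_term G H A x v A' x' v' \<epsilon>)"
      by (rule norm_triangle_sub)
    ultimately show ?case using elim(2) by linarith
  qed
  from no_formal_integral[OF _ _ A dv this] c(1) show False by simp
qed

section \<open>Gradients of first integrals\<close>

text \<open>
  The bound is uniform in the parameters, so that one radius \<open>\<bar>\<epsilon>\<bar> < r / 2000\<close> keeps the curves inside the ball where the
  integral is a quotient.
\<close>

lemma curve_norm_le:
  assumes A: "1/2 < norm A" "norm A < 2" and p: "norm x < 1" "norm v < 2" "norm \<sigma> < 1" "norm \<epsilon> \<le> 1"
  shows "norm (curve \<sigma> A x v \<epsilon>) \<le> 2000 * norm \<epsilon>"
proof -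
  have A0: "A \<noteq> 0" using A by auto
  define y where "y = \<epsilon> * \<sigma> - 2 * (x * v) - 2 * v"
  define Q where "Q = 4 * (x * v)\<^sup>2 + 4 * v\<^sup>2 + 2 * y\<^sup>2"
  define B where "B = (1 - \<epsilon>\<^sup>2 * Q) / A"
  have xv: "norm (x * v) \<le> 2" using mult_mono[of "norm x" 1 "norm v" 2] p by (simp add: norm_mult)
  have es: "norm (\<epsilon> * \<sigma>) \<le> 1" using mult_mono[of "norm \<epsilon>" 1 "norm \<sigma>" 1] p by (simp add: norm_mult)
  have y: "norm y \<le> 9"
    using norm_triangle_ineq4[of "\<epsilon> * \<sigma> - 2 * (x * v)" "2 * v"] norm_triangle_ineq4[of "\<epsilon> * \<sigma>" "2 * (x * v)"]
      xv es p unfolding y_def by (simp add: norm_mult)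
  have sq: "norm (a\<^sup>2) \<le> c\<^sup>2" if "norm a \<le> c" for a :: complex and c
    using that by (simp add: norm_power power_mono)
  have Q: "norm Q \<le> 194"
    using norm_triangle_ineq[of "4 * (x * v)\<^sup>2 + 4 * v\<^sup>2" "2 * y\<^sup>2"] norm_triangle_ineq[of "4 * (x * v)\<^sup>2" "4 * v\<^sup>2"]
      sq[OF xv] sq[OF y] sq[of v 2] p unfolding Q_def by (simp add: norm_mult norm_power)
  have e2: "norm (\<epsilon>\<^sup>2) \<le> norm \<epsilon>"
    using mult_mono[of "norm \<epsilon>" 1 "norm \<epsilon>" "norm \<epsilon>"] p by (simp add: power2_eq_square norm_mult)
  have eQ: "norm (\<epsilon>\<^sup>2 * Q) \<le> 194"
    using mult_mono[of "norm (\<epsilon>\<^sup>2)" 1 "norm Q" 194] e2 p Q by (simp add: norm_mult)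
  have "norm (1 - \<epsilon>\<^sup>2 * Q) \<le> 195" using norm_triangle_ineq4[of 1 "\<epsilon>\<^sup>2 * Q"] eQ by simp
  also have "\<dots> \<le> 390 * norm A" using A by simp
  finally have B: "norm B \<le> 390" using A by (simp add: B_def norm_divide divide_le_eq)
  have AB: "norm (\<epsilon> * (A + B)) \<le> 392 * norm \<epsilon>" "norm (\<i> * \<epsilon> * (A - B)) \<le> 392 * norm \<epsilon>"
  proof -
    have "norm (A + B) \<le> 392" "norm (A - B) \<le> 392"
      using norm_triangle_ineq[of A B] norm_triangle_ineq4[of A B] A B by auto
    then show "norm (\<epsilon> * (A + B)) \<le> 392 * norm \<epsilon>" "norm (\<i> * \<epsilon> * (A - B)) \<le> 392 * norm \<epsilon>"
      by (simp_all add: norm_mult mult.commute[of "norm \<epsilon>"] mult_right_mono)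
  qed
  have m: "norm (4 * \<epsilon>\<^sup>2 * a) \<le> 4 * c * norm \<epsilon>" if "norm a \<le> c" for a c
  proof -
    have "norm (\<epsilon>\<^sup>2) * norm a \<le> norm \<epsilon> * c" using e2 that by (intro mult_mono) auto
    then show ?thesis by (simp add: norm_mult mult_ac)
  qed
  have v2: "norm v \<le> 2" using p by simp
  note nth = curve_nth[OF A0, of \<sigma> x v \<epsilon>, folded y_def, folded Q_def, folded B_def]
  have "norm (curve \<sigma> A x v \<epsilon> $ i) \<le> 400 * norm \<epsilon>" for i
    using exhaust_5[of i]
  proof (elim disjE)
    assume i: "i = 1"
    show ?thesis unfolding i nth using norm_triangle_ineq[of "\<epsilon> * (A + B)" "4 * \<epsilon>\<^sup>2 * (x * v)"] AB(1) m[OF xv] by simp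
  next
    assume i: "i = 2"
    show ?thesis unfolding i nth using norm_triangle_ineq4[of "4 * \<epsilon>\<^sup>2 * v" "\<i> * \<epsilon> * (A - B)"] AB(2) m[OF v2] by simp
  next
    assume i: "i = 3"
    show ?thesis unfolding i nth using norm_triangle_ineq[of "4 * \<epsilon>\<^sup>2 * v" "\<i> * \<epsilon> * (A - B)"] AB(2) m[OF v2] by simp
  next
    assume i: "i = 4"
    show ?thesis unfolding i nth using norm_triangle_ineq4[of "4 * \<epsilon>\<^sup>2 * (x * v)" "\<epsilon> * (A + B)"] AB(1) m[OF xv] by simp
  next
    assume i: "i = 5"
    show ?thesis unfolding i nth using m[OF y] norm_ge_zero[of \<epsilon>] by linarith
  qed
  from norm_vec5_le[OF this] show ?thesis by simp
qed

text \<open>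
  The parameters of a point: the two integrals determine \<open>e\<close> (up to sign) and \<open>\<sigma>\<close>, and the rest is linear algebra. In particular the
  curves sweep out an open set.
\<close>

lemma curve_inverse:
  fixes z :: "complex ^ 5"
  assumes e: "8 * e\<^sup>2 = (z$1)\<^sup>2 + (z$2)\<^sup>2 + (z$3)\<^sup>2 + (z$4)\<^sup>2 + (z$5)\<^sup>2" "e \<noteq> 0"
    and A: "A = (z$1 - z$4 - \<i> * (z$3 - z$2)) / (4 * e)" "A \<noteq> 0"
    and v: "v = (z$2 + z$3) / (8 * e\<^sup>2)" "v \<noteq> 0" and x: "x = (z$1 + z$4) / (8 * e\<^sup>2) / v"
    and \<sigma>: "\<sigma> = (z$1 + z$2 + z$3 + z$4 + z$5) / (4 * e ^ 3)"
  shows "curve \<sigma> A x v e = z"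
proof -
  have xv: "x * v = (z$1 + z$4) / (8 * e\<^sup>2)" using v(2) by (simp add: x)
  have y: "e * \<sigma> - 2 * (x * v) - 2 * v = z$5 / (4 * e\<^sup>2)"
    unfolding xv using e(2) by (simp add: \<sigma> v(1) field_simps power2_eq_square power3_eq_cube)
  define B where "B = (z$1 - z$4 + \<i> * (z$3 - z$2)) / (4 * e)"
  have AB: "16 * e\<^sup>2 * (A * B) = (z$1 - z$4)\<^sup>2 + (z$3 - z$2)\<^sup>2"
    using e(2) by (simp add: A B_def field_simps power2_eq_square)
  have z: "8 * e\<^sup>2 * (x * v) = z$1 + z$4" "8 * e\<^sup>2 * v = z$2 + z$3" "4 * e\<^sup>2 * (z$5 / (4 * e\<^sup>2)) = z$5"
    unfolding xv using e(2) by (simp_all add: v(1))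
  have "16 * e\<^sup>2 * (1 - e\<^sup>2 * (4 * u\<^sup>2 + 4 * v\<^sup>2 + 2 * y\<^sup>2))
      = 2 * (8 * e\<^sup>2) - ((8 * e\<^sup>2 * u)\<^sup>2 + (8 * e\<^sup>2 * v)\<^sup>2 + 2 * (4 * e\<^sup>2 * y)\<^sup>2)" for u y
    by (simp add: power2_eq_square algebra_simps)
  from this[of "x * v" "z$5 / (4 * e\<^sup>2)"]
  have "16 * e\<^sup>2 * (1 - e\<^sup>2 * (4 * (x * v)\<^sup>2 + 4 * v\<^sup>2 + 2 * (z$5 / (4 * e\<^sup>2))\<^sup>2))
      = 2 * (8 * e\<^sup>2) - ((8 * e\<^sup>2 * (x * v))\<^sup>2 + (8 * e\<^sup>2 * v)\<^sup>2 + 2 * (4 * e\<^sup>2 * (z$5 / (4 * e\<^sup>2)))\<^sup>2)" .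
  also have "\<dots> = 16 * e\<^sup>2 * (A * B)"
    unfolding AB z unfolding e(1) by (simp add: power2_eq_square algebra_simps)
  finally have "16 * e\<^sup>2 * (1 - e\<^sup>2 * (4 * (x * v)\<^sup>2 + 4 * v\<^sup>2 + 2 * (z$5 / (4 * e\<^sup>2))\<^sup>2)) = 16 * e\<^sup>2 * (A * B)" .
  then have "1 - e\<^sup>2 * (4 * (x * v)\<^sup>2 + 4 * v\<^sup>2 + 2 * (z$5 / (4 * e\<^sup>2))\<^sup>2) = A * B"
    using e(2) by simp
  then have B: "(1 - e\<^sup>2 * (4 * (x * v)\<^sup>2 + 4 * v\<^sup>2 + 2 * (z$5 / (4 * e\<^sup>2))\<^sup>2)) / A = B"
    using A(2) by simp
  have s: "e * (A + B) = (z$1 - z$4) / 2" "\<i> * e * (A - B) = (z$3 - z$2) / 2"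
    using e(2) by (simp_all add: A B_def field_simps)
  note nth = curve_nth[OF A(2), of \<sigma> x v e, unfolded y, unfolded B, unfolded s]
  have "curve \<sigma> A x v e $ i = z $ i" for i
    using exhaust_5[of i] e(2)
    by (auto simp: nth xv) (auto simp: v(1) field_simps)
  then show ?thesis by (simp add: vec_eq_iff)
qed

lemma UNIV_5: "(UNIV :: 5 set) = {1, 2, 3, 4, 5}"
  using exhaust_5 by auto

lemma sum_5: "sum f (UNIV :: 5 set) = f 1 + f 2 + f 3 + f 4 + f 5"
  unfolding UNIV_5 by (simp add: add_ac)

text \<open>
  The tangent vectors of the level set in the directions \<open>A\<close>, \<open>x\<close>, \<open>v\<close> span a space of dimension three, whose annihilator consists of
  the combinations of \<open>(1, \<dots>, 1)\<close> and the point \<open>X\<close> itself. Here \<open>Bx\<close> and \<open>Bv\<close> are the partial derivatives of \<open>B\<close>.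
\<close>

lemma span_linear_algebra:
  fixes p1 p2 p3 p4 p5 :: complex
  assumes nz: "A \<noteq> 0" "e \<noteq> 0" "v \<noteq> 0"
    and eA: "p1 * (e * (1 - B / A)) + p2 * (- \<i> * e * (1 + B / A)) + p3 * (\<i> * e * (1 + B / A)) + p4 * (- e * (1 - B / A)) = 0"
    and ex: "p1 * (e * Bx + 4 * e\<^sup>2 * v) + p2 * (\<i> * e * Bx) + p3 * (- \<i> * e * Bx) + p4 * (4 * e\<^sup>2 * v - e * Bx) + p5 * (4 * e\<^sup>2 * (- 2 * v)) = 0"
    and ev: "p1 * (e * Bv + 4 * e\<^sup>2 * x) + p2 * (4 * e\<^sup>2 + \<i> * e * Bv) + p3 * (4 * e\<^sup>2 - \<i> * e * Bv) + p4 * (4 * e\<^sup>2 * x - e * Bv)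
       + p5 * (4 * e\<^sup>2 * (- 2 * x - 2)) = 0"
    and Bx: "A * Bx = - 8 * e\<^sup>2 * (v * (x * v - y))" and Bv: "A * Bv = - 8 * e\<^sup>2 * (x * (x * v - y) + (v - y))"
    and X: "X1 = e * (A + B) + 4 * e\<^sup>2 * (x * v)" "X2 = 4 * e\<^sup>2 * v - \<i> * e * (A - B)"
     "X3 = 4 * e\<^sup>2 * v + \<i> * e * (A - B)" "X4 = 4 * e\<^sup>2 * (x * v) - e * (A + B)" "X5 = 4 * e\<^sup>2 * y"
  shows "\<exists>l \<mu>. p1 = l + \<mu> * X1 \<and> p2 = l + \<mu> * X2 \<and> p3 = l + \<mu> * X3 \<and> p4 = l + \<mu> * X4 \<and> p5 = l + \<mu> * X5"
proof -
  define a b where "a = p1 - p4" and "b = p3 - p2"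
  \<comment> \<open>The A-direction relates the two isotropic combinations of a and b, so that both are given by one number \<mu>;
    the x- and v-directions then give p1 + p4 - 2 p5 and p2 + p3 - 2 p5.\<close>
  define \<mu> where "\<mu> = (a - \<i> * b) / (4 * e * A)"
  define l where "l = p5 - \<mu> * X5"
  have II: "\<i> * (\<i> * z) = - z" for z by (simp flip: mult.assoc)
  have \<mu>: "a - \<i> * b = 4 * e * A * \<mu>" using nz by (simp add: \<mu>_def)
  have "e * (a * (1 - c) + \<i> * b * (1 + c)) = p1 * (e * (1 - c)) + p2 * (- \<i> * e * (1 + c))
      + p3 * (\<i> * e * (1 + c)) + p4 * (- e * (1 - c))" for c
    by (simp add: a_def b_def algebra_simps)
  from trans[OF this[of "B / A"] eA] have "e * (a * (1 - B / A) + \<i> * b * (1 + B / A)) = 0" .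
  then have X0: "a * (1 - B / A) + \<i> * b * (1 + B / A) = 0" using nz(2) by (simp only: mult_eq_0_iff) blast
  have "a * (A - A * c) + \<i> * b * (A + A * c) = A * (a * (1 - c) + \<i> * b * (1 + c))" for c
    by (simp add: algebra_simps)
  from this[of "B / A"] have eA': "a * (A - B) + \<i> * b * (A + B) = 0"
    unfolding X0 using nz(1) by simp
  have "2 * A * a = 2 * A * (2 * e * \<mu> * (A + B))"
  proof -
    have "2 * A * (2 * e * \<mu> * (A + B)) = (a - \<i> * b) * (A + B)" unfolding \<mu> by (simp add: algebra_simps)
    also have "\<dots> = 2 * A * a - (a * (A - B) + \<i> * b * (A + B))" by (simp add: algebra_simps)
    finally show ?thesis unfolding eA' by (simp only: mult_zero_right diff_0_right add_0_right)
  qed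
  then have a: "a = 2 * e * \<mu> * (A + B)" using nz by simp
  have "2 * A * b = 2 * A * (2 * e * \<i> * \<mu> * (A - B))"
  proof -
    have "2 * A * (2 * e * \<i> * \<mu> * (A - B)) = \<i> * ((a - \<i> * b) * (A - B))" unfolding \<mu> by (simp add: algebra_simps)
    also have "\<dots> = 2 * A * b + \<i> * (a * (A - B) + \<i> * b * (A + B))" by (simp add: algebra_simps II)
    finally show ?thesis unfolding eA' by (simp only: mult_zero_right diff_0_right add_0_right)
  qed
  then have b: "b = 2 * e * \<i> * \<mu> * (A - B)" using nz by simp
  have e4: "4 * e\<^sup>2 \<noteq> 0" using nz(2) by simp
  have ex': "v * (p1 + p4 - 2 * p5) = v * (8 * e\<^sup>2 * \<mu> * (x * v - y))"
  proof -
    have "e * (Bx * (a - \<i> * b)) + 4 * e\<^sup>2 * (v * (p1 + p4 - 2 * p5)) = 0"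
      using ex by (simp add: a_def b_def algebra_simps)
    then have "4 * e\<^sup>2 * (v * (p1 + p4 - 2 * p5)) = - (e * (Bx * (4 * e * A * \<mu>)))"
      unfolding \<mu> by (metis add_eq_0_iff)
    also have "\<dots> = 4 * e\<^sup>2 * (- \<mu> * (A * Bx))" by (simp add: power2_eq_square mult_ac)
    finally have "4 * e\<^sup>2 * (v * (p1 + p4 - 2 * p5)) = 4 * e\<^sup>2 * (- \<mu> * (A * Bx))" .
    then have "v * (p1 + p4 - 2 * p5) = - \<mu> * (A * Bx)"
      by (rule mult_left_cancel[OF e4, THEN iffD1])
    then show ?thesis unfolding Bx by (simp add: algebra_simps)
  qed
  then have p14: "p1 + p4 - 2 * p5 = 8 * e\<^sup>2 * \<mu> * (x * v - y)" by (rule mult_left_cancel[OF nz(3), THEN iffD1])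
  have ev': "x * (p1 + p4 - 2 * p5) + (p2 + p3 - 2 * p5) = 8 * e\<^sup>2 * \<mu> * (x * (x * v - y) + (v - y))"
  proof -
    have "e * (Bv * (a - \<i> * b)) + 4 * e\<^sup>2 * (x * (p1 + p4 - 2 * p5) + (p2 + p3 - 2 * p5)) = 0"
      using ev by (simp add: a_def b_def algebra_simps)
    then have "4 * e\<^sup>2 * (x * (p1 + p4 - 2 * p5) + (p2 + p3 - 2 * p5)) = - (e * (Bv * (4 * e * A * \<mu>)))"
      unfolding \<mu> by (metis add_eq_0_iff)
    also have "\<dots> = 4 * e\<^sup>2 * (- \<mu> * (A * Bv))" by (simp add: power2_eq_square mult_ac)
    finally have "4 * e\<^sup>2 * (x * (p1 + p4 - 2 * p5) + (p2 + p3 - 2 * p5)) = 4 * e\<^sup>2 * (- \<mu> * (A * Bv))" .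
    then have "x * (p1 + p4 - 2 * p5) + (p2 + p3 - 2 * p5) = - \<mu> * (A * Bv)"
      by (rule mult_left_cancel[OF e4, THEN iffD1])
    then show ?thesis unfolding Bv by (simp add: algebra_simps)
  qed
  then have p23: "p2 + p3 - 2 * p5 = 8 * e\<^sup>2 * \<mu> * (v - y)" unfolding p14 by (simp add: algebra_simps)
  have h: "p1 = ((p1 + p4 - 2 * p5) + a) / 2 + p5" "p4 = ((p1 + p4 - 2 * p5) - a) / 2 + p5"
     "p3 = ((p2 + p3 - 2 * p5) + b) / 2 + p5" "p2 = ((p2 + p3 - 2 * p5) - b) / 2 + p5"
    by (simp_all add: a_def b_def field_simps)
  note h' = h[unfolded p14 p23 a b]
  have "p1 = l + \<mu> * X1"
    by (subst h'(1)) (simp add: l_def X add_divide_distrib diff_divide_distrib algebra_simps)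
  moreover have "p4 = l + \<mu> * X4"
    by (subst h'(2)) (simp add: l_def X add_divide_distrib diff_divide_distrib algebra_simps)
  moreover have "p3 = l + \<mu> * X3"
    by (subst h'(3)) (simp add: l_def X add_divide_distrib diff_divide_distrib algebra_simps)
  moreover have "p2 = l + \<mu> * X2"
    by (subst h'(4)) (simp add: l_def X add_divide_distrib diff_divide_distrib algebra_simps)
  moreover have "p5 = l + \<mu> * X5" by (simp add: l_def)
  ultimately show ?thesis by blast
qed

lemma vector_curve_derivative:
  fixes \<alpha> \<beta> u v y :: "complex \<Rightarrow> complex"
  assumes "(\<alpha> has_field_derivative \<alpha>') (at t0)" "(\<beta> has_field_derivative \<beta>') (at t0)"
    "(u has_field_derivative u') (at t0)" "(v has_field_derivative v') (at t0)" "(y has_field_derivative y') (at t0)"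
  shows "((\<lambda>t. vector [e * (\<alpha> t + \<beta> t) + 4 * e\<^sup>2 * u t, 4 * e\<^sup>2 * v t - \<i> * e * (\<alpha> t - \<beta> t),
       4 * e\<^sup>2 * v t + \<i> * e * (\<alpha> t - \<beta> t), 4 * e\<^sup>2 * u t - e * (\<alpha> t + \<beta> t), 4 * e\<^sup>2 * y t] $ i)
     has_field_derivative
      vector [e * (\<alpha>' + \<beta>') + 4 * e\<^sup>2 * u', 4 * e\<^sup>2 * v' - \<i> * e * (\<alpha>' - \<beta>'),
       4 * e\<^sup>2 * v' + \<i> * e * (\<alpha>' - \<beta>'), 4 * e\<^sup>2 * u' - e * (\<alpha>' + \<beta>'), 4 * e\<^sup>2 * y'] $ (i :: 5)) (at t0)"
  using exhaust_5[of i]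
  by (elim disjE) (simp_all only: vector_5, (intro DERIV_add DERIV_diff DERIV_cmult assms)+)

lemma curve_derivatives:
  fixes \<sigma> A x v e :: complex
  assumes nz: "A \<noteq> 0"
  defines "y \<equiv> e * \<sigma> - 2 * (x * v) - 2 * v"
  defines "B \<equiv> (1 - e\<^sup>2 * (4 * (x * v)\<^sup>2 + 4 * v\<^sup>2 + 2 * y\<^sup>2)) / A"
  defines "Bx \<equiv> - 8 * e\<^sup>2 * (v * (x * v - y)) / A"
  defines "Bv \<equiv> - 8 * e\<^sup>2 * (x * (x * v - y) + (v - y)) / A"
  shows "((\<lambda>t. curve \<sigma> t x v e $ i) has_field_derivative
     vector [e * (1 + - B / A) + 4 * e\<^sup>2 * 0, 4 * e\<^sup>2 * 0 - \<i> * e * (1 - - B / A),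
       4 * e\<^sup>2 * 0 + \<i> * e * (1 - - B / A), 4 * e\<^sup>2 * 0 - e * (1 + - B / A), 4 * e\<^sup>2 * 0] $ i) (at A)"
    "((\<lambda>t. curve \<sigma> A t v e $ i) has_field_derivative
     vector [e * (0 + Bx) + 4 * e\<^sup>2 * v, 4 * e\<^sup>2 * 0 - \<i> * e * (0 - Bx), 4 * e\<^sup>2 * 0 + \<i> * e * (0 - Bx),
       4 * e\<^sup>2 * v - e * (0 + Bx), 4 * e\<^sup>2 * (- 2 * v)] $ i) (at x)"
    "((\<lambda>t. curve \<sigma> A x t e $ i) has_field_derivative
     vector [e * (0 + Bv) + 4 * e\<^sup>2 * x, 4 * e\<^sup>2 * 1 - \<i> * e * (0 - Bv), 4 * e\<^sup>2 * 1 + \<i> * e * (0 - Bv),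
       4 * e\<^sup>2 * x - e * (0 + Bv), 4 * e\<^sup>2 * (- 2 * x - 2)] $ i) (at v)"
proof -
  show "((\<lambda>t. curve \<sigma> t x v e $ i) has_field_derivative
     vector [e * (1 + - B / A) + 4 * e\<^sup>2 * 0, 4 * e\<^sup>2 * 0 - \<i> * e * (1 - - B / A),
       4 * e\<^sup>2 * 0 + \<i> * e * (1 - - B / A), 4 * e\<^sup>2 * 0 - e * (1 + - B / A), 4 * e\<^sup>2 * 0] $ i) (at A)"
  proof -
    define w where "w = 1 - e\<^sup>2 * (4 * (x * v)\<^sup>2 + 4 * v\<^sup>2 + 2 * y\<^sup>2)"
    define b where "b t = w / t" for t
    have "((\<lambda>t. w / t) has_field_derivative - (w / A) / A) (at A)" for w
      using nz by (auto intro!: derivative_eq_intros)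
    from this[of w] have d: "(b has_field_derivative - B / A) (at A)"
      unfolding B_def w_def b_def[abs_def] .
    have "((\<lambda>t. vector [e * (t + b t) + 4 * e\<^sup>2 * (x * v), 4 * e\<^sup>2 * v - \<i> * e * (t - b t),
       4 * e\<^sup>2 * v + \<i> * e * (t - b t), 4 * e\<^sup>2 * (x * v) - e * (t + b t), 4 * e\<^sup>2 * y] $ i)
       has_field_derivative
     vector [e * (1 + - B / A) + 4 * e\<^sup>2 * 0, 4 * e\<^sup>2 * 0 - \<i> * e * (1 - - B / A),
       4 * e\<^sup>2 * 0 + \<i> * e * (1 - - B / A), 4 * e\<^sup>2 * 0 - e * (1 + - B / A), 4 * e\<^sup>2 * 0] $ i) (at A)"
      by (rule vector_curve_derivative[OF DERIV_ident d DERIV_const DERIV_const DERIV_const])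
    moreover have "curve \<sigma> t x v e $ i = vector [e * (t + b t) + 4 * e\<^sup>2 * (x * v), 4 * e\<^sup>2 * v - \<i> * e * (t - b t),
       4 * e\<^sup>2 * v + \<i> * e * (t - b t), 4 * e\<^sup>2 * (x * v) - e * (t + b t), 4 * e\<^sup>2 * y] $ i" if "t \<noteq> 0" for t
      using exhaust_5[of i] by (auto simp: curve_nth[OF that] w_def y_def b_def)
    then have "\<forall>\<^sub>F t in nhds A. curve \<sigma> t x v e $ i = vector [e * (t + b t) + 4 * e\<^sup>2 * (x * v), 4 * e\<^sup>2 * v - \<i> * e * (t - b t),
       4 * e\<^sup>2 * v + \<i> * e * (t - b t), 4 * e\<^sup>2 * (x * v) - e * (t + b t), 4 * e\<^sup>2 * y] $ i"
      using nz by (intro eventually_mono[OF t1_space_nhds[of A 0]]) auto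
    ultimately show ?thesis by (subst DERIV_cong_ev[OF refl _ refl])
  qed
  show "((\<lambda>t. curve \<sigma> A t v e $ i) has_field_derivative
     vector [e * (0 + Bx) + 4 * e\<^sup>2 * v, 4 * e\<^sup>2 * 0 - \<i> * e * (0 - Bx), 4 * e\<^sup>2 * 0 + \<i> * e * (0 - Bx),
       4 * e\<^sup>2 * v - e * (0 + Bx), 4 * e\<^sup>2 * (- 2 * v)] $ i) (at x)"
  proof -
    define b where "b t = (1 - e\<^sup>2 * (4 * (t * v)\<^sup>2 + 4 * v\<^sup>2 + 2 * (e * \<sigma> - 2 * (t * v) - 2 * v)\<^sup>2)) / A" for t
    have d: "(b has_field_derivative Bx) (at x)"
      unfolding b_def Bx_def y_def using nz
      by (auto intro!: derivative_eq_intros) (simp add: power2_eq_square algebra_simps)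
    have c: "curve \<sigma> A t v e = vector [e * (A + b t) + 4 * e\<^sup>2 * (t * v), 4 * e\<^sup>2 * v - \<i> * e * (A - b t),
       4 * e\<^sup>2 * v + \<i> * e * (A - b t), 4 * e\<^sup>2 * (t * v) - e * (A + b t), 4 * e\<^sup>2 * (e * \<sigma> - 2 * (t * v) - 2 * v)]" for t
      unfolding vec_eq_iff
    proof
      fix i show "curve \<sigma> A t v e $ i = vector [e * (A + b t) + 4 * e\<^sup>2 * (t * v), 4 * e\<^sup>2 * v - \<i> * e * (A - b t),
       4 * e\<^sup>2 * v + \<i> * e * (A - b t), 4 * e\<^sup>2 * (t * v) - e * (A + b t), 4 * e\<^sup>2 * (e * \<sigma> - 2 * (t * v) - 2 * v)] $ i"
        using exhaust_5[of i] by (auto simp: curve_nth[OF nz] b_def)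
    qed
    show ?thesis unfolding c
      by (rule vector_curve_derivative) (auto intro!: derivative_eq_intros d)
  qed
  show "((\<lambda>t. curve \<sigma> A x t e $ i) has_field_derivative
     vector [e * (0 + Bv) + 4 * e\<^sup>2 * x, 4 * e\<^sup>2 * 1 - \<i> * e * (0 - Bv), 4 * e\<^sup>2 * 1 + \<i> * e * (0 - Bv),
       4 * e\<^sup>2 * x - e * (0 + Bv), 4 * e\<^sup>2 * (- 2 * x - 2)] $ i) (at v)"
  proof -
    define b where "b t = (1 - e\<^sup>2 * (4 * (x * t)\<^sup>2 + 4 * t\<^sup>2 + 2 * (e * \<sigma> - 2 * (x * t) - 2 * t)\<^sup>2)) / A" for t
    have d: "(b has_field_derivative Bv) (at v)"
      unfolding b_def Bv_def y_def using nz
      by (auto intro!: derivative_eq_intros) (simp add: power2_eq_square algebra_simps)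
    have c: "curve \<sigma> A x t e = vector [e * (A + b t) + 4 * e\<^sup>2 * (x * t), 4 * e\<^sup>2 * t - \<i> * e * (A - b t),
       4 * e\<^sup>2 * t + \<i> * e * (A - b t), 4 * e\<^sup>2 * (x * t) - e * (A + b t), 4 * e\<^sup>2 * (e * \<sigma> - 2 * (x * t) - 2 * t)]" for t
      unfolding vec_eq_iff
    proof
      fix i show "curve \<sigma> A x t e $ i = vector [e * (A + b t) + 4 * e\<^sup>2 * (x * t), 4 * e\<^sup>2 * t - \<i> * e * (A - b t),
       4 * e\<^sup>2 * t + \<i> * e * (A - b t), 4 * e\<^sup>2 * (x * t) - e * (A + b t), 4 * e\<^sup>2 * (e * \<sigma> - 2 * (x * t) - 2 * t)] $ i"
        using exhaust_5[of i] by (auto simp: curve_nth[OF nz] b_def)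
    qed
    show ?thesis unfolding c
      by (rule vector_curve_derivative) (auto intro!: derivative_eq_intros d)
  qed
qed

text \<open>
  A function that is constant on the level set near \<open>z\<close> has a gradient that annihilates the tangent vectors.
\<close>

lemma gradient_in_span:
  fixes f :: "complex ^ 5 \<Rightarrow> complex"
  assumes an: "mv_analytic_at f z" and z: "z = curve \<sigma> A x v e" and nz: "A \<noteq> 0" "e \<noteq> 0" "v \<noteq> 0"
    and cA: "\<forall>\<^sub>F t in nhds A. f (curve \<sigma> t x v e) = f z"
    and cx: "\<forall>\<^sub>F t in nhds x. f (curve \<sigma> A t v e) = f z"
    and cv: "\<forall>\<^sub>F t in nhds v. f (curve \<sigma> A x t e) = f z"
  shows "\<exists>l \<mu>. \<forall>i. cpartial i f z = l + \<mu> * z $ i"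
proof -
  obtain U where U: "mv_holomorphic_on f U" "z \<in> U" using an unfolding mv_analytic_at_def by blast
  define y where "y = e * \<sigma> - 2 * (x * v) - 2 * v"
  define B where "B = (1 - e\<^sup>2 * (4 * (x * v)\<^sup>2 + 4 * v\<^sup>2 + 2 * y\<^sup>2)) / A"
  define Bx where "Bx = - 8 * e\<^sup>2 * (v * (x * v - y)) / A"
  define Bv where "Bv = - 8 * e\<^sup>2 * (x * (x * v - y) + (v - y)) / A"
  have tangent: "(\<Sum>i\<in>UNIV. T $ i * cpartial i f z) = 0"
    if d: "\<And>i. ((\<lambda>t. \<gamma> t $ i) has_field_derivative T $ i) (at t0)"
      and c: "\<forall>\<^sub>F t in nhds t0. f (\<gamma> t) = f z" and "\<gamma> t0 = z" for \<gamma> T t0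
  proof -
    have "((\<lambda>t. f (\<gamma> t)) has_field_derivative dir_deriv f z T) (at t0)"
      using curve_derivative[OF U(1) _ d] that(3) U(2) by simp
    moreover have "((\<lambda>t. f (\<gamma> t)) has_field_derivative 0) (at t0)"
      by (subst DERIV_cong_ev[OF refl c refl]) simp
    ultimately have "dir_deriv f z T = 0" using DERIV_unique by blast
    then show ?thesis by (simp add: dir_deriv_def)
  qed
  note nth = curve_nth[OF nz(1), of \<sigma> x v e, folded y_def, folded B_def, folded z]
  note T = curve_derivatives[OF nz(1), where \<sigma> = \<sigma> and x = x and v = v and e = e, folded y_def, folded B_def Bx_def Bv_def]
  have Bx: "A * Bx = - 8 * e\<^sup>2 * (v * (x * v - y))" and Bv: "A * Bv = - 8 * e\<^sup>2 * (x * (x * v - y) + (v - y))"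
    using nz by (simp_all add: Bx_def Bv_def)
  have "\<exists>l \<mu>. cpartial 1 f z = l + \<mu> * z $ 1 \<and> cpartial 2 f z = l + \<mu> * z $ 2 \<and> cpartial 3 f z = l + \<mu> * z $ 3
     \<and> cpartial 4 f z = l + \<mu> * z $ 4 \<and> cpartial 5 f z = l + \<mu> * z $ 5"
    by (rule span_linear_algebra[OF nz _ _ _ Bx Bv nth])
       (use tangent[OF T(1) cA z[symmetric]] tangent[OF T(2) cx z[symmetric]] tangent[OF T(3) cv z[symmetric]]
         in \<open>simp_all add: sum_5 mult.commute[of "cpartial i f z" for i]\<close>)
  then obtain l \<mu> where s: "cpartial 1 f z = l + \<mu> * z $ 1" "cpartial 2 f z = l + \<mu> * z $ 2"
    "cpartial 3 f z = l + \<mu> * z $ 3" "cpartial 4 f z = l + \<mu> * z $ 4" "cpartial 5 f z = l + \<mu> * z $ 5" by blast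
  have "cpartial i f z = l + \<mu> * z $ i" for i using exhaust_5[of i] s by auto
  then show ?thesis by blast
qed

text \<open>
  At the reference point \<open>A = 1, x = 0, v = 1, \<sigma> = 0\<close> the inverse formulas are continuous; the square root that gives \<open>e\<close> is
  taken near the positive number \<open>\<epsilon>\<^sup>2\<close>.
\<close>

lemma parameters_near_reference:
  fixes \<epsilon> :: real
  assumes \<epsilon>: "0 < \<epsilon>"
  shows "\<forall>\<^sub>F z in nhds (curve 0 1 0 1 (of_real \<epsilon>)). \<exists>e A x v \<sigma>. z = curve \<sigma> A x v e \<and> 1/2 < norm A \<and> norm A < 2
     \<and> norm x < 1 \<and> norm v < 2 \<and> v \<noteq> 0 \<and> norm \<sigma> < 1 \<and> norm e < 2 * \<epsilon> \<and> e \<noteq> 0"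
proof -
  define z0 where "z0 = curve 0 1 0 1 (of_real \<epsilon>)"
  let ?\<epsilon> = "complex_of_real \<epsilon>"
  have z0: "z0 $ 1 = 2 * ?\<epsilon> - 12 * ?\<epsilon> ^ 3" "z0 $ 2 = 4 * ?\<epsilon>\<^sup>2 - \<i> * (12 * ?\<epsilon> ^ 3)"
    "z0 $ 3 = 4 * ?\<epsilon>\<^sup>2 + \<i> * (12 * ?\<epsilon> ^ 3)" "z0 $ 4 = 12 * ?\<epsilon> ^ 3 - 2 * ?\<epsilon>" "z0 $ 5 = - 8 * ?\<epsilon>\<^sup>2"
    unfolding z0_def by (simp_all add: curve_nth algebra_simps power2_eq_square power3_eq_cube)
  define E2 where "E2 z = ((z$1)\<^sup>2 + (z$2)\<^sup>2 + (z$3)\<^sup>2 + (z$4)\<^sup>2 + (z$5)\<^sup>2) / 8" for z :: "complex ^ 5"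
  define E where "E z = csqrt (E2 z)" for z
  define A where "A z = (z$1 - z$4 - \<i> * (z$3 - z$2)) / (4 * E z)" for z
  define v where "v z = (z$2 + z$3) / (8 * (E z)\<^sup>2)" for z
  define x where "x z = (z$1 + z$4) / (8 * (E z)\<^sup>2) / v z" for z
  define \<sigma> where "\<sigma> z = (z$1 + z$2 + z$3 + z$4 + z$5) / (4 * E z ^ 3)" for z
  have II: "\<i> * (\<i> * z) = - z" for z by (simp flip: mult.assoc)
  have e2: "E2 z0 = ?\<epsilon>\<^sup>2"
    unfolding E2_def z0 by (simp add: power2_eq_square power3_eq_cube algebra_simps II)
  have E0: "E z0 = ?\<epsilon>" unfolding E_def e2 using \<epsilon> by (intro csqrt_square) simp
  have A0: "A z0 = 1" and v0: "v z0 = 1" and x0: "x z0 = 0" and \<sigma>0: "\<sigma> z0 = 0"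
    unfolding x_def A_def v_def \<sigma>_def E0 z0 using \<epsilon> by (simp_all add: algebra_simps II)
  have cE2: "isCont E2 z0" unfolding E2_def by (intro continuous_intros) auto
  have cE: "isCont E z0"
    unfolding E_def using cE2 e2 mult_pos_pos[OF \<epsilon> \<epsilon>]
    by (intro isCont_csqrt') (simp_all add: complex_nonpos_Reals_iff power2_eq_square)
  have ne: "E z0 \<noteq> 0" "v z0 \<noteq> 0" using \<epsilon> by (simp_all add: E0 v0)
  have cA: "isCont A z0" unfolding A_def using ne by (intro continuous_intros cE) auto
  have cv: "isCont v z0" unfolding v_def using ne by (intro continuous_intros cE) auto
  have cx: "isCont x z0" unfolding x_def using ne by (intro continuous_intros cE cv) auto
  have c\<sigma>: "isCont \<sigma> z0" unfolding \<sigma>_def using ne by (intro continuous_intros cE) auto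
  have lim: "((\<lambda>z. norm (F z)) \<longlongrightarrow> norm (F z0)) (nhds z0)" if "isCont F z0" for F :: "complex ^ 5 \<Rightarrow> complex"
    using that unfolding isCont_def tendsto_at_iff_tendsto_nhds by (rule tendsto_norm)
  have "\<forall>\<^sub>F z in nhds z0. 1/2 < norm (A z)" by (rule order_tendstoD(1)[OF lim[OF cA]]) (simp add: A0)
  moreover have "\<forall>\<^sub>F z in nhds z0. norm (A z) < 2" by (rule order_tendstoD(2)[OF lim[OF cA]]) (simp add: A0)
  moreover have "\<forall>\<^sub>F z in nhds z0. norm (x z) < 1" by (rule order_tendstoD(2)[OF lim[OF cx]]) (simp add: x0)
  moreover have "\<forall>\<^sub>F z in nhds z0. norm (v z) < 2" by (rule order_tendstoD(2)[OF lim[OF cv]]) (simp add: v0)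
  moreover have "\<forall>\<^sub>F z in nhds z0. 0 < norm (v z)" by (rule order_tendstoD(1)[OF lim[OF cv]]) (simp add: v0)
  moreover have "\<forall>\<^sub>F z in nhds z0. norm (\<sigma> z) < 1" by (rule order_tendstoD(2)[OF lim[OF c\<sigma>]]) (simp add: \<sigma>0)
  moreover have "\<forall>\<^sub>F z in nhds z0. norm (E z) < 2 * \<epsilon>"
    by (rule order_tendstoD(2)[OF lim[OF cE]]) (use \<epsilon> in \<open>simp add: E0\<close>)
  moreover have "\<forall>\<^sub>F z in nhds z0. 0 < norm (E z)"
    by (rule order_tendstoD(1)[OF lim[OF cE]]) (use \<epsilon> in \<open>simp add: E0\<close>)
  ultimately have "\<forall>\<^sub>F z in nhds z0. \<exists>e A x v \<sigma>. z = curve \<sigma> A x v e \<and> 1/2 < norm A \<and> norm A < 2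
     \<and> norm x < 1 \<and> norm v < 2 \<and> v \<noteq> 0 \<and> norm \<sigma> < 1 \<and> norm e < 2 * \<epsilon> \<and> e \<noteq> 0"
  proof eventually_elim
    case (elim z)
    have "curve (\<sigma> z) (A z) (x z) (v z) (E z) = z"
    proof (rule curve_inverse)
      show "8 * (E z)\<^sup>2 = (z$1)\<^sup>2 + (z$2)\<^sup>2 + (z$3)\<^sup>2 + (z$4)\<^sup>2 + (z$5)\<^sup>2"
        by (simp add: E_def E2_def)
    qed (use elim in \<open>auto simp: A_def v_def x_def \<sigma>_def\<close>)
    then show ?case using elim
      by (intro exI[of _ "E z"] exI[of _ "A z"] exI[of _ "x z"] exI[of _ "v z"] exI[of _ "\<sigma> z"]) auto
  qed
  then show ?thesis by (simp only: z0_def)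
qed

text \<open>
  The cross product of \<open>l\<close> and \<open>m\<close> is a relation unless it vanishes. In that case the pairs \<open>(l 0, m 0)\<close> and
  \<open>(l 1, m 1)\<close> are already dependent.
\<close>

lemma three_vectors_in_plane:
  fixes l m :: "nat \<Rightarrow> complex"
  shows "\<exists>c. (\<exists>i<3. c i \<noteq> 0) \<and> (\<Sum>i<3. c i * l i) = 0 \<and> (\<Sum>i<3. c i * m i) = 0"
proof -
  have S: "(\<Sum>i<3. f i) = f 0 + f 1 + f 2" for f :: "nat \<Rightarrow> complex"
    by (simp add: eval_nat_numeral)
  define cr where "cr i = (if i = 0 then l 1 * m 2 - l 2 * m 1 else if i = 1 then l 2 * m 0 - l 0 * m 2
     else l 0 * m 1 - l 1 * m 0)" for i :: nat
  show ?thesis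
  proof (cases "\<exists>i<3. cr i \<noteq> 0")
    case True
    then show ?thesis by (intro exI[of _ cr]) (auto simp: S cr_def algebra_simps)
  next
    case False
    then have cr: "cr 0 = 0" "cr 1 = 0" "cr 2 = 0" by auto
    then have eq: "l 1 * m 2 = l 2 * m 1" "l 2 * m 0 = l 0 * m 2" "l 0 * m 1 = l 1 * m 0"
      by (auto simp: cr_def)
    have "\<exists>a b. (a \<noteq> 0 \<or> b \<noteq> 0) \<and> a * l 0 + b * l 1 = 0 \<and> a * m 0 + b * m 1 = 0"
    proof (cases "l 0 = 0 \<and> l 1 = 0")
      case True
      show ?thesis
      proof (cases "m 0 = 0 \<and> m 1 = 0")
        case True
        then show ?thesis using \<open>l 0 = 0 \<and> l 1 = 0\<close> by (intro exI[of _ 1] exI[of _ 1]) simp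
      next
        case False
        then show ?thesis using \<open>l 0 = 0 \<and> l 1 = 0\<close>
          by (intro exI[of _ "m 1"] exI[of _ "- m 0"]) auto
      qed
    next
      case False
      then show ?thesis using eq(3)
        by (intro exI[of _ "l 1"] exI[of _ "- l 0"]) (auto simp: algebra_simps)
    qed
    then obtain a b where ab: "a \<noteq> 0 \<or> b \<noteq> 0" "a * l 0 + b * l 1 = 0" "a * m 0 + b * m 1 = 0" by blast
    show ?thesis
      by (intro exI[of _ "\<lambda>i. if i = 0 then a else if i = 1 then b else 0"])
         (use ab in \<open>auto simp: S intro: exI[of _ 0] exI[of _ 1]\<close>)
  qed
qed

section \<open>The number of first integrals\<close>

lemma nonzero_open:
  assumes h: "mv_holomorphic_on h (ball p r)" and q: "q \<in> ball p r" "h q \<noteq> 0"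
    and W: "open W" "W \<subseteq> ball p r" "W \<noteq> {}"
  shows "open {z \<in> W. h z \<noteq> 0}" "{z \<in> W. h z \<noteq> 0} \<noteq> {}"
proof -
  have "continuous_on W h"
    using mv_holomorphic_continuous[OF h] W(2) by (rule continuous_on_subset)
  then show "open {z \<in> W. h z \<noteq> 0}"
    using continuous_open_preimage[OF _ W(1) open_Compl[OF closed_singleton], of h 0]
    by (simp add: vimage_def Int_def)
  obtain z where "z \<in> W" using W(3) by blast
  then show "{z \<in> W. h z \<noteq> 0} \<noteq> {}"
    using mv_holomorphic_nonzero_dense[OF h q W(1)] W(2) by blast
qed

text \<open>
  All curves from the given level set with parameters in the stated ranges stay in the ball, so \<open>no_separating_integral\<close>
  makes \<open>f\<close> constant on the part of the level set near \<open>z\<close>, and \<open>gradient_in_span\<close> applies.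
\<close>

lemma first_integral_gradient:
  fixes f g h :: "complex ^ 5 \<Rightarrow> complex"
  assumes fi: "meromorphic_first_integral karabut f"
    and g: "mv_holomorphic_on g (ball 0 r)" and h: "mv_holomorphic_on h (ball 0 r)" and r: "r > 0"
    and f: "\<And>z. z \<in> ball 0 r \<Longrightarrow> h z \<noteq> 0 \<Longrightarrow> f z = g z / h z"
    and \<epsilon>: "4000 * \<epsilon> < r" "2 * \<epsilon> < 1"
    and z: "z = curve \<sigma> A x v e" "z \<in> ball 0 r" "h z \<noteq> 0"
    and p: "1/2 < norm A" "norm A < 2" "norm x < 1" "norm v < 2" "v \<noteq> 0" "norm \<sigma> < 1" "norm e < 2 * \<epsilon>" "e \<noteq> 0"
  shows "\<exists>l \<mu>. \<forall>i. cpartial i f z = l + \<mu> * z $ i"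
proof -
  have A0: "A \<noteq> 0" using p by auto
  have rel: "dir_deriv g y (karabut y) * h y = g y * dir_deriv h y (karabut y)" if y: "y \<in> ball 0 r" "h y \<noteq> 0" for y
  proof -
    have "mv_analytic_at f y" by (rule dir_deriv_quotient(1)[OF g h _ y f]) auto
    then have "dir_deriv f y (karabut y) = 0" using fi by (simp add: meromorphic_first_integral_def dir_deriv_def)
    then show ?thesis using dir_deriv_quotient(2)[OF g h _ y f, of "karabut y"] by simp
  qed
  have near: "f (curve \<sigma> A' x' v' e) = f z"
    if p': "1/2 < norm A'" "norm A' < 2" "norm x' < 1" "norm v' < 2" and h': "h (curve \<sigma> A' x' v' e) \<noteq> 0" for A' x' v'
  proof -
    have b: "curve \<sigma> a y u \<epsilon>' \<in> ball 0 r"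
      if "1/2 < norm a" "norm a < 2" "norm y < 1" "norm u < 2" "\<epsilon>' \<in> ball 0 (2 * \<epsilon>)" for a y u \<epsilon>'
    proof -
      have "norm (curve \<sigma> a y u \<epsilon>') \<le> 2000 * norm \<epsilon>'"
        using that \<epsilon>(2) p(6) by (intro curve_norm_le) auto
      then show ?thesis using that(5) \<epsilon>(1) by simp
    qed
    have "g (curve \<sigma> A x v e) * h (curve \<sigma> A' x' v' e) = g (curve \<sigma> A' x' v' e) * h (curve \<sigma> A x v e)"
    proof (rule no_separating_integral[OF g h r _ rel A0])
      show "\<exists>q\<in>ball 0 r. h q \<noteq> 0" using z by blast
      show "A' \<noteq> 0" using p' by auto
      show "e \<in> ball 0 (2 * \<epsilon>)" using p by simp
    qed (use b p p' in auto)
    then have eq: "g z * h (curve \<sigma> A' x' v' e) = g (curve \<sigma> A' x' v' e) * h z"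
      unfolding z(1)[symmetric] .
    have "curve \<sigma> A' x' v' e \<in> ball 0 r" using b p' p by simp
    then have f': "f (curve \<sigma> A' x' v' e) = g (curve \<sigma> A' x' v' e) / h (curve \<sigma> A' x' v' e)"
      using h' by (rule f)
    show ?thesis unfolding f' f[OF z(2,3)] by (rule frac_eq_eq[OF h' z(3), THEN iffD2]) (rule eq[symmetric])
  qed
  have hU: "open {z \<in> ball 0 r. h z \<noteq> 0}"
  proof (rule nonzero_open(1)[OF h z(2,3)])
    show "ball 0 r \<noteq> ({} :: (complex ^ 5) set)" using z(2) by blast
  qed simp_all
  have h_ne: "\<forall>\<^sub>F t in nhds t0. h (\<gamma> t) \<noteq> 0" if "isCont \<gamma> t0" "\<gamma> t0 = z" for \<gamma> :: "complex \<Rightarrow> complex ^ 5" and t0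
  proof -
    have "(\<gamma> \<longlongrightarrow> z) (nhds t0)" using that unfolding isCont_def tendsto_at_iff_tendsto_nhds by simp
    then have "\<forall>\<^sub>F t in nhds t0. \<gamma> t \<in> {z \<in> ball 0 r. h z \<noteq> 0}"
      using hU z by (intro topological_tendstoD) auto
    then show ?thesis by (rule eventually_mono) simp
  qed
  have cvec: "isCont \<gamma> t0" if "\<And>i. isCont (\<lambda>t. \<gamma> t $ i) t0" for \<gamma> :: "complex \<Rightarrow> complex ^ 5" and t0
    using that unfolding isCont_def by (rule vec_tendstoI)
  have bnd: "\<forall>\<^sub>F t in nhds t0. norm t < c" if "norm t0 < c" for t0 :: complex and c
    using that by (intro order_tendstoD(2)[OF tendsto_norm[OF filterlim_ident]])
  have bnd': "\<forall>\<^sub>F t in nhds t0. c < norm t" if "c < norm t0" for t0 :: complex and c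
    using that by (intro order_tendstoD(1)[OF tendsto_norm[OF filterlim_ident]])
  show ?thesis
  proof (rule gradient_in_span[OF _ z(1) A0 p(8) p(5)])
    show "mv_analytic_at f z" by (rule dir_deriv_quotient(1)[OF g h _ z(2,3) f]) auto
    have "isCont (\<lambda>t. curve \<sigma> t x v e) A"
      by (rule cvec, rule DERIV_isCont[OF curve_derivatives(1)[OF A0]])
    then have "\<forall>\<^sub>F t in nhds A. h (curve \<sigma> t x v e) \<noteq> 0" by (rule h_ne) (simp add: z)
    with bnd[OF p(2)] bnd'[OF p(1)] show "\<forall>\<^sub>F t in nhds A. f (curve \<sigma> t x v e) = f z"
      by eventually_elim (use near p in auto)
    have "isCont (\<lambda>t. curve \<sigma> A t v e) x"
      by (rule cvec, rule DERIV_isCont[OF curve_derivatives(2)[OF A0]])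
    then have "\<forall>\<^sub>F t in nhds x. h (curve \<sigma> A t v e) \<noteq> 0" by (rule h_ne) (simp add: z)
    with bnd[OF p(3)] show "\<forall>\<^sub>F t in nhds x. f (curve \<sigma> A t v e) = f z"
      by eventually_elim (use near p in auto)
    have "isCont (\<lambda>t. curve \<sigma> A x t e) v"
      by (rule cvec, rule DERIV_isCont[OF curve_derivatives(3)[OF A0]])
    then have "\<forall>\<^sub>F t in nhds v. h (curve \<sigma> A x t e) \<noteq> 0" by (rule h_ne) (simp add: z)
    with bnd[OF p(4)] show "\<forall>\<^sub>F t in nhds v. f (curve \<sigma> A x t e) = f z"
      by eventually_elim (use near p in auto)
  qed
qed

text \<open>
  Represent three of the integrals as quotients on a common ball at the origin. In the open set swept out by the curves, choose a point
  of the dense set on which the gradients are independent, off the zeros of the denominators. There the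
  three gradients lie in a plane.
\<close>

lemma at_most_two_integrals:
  assumes fi: "\<And>i. i < k \<Longrightarrow> meromorphic_first_integral karabut (\<Phi> i)"
    and ind: "functionally_independent k \<Phi>"
  shows "k \<le> 2"
proof (rule ccontr)
  assume "\<not> k \<le> 2"
  then have k: "3 \<le> k" by simp
  obtain U where U: "open U" "closure U = UNIV"
    "\<And>z c. z \<in> U \<Longrightarrow> (\<Sum>i<k. c i *s cgrad (\<Phi> i) z) = 0 \<Longrightarrow> (\<forall>i<k. c i = 0)"
    using ind unfolding functionally_independent_def by blast
  define R where "R i s g h \<longleftrightarrow> s > 0 \<and> mv_holomorphic_on g (ball 0 s) \<and> mv_holomorphic_on h (ball 0 s) \<and>
        (\<exists>z\<in>ball 0 s. h z \<noteq> 0) \<and> (\<forall>z\<in>ball 0 s. h z \<noteq> 0 \<longrightarrow> \<Phi> i z = g z / h z)" for i s g h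
  have "\<exists>s g h. R i s g h" if "i < 3" for i
  proof -
    have "mv_meromorphic_on (\<Phi> i) UNIV"
      using fi[of i] k that by (simp add: meromorphic_first_integral_def)
    from this[unfolded mv_meromorphic_on_def, rule_format, of 0] show ?thesis
      unfolding R_def by blast
  qed
  then obtain s g h where R: "\<And>i. i < 3 \<Longrightarrow> R i (s i) (g i) (h i)" by metis
  have s: "\<And>i. i < 3 \<Longrightarrow> s i > 0"
    and g: "\<And>i. i < 3 \<Longrightarrow> mv_holomorphic_on (g i) (ball 0 (s i))"
    and h: "\<And>i. i < 3 \<Longrightarrow> mv_holomorphic_on (h i) (ball 0 (s i))"
    and nz: "\<And>i. i < 3 \<Longrightarrow> \<exists>z\<in>ball 0 (s i). h i z \<noteq> 0"
    and f: "\<And>i z. i < 3 \<Longrightarrow> z \<in> ball 0 (s i) \<Longrightarrow> h i z \<noteq> 0 \<Longrightarrow> \<Phi> i z = g i z / h i z"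
    using R unfolding R_def by blast+
  define r where "r = Min (s ` {..<3})"
  have r: "r > 0" unfolding r_def using s by (subst Min_gr_iff) (auto simp: lessThan_empty_iff)
  have rs: "ball 0 r \<subseteq> (ball 0 (s i) :: (complex ^ 5) set)" if "i < 3" for i
  proof -
    have "r \<le> s i" unfolding r_def using that by (intro Min_le) auto
    then show ?thesis by (rule subset_ball)
  qed
  \<comment> \<open>Curves up to the parameter 2 \<epsilon> stay within norm 4000 \<epsilon>, provided that 2 \<epsilon> is less than 1.\<close>
  define \<epsilon> where "\<epsilon> = min (1/4) (r / 8000)"
  have \<epsilon>: "0 < \<epsilon>" "4000 * \<epsilon> < r" "2 * \<epsilon> < 1" using r by (auto simp: \<epsilon>_def)
  define z0 where "z0 = curve 0 1 0 1 (of_real \<epsilon>)"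
  have "norm z0 \<le> 2000 * norm (complex_of_real \<epsilon>)"
    unfolding z0_def using \<epsilon> by (intro curve_norm_le) auto
  then have z0: "z0 \<in> ball 0 r" using \<epsilon> by simp
  have "\<exists>N. open N \<and> z0 \<in> N \<and> (\<forall>z\<in>N. \<exists>e A x v \<sigma>. z = curve \<sigma> A x v e \<and> 1/2 < norm A \<and> norm A < 2
     \<and> norm x < 1 \<and> norm v < 2 \<and> v \<noteq> 0 \<and> norm \<sigma> < 1 \<and> norm e < 2 * \<epsilon> \<and> e \<noteq> 0)"
    using parameters_near_reference[OF \<epsilon>(1)] unfolding z0_def eventually_nhds .
  then obtain N where N: "open N" "z0 \<in> N" and param: "\<forall>z\<in>N. \<exists>e A x v \<sigma>. z = curve \<sigma> A x v e \<and> 1/2 < norm A \<and> norm A < 2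
     \<and> norm x < 1 \<and> norm v < 2 \<and> v \<noteq> 0 \<and> norm \<sigma> < 1 \<and> norm e < 2 * \<epsilon> \<and> e \<noteq> 0"
    by (elim exE conjE)
  define W where "W = N \<inter> ball 0 r \<inter> U"
  have W: "open W" "W \<subseteq> ball 0 r" using N U by (auto simp: W_def)
  have "W \<noteq> {}"
  proof -
    have "N \<inter> ball 0 r \<noteq> {}" "open (N \<inter> ball 0 r)" using N z0 by auto
    then show ?thesis using open_Int_closure_eq_empty[of "N \<inter> ball 0 r" U] U(2) by (simp add: W_def)
  qed
  have step: "open {z \<in> V. h i z \<noteq> 0} \<and> {z \<in> V. h i z \<noteq> 0} \<noteq> {}"
    if i: "i < 3" and V: "open V" "V \<subseteq> ball 0 r" "V \<noteq> {}" for i V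
  proof -
    obtain q where q: "q \<in> ball 0 (s i)" "h i q \<noteq> 0" using nz[OF i] by blast
    have "V \<subseteq> ball 0 (s i)" using V(2) rs[OF i] by blast
    from nonzero_open[OF h[OF i] q V(1) this V(3)] show ?thesis by blast
  qed
  define W1 where "W1 = {z \<in> W. h 0 z \<noteq> 0}"
  define W2 where "W2 = {z \<in> W1. h 1 z \<noteq> 0}"
  have W1: "open W1" "W1 \<noteq> {}" "W1 \<subseteq> ball 0 r"
    using step[of 0 W] W \<open>W \<noteq> {}\<close> by (auto simp: W1_def)
  have W2: "open W2" "W2 \<noteq> {}" "W2 \<subseteq> ball 0 r"
    using step[of 1 W1] W1 by (auto simp: W2_def)
  obtain z where z: "z \<in> W2" "h 2 z \<noteq> 0" using step[of 2 W2] W2 by auto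
  have zW: "z \<in> W" and hz: "\<And>i. i < 3 \<Longrightarrow> h i z \<noteq> 0"
    using z by (auto simp: W1_def W2_def less_Suc_eq numeral_3_eq_3 numeral_2_eq_2)
  obtain e A x v \<sigma> where p: "z = curve \<sigma> A x v e" "1/2 < norm A" "norm A < 2"
     "norm x < 1" "norm v < 2" "v \<noteq> 0" "norm \<sigma> < 1" "norm e < 2 * \<epsilon>" "e \<noteq> 0"
  proof -
    have "z \<in> N" using zW by (simp add: W_def)
    from param[rule_format, OF this] show thesis by (elim exE conjE) (rule that)
  qed
  have "\<exists>l \<mu>. \<forall>j. cpartial j (\<Phi> i) z = l + \<mu> * z $ j" if i: "i < 3" for i
  proof -
    have fi': "meromorphic_first_integral karabut (\<Phi> i)" using fi i k by simp
    have zr: "z \<in> ball 0 r" using zW by (simp add: W_def)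
    have f': "\<Phi> i y = g i y / h i y" if "y \<in> ball 0 r" "h i y \<noteq> 0" for y
      using f[OF i] rs[OF i] that by blast
    show ?thesis
      by (rule first_integral_gradient[where g = "g i" and h = "h i",
            OF fi' mv_holomorphic_on_subset[OF g[OF i] rs[OF i]] mv_holomorphic_on_subset[OF h[OF i] rs[OF i]]
              r f' \<epsilon>(2,3) p(1) zr hz[OF i] p(2-9)])
  qed
  then obtain l \<mu> where grad: "\<And>i j. i < 3 \<Longrightarrow> cpartial j (\<Phi> i) z = l i + \<mu> i * z $ j" by metis
  obtain c where c: "\<exists>i<3. c i \<noteq> 0" "(\<Sum>i<3. c i * l i) = 0" "(\<Sum>i<3. c i * \<mu> i) = 0"
    using three_vectors_in_plane by blast
  define c' where "c' i = (if i < 3 then c i else 0)" for i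
  have "(\<Sum>i<k. c' i *s cgrad (\<Phi> i) z) = 0"
  proof -
    have "(\<Sum>i<k. c' i *s cgrad (\<Phi> i) z) = (\<Sum>i<3. c' i *s cgrad (\<Phi> i) z)"
      using k by (intro sum.mono_neutral_right) (auto simp: c'_def)
    also have "\<dots> = 0"
      unfolding vec_eq_iff
    proof
      fix j
      have "(\<Sum>i<3. c' i *s cgrad (\<Phi> i) z) $ j = (\<Sum>i<3. c i * l i + (c i * \<mu> i) * z $ j)"
        unfolding sum_component
        by (intro sum.cong) (auto simp: c'_def cgrad_def grad algebra_simps)
      also have "\<dots> = (\<Sum>i<3. c i * l i) + (\<Sum>i<3. c i * \<mu> i) * z $ j"
        by (simp only: sum.distrib sum_distrib_right)
      finally show "(\<Sum>i<3. c' i *s cgrad (\<Phi> i) z) $ j = 0 $ j" using c by simp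
    qed
    finally show ?thesis .
  qed
  then have c0: "\<forall>i<k. c' i = 0" using U(3) zW by (auto simp: W_def)
  obtain i where "i < 3" "c i \<noteq> 0" using c(1) by blast
  then show False using c0 k by (auto simp: c'_def dest: spec[of _ i])
qed

lemma mv_holomorphic_meromorphic:
  assumes "mv_holomorphic_on f UNIV"
  shows "mv_meromorphic_on f UNIV"
  unfolding mv_meromorphic_on_def
proof
  fix p :: "complex ^ 'a"
  have "mv_holomorphic_on (\<lambda>_. 1) (ball p 1)"
    unfolding mv_holomorphic_on_def by (auto intro!: exI[of _ "\<lambda>_. 0"])
  moreover have "mv_holomorphic_on f (ball p 1)"
    using assms by (rule mv_holomorphic_on_subset) simp
  ultimately
  show "\<exists>r>0. \<exists>g h. ball p r \<subseteq> UNIV \<and> mv_holomorphic_on g (ball p r) \<and> mv_holomorphic_on h (ball p r) \<and>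
      (\<exists>z\<in>ball p r. h z \<noteq> 0) \<and> (\<forall>z\<in>ball p r. h z \<noteq> 0 \<longrightarrow> f z = g z / h z)"
  proof (intro exI conjI)
    show "(0::real) < 1" by simp
    show "mv_holomorphic_on f (ball p 1)" by fact
    show "mv_holomorphic_on (\<lambda>_. 1) (ball p 1)" by fact
  qed (auto intro: exI[of _ p])
qed

lemma two_integrals:
  "\<exists>\<Phi>. (\<forall>i<2. meromorphic_first_integral karabut (\<Phi> i)) \<and> functionally_independent 2 \<Phi>"
proof -
  define L Q :: "complex ^ 5 \<Rightarrow> complex" where "L z = (\<Sum>i\<in>UNIV. z $ i)" and "Q z = (\<Sum>i\<in>UNIV. (z $ i)\<^sup>2)" for z
  have bl: "((\<lambda>z. z $ i) has_derivative (\<lambda>v. v $ i)) (at z)" for z :: "complex ^ 5" and i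
    by (intro bounded_linear_imp_has_derivative bounded_linear_vec_nth)
  have dL: "(L has_derivative (\<lambda>v. \<Sum>i\<in>UNIV. v $ i)) (at z)" for z
    unfolding L_def by (intro has_derivative_sum bl)
  have dQ: "(Q has_derivative (\<lambda>v. \<Sum>i\<in>UNIV. 2 * z $ i * v $ i)) (at z)" for z
    unfolding Q_def power2_eq_square
    by (rule has_derivative_eq_rhs[OF has_derivative_sum[OF has_derivative_mult[OF bl bl]]])
       (auto simp: algebra_simps)
  have sL: "(\<Sum>i\<in>UNIV. (c *s v) $ i) = c * (\<Sum>i\<in>UNIV. v $ i)" for c :: complex and v :: "complex ^ 5"
    by (simp add: sum_distrib_left)
  have sQ: "(\<Sum>i\<in>UNIV. 2 * z $ i * (c *s v) $ i) = c * (\<Sum>i\<in>UNIV. 2 * z $ i * v $ i)" for c :: complex and z v :: "complex ^ 5"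
    by (simp add: sum_distrib_left mult_ac)
  have cL: "cpartial i L z = 1" for i z
    using cpartial_eq[OF dL sL] by (simp add: axis_def)
  have cQ: "cpartial i Q z = 2 * z $ i" for i z
    using cpartial_eq[OF dQ sQ] by (simp add: axis_def if_distrib cong: if_cong)
  have hL: "mv_holomorphic_on L U" and hQ: "mv_holomorphic_on Q U" for U
    unfolding mv_holomorphic_on_def using dL sL dQ sQ by blast+
  define \<Phi> where "\<Phi> i = (if i = 0 then L else Q)" for i :: nat
  have "meromorphic_first_integral karabut (\<Phi> i)" for i
    using mv_holomorphic_meromorphic[OF hL] mv_holomorphic_meromorphic[OF hQ]
    by (auto simp: meromorphic_first_integral_def \<Phi>_def cL cQ sum_5 karabut_nth algebra_simps)
  moreover have "functionally_independent 2 \<Phi>"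
    unfolding functionally_independent_def
  proof (intro exI[of _ "{z :: complex ^ 5. z $ 1 \<noteq> z $ 2}"] conjI ballI allI impI)
    show "open {z :: complex ^ 5. z $ 1 \<noteq> z $ 2}"
      by (intro open_Collect_neq continuous_intros)
    have "z \<in> closure {z :: complex ^ 5. z $ 1 \<noteq> z $ 2}" for z :: "complex ^ 5"
      unfolding closure_approachable
    proof (intro allI impI)
      fix \<delta> :: real assume "\<delta> > 0"
      show "\<exists>y\<in>{z :: complex ^ 5. z $ 1 \<noteq> z $ 2}. dist y z < \<delta>"
      proof (cases "z $ 1 = z $ 2")
        case True
        have "dist (upd z 1 (z $ 1 + of_real (\<delta> / 2))) (upd z 1 (z $ 1)) = \<delta> / 2"
          unfolding dist_upd_same using \<open>\<delta> > 0\<close> by (simp add: dist_norm del: of_real_divide)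
        then have "dist (upd z 1 (z $ 1 + of_real (\<delta> / 2))) z < \<delta>"
          unfolding upd_id using \<open>\<delta> > 0\<close> by simp
        moreover have "upd z 1 (z $ 1 + of_real (\<delta> / 2)) \<in> {z. z $ 1 \<noteq> z $ 2}"
          using True \<open>\<delta> > 0\<close> by simp
        ultimately show ?thesis by blast
      qed (use \<open>\<delta> > 0\<close> in auto)
    qed
    then show "closure {z :: complex ^ 5. z $ 1 \<noteq> z $ 2} = UNIV" by blast
    fix z :: "complex ^ 5" assume z: "z \<in> {z. z $ 1 \<noteq> z $ 2}"
    show "mv_analytic_at (\<Phi> i) z" for i
      unfolding mv_analytic_at_def using hL hQ by (intro exI[of _ UNIV]) (auto simp: \<Phi>_def)
    fix c and i :: nat assume c: "(\<Sum>i<2. c i *s cgrad (\<Phi> i) z) = 0" and "i < 2"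
    have "c 0 + c 1 * (2 * z $ j) = 0" for j
      using arg_cong[OF c, of "\<lambda>u. u $ j"] by (simp add: eval_nat_numeral \<Phi>_def cgrad_def cL cQ)
    from this[of 1] this[of 2] have e: "c 0 + c 1 * (2 * z $ 1) = 0" "c 0 + c 1 * (2 * z $ 2) = 0" .
    then have "c 1 * (2 * z $ 1) = c 1 * (2 * z $ 2)" by (metis add_left_cancel)
    then have "c 1 = 0" using z by simp
    then show "c i = 0" using e \<open>i < 2\<close> by (auto simp: less_2_cases_iff)
  qed
  ultimately show ?thesis by blast
qed

theorem theorem3:
  "(\<exists>\<Phi>. (\<forall>i<2. meromorphic_first_integral karabut (\<Phi> i)) \<and> functionally_independent 2 \<Phi>) \<and>
   (\<forall>k \<Phi>. (\<forall>i<k. meromorphic_first_integral karabut (\<Phi> i)) \<and> functionally_independent k \<Phi>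
      \<longrightarrow> k \<le> 2)"
  using two_integrals at_most_two_integrals by blast

end
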